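(* Let $\Omega$, $\mathcal O$, $g$, $\Omega_n$, $\mathcal O_n$, $\mathbf g_n$, $\delta_n$, $\eta$ be as in the context, let $h=h_n>0$, and let the kernel, domain and data assumptions stated there hold. Let $\mathbf u_n:\Omega_n\to\mathbb R$ solve the graph infinity Laplacian equation with bandwidth $h_n$ and labels $\mathbf g_n$ on $\mathcal O_n$, let $u:\overline\Omega\to\mathbb R$ be an absolutely minimizing Lipschitz extension of $g$, and let $u_n=\mathbf u_n\circ\pi_n$ be the piecewise constant extension of $\mathbf u_n$. If $\delta_n\ll h_n\ll\varepsilon$ for every fixed $\varepsilon>0$, i.e. $\delta_n/h_n\to0$ and $h_n\to0$ as $n\to\infty$, then $u_n\to u$ uniformly on $\overline\Omega$ as $n\to\infty$.
   Context: Notation: $a\vee b=\max\{a,b\}$, $|\cdot|$ is the Euclidean norm, $a_n\ll b_n$ means $a_n/b_n\to0$ as $n\to\infty$. Domain. $\Omega\subset\mathbb R^d$ is an open bounded domain, and $d_\Omega(x,y)=\inf\{\int_0^1|\dot\xi(t)|\,dt:\ \xi\in C^1([0,1];\overline\Omega),\ \xi(0)=x,\ \xi(1)=y\}$ for $x,y\in\overline\Omega$. Topological notions (relatively open, connected, relative boundary $\partial^{\mathrm{rel}}$) refer to the metric space $(\overline\Omega,d_\Omega)$. Domain assumption: there are $\phi:[0,\infty)\to[0,\infty)$ with $\lim_{h\downarrow0}\phi(h)/h=0$ and $r_\Omega>0$ such that $d_\Omega(x,y)\le|x-y|+\phi(|x-y|)$ for all $x,y\in\Omega$ with $|x-y|\le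 r_\Omega$. Labels and point clouds. $\mathcal O\subset\overline\Omega$ is nonempty and closed, $\Omega_{\mathcal O}=\overline\Omega\setminus\mathcal O$, $g:\mathcal O\to\mathbb R$. For $n\in\mathbb N$, $\Omega_n\subset\overline\Omega$ is a finite point cloud, $\mathcal O_n\subset\Omega_n$ is nonempty, $\mathbf g_n:\mathcal O_n\to\mathbb R$. With $d_H(A,B)=\sup_{x\in A}\inf_{y\in B}|x-y|\vee\sup_{x\in B}\inf_{y\in A}|x-y|$, the graph resolution is $\delta_n=d_H(\Omega_n,\overline\Omega)\vee d_H(\mathcal O_n,\mathcal O)$. Closest point projections: $\pi_n(x)\in\operatorname{argmin}_{\mathbf x\in\Omega_n}|x-\mathbf x|$ for $x\in\overline\Omega$ and $\pi_{\mathcal O_n}(z)\in\operatorname{argmin}_{\mathbf z\in\mathcal O_n}|z-\mathbf z|$ for $z\in\mathcal O$. Kernel assumption: $\eta:(0,\infty)\to[0,\infty)$ is nonincreasing with $\operatorname{supp}\eta\subset[0,1]$, $\sigma_\eta:=\sup_{t>0}t\eta(t)\in(0,\infty)$, and there exists $t_0\in(0,1]$ (chosen as the largest number with this property) with $\sigma_\eta=t_0\eta(t_0)$. For $h>0$ set $\eta_h(t)=\frac1{\sigma_\eta h}\eta(t/h)$, with the convention $\eta(0)\cdot0=0$. Graph (with $h=h_n$). Weights on $\Omega_n$: $\mathbf w_n(\mathbf x,\mathbf y)=\eta_h(|\mathbf x-\mathbf y|)$ for $\mathbf x\ne\mathbf y$ and $0$ for $\mathbf x=\mathbf y$. Graph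 distance: $\mathbf d_n(\mathbf x,\mathbf x)=0$ and, for $\mathbf x\ne\mathbf y$, $\mathbf d_n(\mathbf x,\mathbf y)=\min\{\sum_{i=1}^N\mathbf w_n(\mathbf x_{i-1},\mathbf x_i)^{-1}\}$ over all $N\in\mathbb N$ and finite sequences in $\Omega_n$ with $\mathbf x_0=\mathbf x$, $\mathbf x_N=\mathbf y$ (with $0^{-1}=\infty$). $\operatorname{Lip}_n(\mathbf v;A)=\max_{\mathbf x\neq\mathbf y\in A}|\mathbf v(\mathbf x)-\mathbf v(\mathbf y)|/\mathbf d_n(\mathbf x,\mathbf y)$. Graph infinity Laplacian equation: $\min_{\mathbf y\in\Omega_n}\eta_h(|\mathbf x-\mathbf y|)(\mathbf u_n(\mathbf y)-\mathbf u_n(\mathbf x))+\max_{\mathbf y\in\Omega_n}\eta_h(|\mathbf x-\mathbf y|)(\mathbf u_n(\mathbf y)-\mathbf u_n(\mathbf x))=0$ for $\mathbf x\in\Omega_n\setminus\mathcal O_n$, and $\mathbf u_n=\mathbf g_n$ on $\mathcal O_n$. AMLE. $\operatorname{Lip}_\Omega(u;A)=\sup_{x\ne y\in A}|u(x)-u(y)|/d_\Omega(x,y)$. $u\in C(\overline\Omega)$ is an absolutely minimizing Lipschitz extension of $g$ if $u=g$ on $\mathcal O$ and $\operatorname{Lip}_\Omega(u;\overline V)=\operatorname{Lip}_\Omega(u;\partial^{\mathrm{rel}}V)$ for all relatively open and connected $V\subset\Omega_{\mathcal O}$. Data assumption: $\sup_n\operatorname{Lip}_n(\mathbf g_n;\mathcal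 O_n)<\infty$, $\operatorname{Lip}_\Omega(g;\mathcal O)<\infty$, and there is a constant $C_0>0$ with $|\mathbf g_n(\pi_{\mathcal O_n}(z))-g(z)|\le C_0\delta_n$ for all $z\in\mathcal O$ and all $n$. *)

theory Defs
  imports "HOL-Analysis.Analysis"
begin

section \<open>Geodesic distance of a domain\<close>

text \<open>
  Admissible curves are those in \<open>C\<^sup>1([0,1]; closure \<Omega>)\<close>. The two-sided derivatives at \<open>0\<close> and
  \<open>1\<close> required by \<open>C1_differentiable_on\<close> are no restriction: values of \<open>\<xi>\<close> outside \<open>[0,1]\<close> are
  unconstrained, so a curve with one-sided end derivatives can be continued along its tangents.
  The distance is \<open>\<infinity>\<close> if there is no admissible curve.
\<close>

definition geo_dist :: "'a::euclidean_space set \<Rightarrow> 'a \<Rightarrow> 'a \<Rightarrow> ennreal" where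
  "geo_dist \<Omega> x y =
     (INF \<xi>\<in>{\<xi>. \<xi> C1_differentiable_on {0..1} \<and> path_image \<xi> \<subseteq> closure \<Omega>
                \<and> pathstart \<xi> = x \<and> pathfinish \<xi> = y}.
        ennreal (integral {0..1} (\<lambda>t. norm (vector_derivative \<xi> (at t)))))"

text \<open>
  The topology of the metric space \<open>(closure \<Omega>, geo_dist \<Omega>)\<close>. For a nonempty connected open \<open>\<Omega>\<close>
  satisfying \<open>domain_assumption\<close> below, \<open>geo_dist \<Omega>\<close> is finite on \<open>closure \<Omega>\<close>, so the conversion
  to \<open>real\<close> loses nothing.
\<close>

definition geo_topology :: "'a::euclidean_space set \<Rightarrow> 'a topology" where
  "geo_topology \<Omega> = Metric_space.mtopology (closure \<Omega>) (\<lambda>x y. enn2real (geo_dist \<Omega> x y))"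

definition domain_assumption :: "'a::euclidean_space set \<Rightarrow> bool" where
  "domain_assumption \<Omega> \<longleftrightarrow>
     (\<exists>(\<phi> :: real \<Rightarrow> real) r. (\<forall>s\<ge>0. \<phi> s \<ge> 0) \<and> ((\<lambda>s. \<phi> s / s) \<longlongrightarrow> 0) (at_right 0) \<and> r > 0 \<and>
        (\<forall>x\<in>\<Omega>. \<forall>y\<in>\<Omega>. norm (x - y) \<le> r \<longrightarrow>
            geo_dist \<Omega> x y \<le> ennreal (norm (x - y) + \<phi> (norm (x - y)))))"


section \<open>Lipschitz constants and absolutely minimizing Lipschitz extensions\<close>

text \<open>
  Pairs at infinite distance contribute \<open>0\<close>, and the constant of a set with at most one point is \<open>0\<close>.
\<close>

definition lip_const :: "('a \<Rightarrow> 'a \<Rightarrow> ennreal) \<Rightarrow> ('a \<Rightarrow> real) \<Rightarrow> 'a set \<Rightarrow> ennreal" where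
  "lip_const d v A = (SUP (x, y)\<in>{(x, y). x \<in> A \<and> y \<in> A \<and> x \<noteq> y}. ennreal \<bar>v x - v y\<bar> / d x y)"

definition is_AMLE ::
  "'a::euclidean_space set \<Rightarrow> 'a set \<Rightarrow> ('a \<Rightarrow> real) \<Rightarrow> ('a \<Rightarrow> real) \<Rightarrow> bool" where
  "is_AMLE \<Omega> \<O> g u \<longleftrightarrow>
     continuous_on (closure \<Omega>) u \<and> (\<forall>z\<in>\<O>. u z = g z) \<and>
     (\<forall>V. V \<subseteq> closure \<Omega> - \<O> \<longrightarrow> openin (geo_topology \<Omega>) V \<longrightarrow> connectedin (geo_topology \<Omega>) V \<longrightarrow>
        lip_const (geo_dist \<Omega>) u (geo_topology \<Omega> closure_of V) =
        lip_const (geo_dist \<Omega>) u (geo_topology \<Omega> frontier_of V))"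


section \<open>Graph resolution\<close>

text \<open>Only used for nonempty bounded sets, where all suprema are those of bounded sets.\<close>

definition hausdorff_dist :: "'a::metric_space set \<Rightarrow> 'a set \<Rightarrow> real" where
  "hausdorff_dist A B = max (SUP x\<in>A. infdist x B) (SUP x\<in>B. infdist x A)"

definition graph_resolution ::
  "'a::euclidean_space set \<Rightarrow> 'a set \<Rightarrow> 'a set \<Rightarrow> 'a set \<Rightarrow> real" where
  "graph_resolution \<Omega> \<O> \<Omega>n \<O>n = max (hausdorff_dist \<Omega>n (closure \<Omega>)) (hausdorff_dist \<O>n \<O>)"


section \<open>Kernels and weighted graphs\<close>

text \<open>
  A kernel is a function on \<open>(0,\<infinity>)\<close>; its value at \<open>0\<close> is arbitrary and is only ever multiplied by \<open>0\<close>.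
\<close>

definition kernel_sigma :: "(real \<Rightarrow> real) \<Rightarrow> real" where
  "kernel_sigma \<eta> = (SUP t\<in>{0<..}. t * \<eta> t)"

definition kernel_assumption :: "(real \<Rightarrow> real) \<Rightarrow> bool" where
  "kernel_assumption \<eta> \<longleftrightarrow>
     (\<forall>t>0. \<eta> t \<ge> 0) \<and> antimono_on {0<..} \<eta> \<and> closure {t. t > 0 \<and> \<eta> t \<noteq> 0} \<subseteq> {0..1} \<and>
     bdd_above ((\<lambda>t. t * \<eta> t) ` {0<..}) \<and> kernel_sigma \<eta> > 0 \<and>
     (\<exists>t0\<in>{0<..1}. kernel_sigma \<eta> = t0 * \<eta> t0 \<and>
        (\<forall>t\<in>{0<..1}. kernel_sigma \<eta> = t * \<eta> t \<longrightarrow> t \<le> t0))"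

definition scaled_kernel :: "(real \<Rightarrow> real) \<Rightarrow> real \<Rightarrow> real \<Rightarrow> real" where
  "scaled_kernel \<eta> h t = 1 / (kernel_sigma \<eta> * h) * \<eta> (t / h)"

definition graph_weight ::
  "(real \<Rightarrow> real) \<Rightarrow> real \<Rightarrow> 'a::euclidean_space \<Rightarrow> 'a \<Rightarrow> real" where
  "graph_weight \<eta> h x y = (if x = y then 0 else scaled_kernel \<eta> h (norm (x - y)))"

text \<open>
  Here \<open>inverse 0 = \<infinity>\<close>. For a finite vertex set the infimum over the paths is attained.
\<close>

definition graph_dist ::
  "(real \<Rightarrow> real) \<Rightarrow> real \<Rightarrow> 'a::euclidean_space set \<Rightarrow> 'a \<Rightarrow> 'a \<Rightarrow> ennreal" where
  "graph_dist \<eta> h \<Omega>n x y =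
     (if x = y then 0
      else (INF (N, p)\<in>{(N :: nat, p :: nat \<Rightarrow> 'a). (\<forall>i\<le>N. p i \<in> \<Omega>n) \<and> p 0 = x \<and> p N = y}.
              \<Sum>i=1..N. inverse (ennreal (graph_weight \<eta> h (p (i - 1)) (p i)))))"

definition solves_graph_inf_laplace ::
  "(real \<Rightarrow> real) \<Rightarrow> real \<Rightarrow> 'a::euclidean_space set \<Rightarrow> 'a set \<Rightarrow> ('a \<Rightarrow> real) \<Rightarrow> ('a \<Rightarrow> real) \<Rightarrow> bool"
where
  "solves_graph_inf_laplace \<eta> h \<Omega>n \<O>n gn v \<longleftrightarrow>
     (\<forall>x\<in>\<Omega>n - \<O>n.
        (MIN y\<in>\<Omega>n. scaled_kernel \<eta> h (norm (x - y)) * (v y - v x)) +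
        (MAX y\<in>\<Omega>n. scaled_kernel \<eta> h (norm (x - y)) * (v y - v x)) = 0) \<and>
     (\<forall>x\<in>\<O>n. v x = gn x)"

definition closest_point_projection ::
  "'a::euclidean_space set \<Rightarrow> 'a set \<Rightarrow> ('a \<Rightarrow> 'a) \<Rightarrow> bool" where
  "closest_point_projection S P \<pi> \<longleftrightarrow> (\<forall>x\<in>S. is_arg_min (\<lambda>p. norm (x - p)) (\<lambda>p. p \<in> P) (\<pi> x))"

end

theory Submission
  imports Defs
begin

text \<open>
  The proof has two halves that meet in the notion of comparison with cones. Both halves
  bound a function on a ball of radius \<open>2 \<epsilon>\<close> around \<open>x\<close> that contains no label by the cone with vertex \<open>x\<close>
  through the value at \<open>x\<close> and the maximum on that ball. The only consequence that matters is the midpoint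
  inequality \<open>2 * u y \<le> u x + m\<close> for \<open>d x y \<le> \<epsilon>\<close>, where \<open>m\<close> bounds \<open>u\<close> on the ball of radius \<open>2 \<epsilon>\<close>
  (\<open>cone_subsolution\<close>).

  Uniqueness in the continuum: replacing \<open>u\<close> by its maximum over balls of radius \<open>\<epsilon>\<close> turns the midpoint
  inequality into a subsolution property for the finite difference infinity Laplacian
  (\<open>ball_max_midpoint\<close>), and for that equation an argument of Armstrong and Smart gives a comparison
  principle by looking at extreme points only (\<open>finite_difference_comparison\<close>). Letting \<open>\<epsilon>\<close> tend to zero,
  a subsolution that lies below a supersolution on the labels lies below it everywhere
  (\<open>cone_subsolution_comparison\<close>). An absolutely minimizing Lipschitz extension is both a sub- and a
  supersolution (\<open>is_AMLE_cone_subsolution\<close>): if it crossed a cone, it would be too steep on the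
  component where it lies above.

  Convergence: on the graph the same comparison with cones holds for the graph distance, because at a
  vertex where the solution exceeds a cone by the largest amount, it drops towards the vertex of the cone
  at least as fast as the cone, so by the equation it rises as fast elsewhere
  (\<open>graph_cone_comparison\<close>). This also yields a uniform Lipschitz bound for the graph solutions
  (\<open>solution_lipschitz\<close>). The scaling \<open>\<delta> n / h n \<longlonglongrightarrow> 0\<close> makes the graph distances converge
  uniformly to the geodesic distance (\<open>eventually_graph_dist_ge\<close>, \<open>eventually_graph_dist_le\<close>), so the pointwise
  upper limit of the graph solutions is a continuous subsolution with the right boundary values
  (\<open>asymptotic_cone\<close>, \<open>eventually_boundary\<close>). Hence it lies below the extension, and by compactness the
  estimate is uniform (\<open>asymptotic_comparison\<close>). Applying this to the negated functions gives the other half.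

  Underneath lies the fact that the geodesic distance makes the closure of the domain a compact length
  space with the Euclidean topology. The delicate points are that distances between boundary points
  are finite and asymptotically Euclidean, which requires joining infinitely many curves into one of
  class \<open>C\<^sup>1\<close> (\<open>geo_dist_to_closure\<close>).
\<close>

section \<open>Compact length spaces with an almost Euclidean distance\<close>

text \<open>
  The metric \<open>d\<close> dominates the ambient distance and agrees with it to first order at small scales, so
  both induce the same topology and the same notion of uniform continuity. All topological statements
  below therefore refer to the ambient distance, all quantitative ones to \<open>d\<close>.
\<close>

locale compact_near_isometric =
  fixes X :: "'a::metric_space set" and d :: "'a \<Rightarrow> 'a \<Rightarrow> real"
  assumes compact_space: "compact X"
    and d_refl: "x \<in> X \<Longrightarrow> d x x = 0"
    and d_sym: "x \<in> X \<Longrightarrow> y \<in> X \<Longrightarrow> d x y = d y x"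
    and d_triangle: "x \<in> X \<Longrightarrow> y \<in> X \<Longrightarrow> z \<in> X \<Longrightarrow> d x z \<le> d x y + d y z"
    and dist_le_d: "x \<in> X \<Longrightarrow> y \<in> X \<Longrightarrow> dist x y \<le> d x y"
    and d_near: "\<kappa> > 0 \<Longrightarrow> \<exists>\<rho>>0. \<forall>x\<in>X. \<forall>y\<in>X. dist x y < \<rho> \<longrightarrow> d x y \<le> (1 + \<kappa>) * dist x y"
begin

lemma d_nonneg: "x \<in> X \<Longrightarrow> y \<in> X \<Longrightarrow> 0 \<le> d x y"
  using dist_le_d[of x y] zero_le_dist[of x y] by linarith

lemma d_zero: "x \<in> X \<Longrightarrow> y \<in> X \<Longrightarrow> d x y = 0 \<Longrightarrow> x = y"
  using dist_le_d[of x y] by simp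

lemma d_small:
  assumes "e > 0"
  shows "\<exists>\<rho>>0. \<forall>x\<in>X. \<forall>y\<in>X. dist x y < \<rho> \<longrightarrow> d x y < e"
proof -
  obtain \<rho> where "\<rho> > 0" and \<rho>: "\<forall>x\<in>X. \<forall>y\<in>X. dist x y < \<rho> \<longrightarrow> d x y \<le> (1 + 1) * dist x y"
    using d_near[of 1] by auto
  have "d x y < e" if "x \<in> X" "y \<in> X" "dist x y < min \<rho> (e/2)" for x y
    using \<rho> that by fastforce
  then show ?thesis using \<open>\<rho> > 0\<close> assms by (intro exI[of _ "min \<rho> (e/2)"]) auto
qed

lemma continuous_on_if_d_modulus:
  fixes u :: "'a \<Rightarrow> real"
  assumes "\<And>e. e > 0 \<Longrightarrow> \<exists>\<rho>>0. \<forall>x\<in>X. \<forall>y\<in>X. d x y < \<rho> \<longrightarrow> \<bar>u x - u y\<bar> \<le> e"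
  shows "continuous_on X u"
  unfolding continuous_on_iff
proof (intro ballI allI impI)
  fix x e assume x: "x \<in> X" and e: "(0::real) < e"
  obtain \<rho> where "\<rho> > 0" and \<rho>: "\<forall>x\<in>X. \<forall>y\<in>X. d x y < \<rho> \<longrightarrow> \<bar>u x - u y\<bar> \<le> e/2"
    using assms[of "e/2"] e by auto
  obtain r where "r > 0" and r: "\<forall>x\<in>X. \<forall>y\<in>X. dist x y < r \<longrightarrow> d x y < \<rho>"
    using d_small[OF \<open>\<rho> > 0\<close>] by auto
  have "dist (u y) (u x) < e" if "y \<in> X" "dist y x < r" for y
    using \<rho> r that x e by (fastforce simp: dist_real_def)
  then show "\<exists>r>0. \<forall>y\<in>X. dist y x < r \<longrightarrow> dist (u y) (u x) < e"
    using \<open>r > 0\<close> by auto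
qed

lemma d_modulus_if_continuous_on:
  fixes u :: "'a \<Rightarrow> real"
  assumes "continuous_on X u" "e > 0"
  shows "\<exists>\<rho>>0. \<forall>x\<in>X. \<forall>y\<in>X. d x y < \<rho> \<longrightarrow> \<bar>u x - u y\<bar> < e"
proof -
  have "uniformly_continuous_on X u"
    using compact_uniformly_continuous assms(1) compact_space by blast
  then obtain \<rho> where "\<rho> > 0" and \<rho>: "\<forall>x\<in>X. \<forall>y\<in>X. dist y x < \<rho> \<longrightarrow> dist (u y) (u x) < e"
    using assms(2) unfolding uniformly_continuous_on_def by meson
  have "\<bar>u x - u y\<bar> < e" if "x \<in> X" "y \<in> X" "d x y < \<rho>" for x y
  proof -
    have "dist y x < \<rho>" using dist_le_d[of x y] that by (simp add: dist_commute)
    then show ?thesis using \<rho> that by (simp add: dist_real_def abs_minus_commute)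
  qed
  then show ?thesis using \<open>\<rho> > 0\<close> by auto
qed

lemma continuous_on_d: "x \<in> X \<Longrightarrow> continuous_on X (d x)"
proof (rule continuous_on_if_d_modulus)
  fix e :: real assume "x \<in> X" "e > 0"
  have "\<bar>d x y - d x z\<bar> \<le> e" if "y \<in> X" "z \<in> X" "d y z < e" for y z
    using d_triangle[of x y z] d_triangle[of x z y] d_sym[of y z] that \<open>x \<in> X\<close> by auto
  then show "\<exists>\<rho>>0. \<forall>y\<in>X. \<forall>z\<in>X. d y z < \<rho> \<longrightarrow> \<bar>d x y - d x z\<bar> \<le> e"
    using \<open>e > 0\<close> by auto
qed

lemma d_bounded: "\<exists>M>0. \<forall>x\<in>X. \<forall>y\<in>X. d x y \<le> M"
proof (cases "X = {}")
  case False
  then obtain x0 where x0: "x0 \<in> X" by blast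
  then obtain b where b: "b \<in> X" "\<And>y. y \<in> X \<Longrightarrow> d x0 y \<le> d x0 b"
    using continuous_attains_sup[OF compact_space False continuous_on_d] by blast
  have "d x y \<le> 2 * d x0 b + 1" if "x \<in> X" "y \<in> X" for x y
    using d_triangle[of x x0 y] d_sym[of x x0] b(2)[of x] b(2)[of y] that x0 by simp
  moreover have "2 * d x0 b + 1 > 0" using d_nonneg[OF x0 b(1)] by simp
  ultimately show ?thesis by blast
qed (auto intro: exI[of _ 1])

lemma mtopology_eq_top_of_set:
  assumes "Metric_space X d"
  shows "Metric_space.mtopology X d = top_of_set X"
proof -
  interpret M: Metric_space X d by fact
  show ?thesis
    unfolding topology_eq
  proof (intro allI)
    fix U
    have "(\<exists>r>0. M.mball x r \<subseteq> U) \<longleftrightarrow> (\<exists>e>0. \<forall>y\<in>X. dist y x < e \<longrightarrow> y \<in> U)" if x: "x \<in> X" for x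
    proof
      assume "\<exists>r>0. M.mball x r \<subseteq> U"
      then obtain r where r: "r > 0" "M.mball x r \<subseteq> U" by blast
      obtain \<rho> where "\<rho> > 0" "\<forall>x\<in>X. \<forall>y\<in>X. dist x y < \<rho> \<longrightarrow> d x y < r"
        using d_small[OF r(1)] by blast
      then show "\<exists>e>0. \<forall>y\<in>X. dist y x < e \<longrightarrow> y \<in> U"
        using x r(2) by (intro exI[of _ \<rho>]) (auto simp: dist_commute M.mball_def)
    next
      assume "\<exists>e>0. \<forall>y\<in>X. dist y x < e \<longrightarrow> y \<in> U"
      then obtain e where e: "e > 0" "\<And>y. y \<in> X \<Longrightarrow> dist y x < e \<Longrightarrow> y \<in> U" by blast
      have "y \<in> U" if "y \<in> M.mball x e" for y
        using that e(2)[of y] dist_le_d[of x y] by (auto simp: M.mball_def dist_commute)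
      then show "\<exists>r>0. M.mball x r \<subseteq> U" using e(1) by blast
    qed
    then show "openin M.mtopology U \<longleftrightarrow> openin (top_of_set X) U"
      unfolding M.openin_mtopology openin_euclidean_subtopology_iff by blast
  qed
qed

end

text \<open>
  Length spaces in a form that is easy to verify: infima of curve lengths only give approximate
  intermediate points. Compactness upgrades them to exact ones in \<open>d_between\<close>.
\<close>

locale compact_length_space = compact_near_isometric +
  assumes d_approx_between: "x \<in> X \<Longrightarrow> y \<in> X \<Longrightarrow> 0 \<le> s \<Longrightarrow> s \<le> d x y \<Longrightarrow> \<theta> > 0 \<Longrightarrow>
                      \<exists>z\<in>X. d x z = s \<and> d z y \<le> d x y - s + \<theta>"
begin

lemma d_between:
  assumes "x \<in> X" "y \<in> X" "0 \<le> s" "s \<le> d x y"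
  shows "\<exists>z\<in>X. d x z = s \<and> d z y = d x y - s"
proof -
  define K where "K = X \<inter> (X \<inter> d x -` {s})"
  have "closed (X \<inter> d x -` {s})"
    using continuous_closed_preimage[OF continuous_on_d[OF assms(1)] compact_imp_closed[OF compact_space]]
    by simp
  then have "compact K" unfolding K_def by (rule compact_Int_closed[OF compact_space])
  moreover have "continuous_on K (d y)"
    by (rule continuous_on_subset[OF continuous_on_d[OF assms(2)]]) (auto simp: K_def)
  moreover have "K \<noteq> {}" using d_approx_between[OF assms zero_less_one] by (auto simp: K_def)
  ultimately obtain z where z: "z \<in> K" "\<And>w. w \<in> K \<Longrightarrow> d y z \<le> d y w"
    using continuous_attains_inf[of K "d y"] by blast
  have zX: "z \<in> X" "d x z = s" using z(1) by (auto simp: K_def)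
  have "d z y \<le> d x y - s"
  proof (rule field_le_epsilon)
    fix e :: real assume "e > 0"
    then obtain w where w: "w \<in> X" "d x w = s" "d w y \<le> d x y - s + e"
      using d_approx_between[OF assms] by blast
    then have "d y z \<le> d y w" using z(2) by (auto simp: K_def)
    then show "d z y \<le> d x y - s + e"
      using w d_sym[of y z] d_sym[of y w] zX assms(2) by simp
  qed
  then show ?thesis using d_triangle[of x z y] zX assms by force
qed

definition dcball :: "'a \<Rightarrow> real \<Rightarrow> 'a set" where
  "dcball x r = {y\<in>X. d x y \<le> r}"

lemma mem_dcball: "y \<in> dcball x r \<longleftrightarrow> y \<in> X \<and> d x y \<le> r"
  by (simp add: dcball_def)

lemma dcball_center: "x \<in> X \<Longrightarrow> r \<ge> 0 \<Longrightarrow> x \<in> dcball x r"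
  by (simp add: mem_dcball d_refl)

lemma compact_dcball: "x \<in> X \<Longrightarrow> compact (dcball x r)"
proof -
  assume x: "x \<in> X"
  have "closed (X \<inter> d x -` {..r})"
    using continuous_closed_preimage[OF continuous_on_d[OF x] compact_imp_closed[OF compact_space]]
    by simp
  moreover have "dcball x r = X \<inter> (X \<inter> d x -` {..r})"
    by (auto simp: dcball_def)
  ultimately show ?thesis using compact_Int_closed[OF compact_space] by metis
qed

text \<open>
  This is where the length structure is needed: a ball of radius \<open>r + s\<close> is the \<open>s\<close>-neighbourhood of the
  ball of radius \<open>r\<close>.
\<close>

lemma between_dcball:
  assumes "x \<in> X" "y \<in> X" "d x y \<le> r + s" "0 \<le> r" "0 \<le> s"
  obtains z where "z \<in> X" "d x z \<le> r" "d z y \<le> s"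
proof (cases "d x y \<le> r")
  case True
  then show ?thesis using that[of y] assms d_refl by auto
next
  case False
  then show ?thesis using d_between[of x y r] assms that by force
qed

text \<open>
  A shortest path from \<open>x\<close> to \<open>y\<close> must enter \<open>V\<close> somewhere. In terms of distances: among the points of the
  metric interval between \<open>x\<close> and \<open>y\<close> that lie in \<open>closure V\<close>, one closest to \<open>x\<close> cannot belong to the open
  set \<open>V\<close>, because intermediate points slightly closer to \<open>x\<close> would belong to \<open>V\<close> as well.
\<close>

lemma entry_point:
  assumes V: "openin (top_of_set X) V" and y: "y \<in> V" and x: "x \<in> X - V"
  obtains p where "p \<in> X" "p \<in> closure V" "p \<notin> V" "d x p + d p y = d x y"
proof -
  have VX: "V \<subseteq> X" using V openin_imp_subset by blast
  then have yX: "y \<in> X" using y by auto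
  define T where "T = X \<inter> (\<lambda>w. d x w + d w y) -` {d x y} \<inter> closure V"
  have "continuous_on X (\<lambda>w. d x w + d y w)"
    using continuous_on_d x yX by (intro continuous_on_add) auto
  then have "continuous_on X (\<lambda>w. d x w + d w y)"
    by (rule continuous_on_eq) (use d_sym yX in auto)
  then have "closed (X \<inter> (\<lambda>w. d x w + d w y) -` {d x y})"
    using continuous_closed_preimage compact_imp_closed[OF compact_space] closed_singleton by blast
  then have "compact (X \<inter> (X \<inter> (\<lambda>w. d x w + d w y) -` {d x y} \<inter> closure V))"
    using compact_Int_closed[OF compact_space closed_Int[OF _ closed_closure]] by blast
  then have "compact T" unfolding T_def by (metis Int_assoc Int_absorb)
  moreover have "y \<in> T" using y yX closure_subset[of V] by (auto simp: T_def d_refl)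
  moreover have "continuous_on T (d x)"
    using x by (intro continuous_on_subset[OF continuous_on_d]) (auto simp: T_def)
  ultimately obtain p where pT: "p \<in> T" and pmin: "\<And>w. w \<in> T \<Longrightarrow> d x p \<le> d x w"
    using continuous_attains_inf[of T "d x"] by auto
  have p: "p \<in> X" "p \<in> closure V" "d x p + d p y = d x y" using pT by (auto simp: T_def)
  have "p \<notin> V"
  proof
    assume pV: "p \<in> V"
    then obtain r where "r > 0" and r: "\<And>w. w \<in> X \<Longrightarrow> dist w p < r \<Longrightarrow> w \<in> V"
      using V unfolding openin_euclidean_subtopology_iff by blast
    have "p \<noteq> x" using pV x by auto
    then have "d x p > 0" using d_zero[of x p] d_nonneg[of x p] p x by fastforce
    define s where "s = min (r/2) (d x p)"
    have s: "0 < s" "s \<le> d x p" "s < r" using \<open>r > 0\<close> \<open>d x p > 0\<close> by (auto simp: s_def)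
    obtain z where z: "z \<in> X" "d x z = d x p - s" "d z p = s"
      using d_between[of x p "d x p - s"] s p x by auto
    have "dist z p < r" using dist_le_d[of z p] z p s by auto
    then have zV: "z \<in> V" using r z by auto
    have "d z y \<le> s + d p y" using d_triangle[of z p y] z p yX by auto
    moreover have "d x y \<le> d x z + d z y" using d_triangle[of x z y] x z yX by auto
    ultimately have "d x z + d z y = d x y" using p z by auto
    then have "z \<in> T" using z zV closure_subset by (auto simp: T_def)
    then show False using pmin[of z] z s by auto
  qed
  then show ?thesis using that p by blast
qed

lemma openin_dball: "x \<in> X \<Longrightarrow> openin (top_of_set X) {y\<in>X. d x y < r}"
proof -
  assume "x \<in> X"
  then have "openin (top_of_set X) (X \<inter> d x -` {..<r})"
    by (intro continuous_openin_preimage_gen continuous_on_d) auto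
  moreover have "X \<inter> d x -` {..<r} = {y\<in>X. d x y < r}" by auto
  ultimately show ?thesis by simp
qed

text \<open>
  If an open part of a ball misses the centre, the entry point of a shortest path into that part
  belongs to the ball but to neither of two complementary open parts.
\<close>

lemma connected_dball:
  assumes x: "x \<in> X"
  shows "connected {y\<in>X. d x y < r}"
proof (rule ccontr)
  let ?B = "{y\<in>X. d x y < r}"
  assume "\<not> connected ?B"
  then obtain A1 A2 where A: "openin (top_of_set ?B) A1" "openin (top_of_set ?B) A2"
    "A1 \<union> A2 = ?B" "A1 \<inter> A2 = {}" "A1 \<noteq> {}" "A2 \<noteq> {}"
    unfolding connected_openin_eq by auto
  have *: False if A: "openin (top_of_set ?B) A1" "openin (top_of_set ?B) A2"
    "A1 \<union> A2 = ?B" "A1 \<inter> A2 = {}" "A2 \<noteq> {}" "x \<in> A1" for A1 A2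
  proof -
    have o: "openin (top_of_set X) A1" "openin (top_of_set X) A2"
      using A openin_dball[OF x, of r] openin_trans by blast+
    obtain y where y: "y \<in> A2" using A by auto
    obtain p where p: "p \<in> X" "p \<in> closure A2" "p \<notin> A2" "d x p + d p y = d x y"
      using entry_point[OF o(2) y, of x] x A by blast
    have "y \<in> X" "d x y < r" using y A by auto
    then have "d x p < r" using p d_nonneg[of p y] by auto
    then have "p \<in> A1" using p A by auto
    then obtain e where e: "e > 0" "\<And>w. w \<in> X \<Longrightarrow> dist w p < e \<Longrightarrow> w \<in> A1"
      using o(1) unfolding openin_euclidean_subtopology_iff by blast
    obtain w where "w \<in> A2" "dist w p < e" using p(2) e(1) closure_approachable by blast
    then show False using e(2)[of w] A by auto
  qed
  have "\<not> r \<le> 0"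
  proof
    assume "r \<le> 0"
    then have "?B = {}" using d_nonneg x by force
    then show False using A by auto
  qed
  then have "x \<in> ?B" using x d_refl by auto
  then show False using *[of A1 A2] *[of A2 A1] A by blast
qed

lemma locally_connected_space: "locally connected X"
proof (rule locallyI)
  fix W x assume W: "openin (top_of_set X) W" and "x \<in> W"
  then have x: "x \<in> X" using openin_imp_subset by blast
  obtain e where e: "e > 0" "\<And>w. w \<in> X \<Longrightarrow> dist w x < e \<Longrightarrow> w \<in> W"
    using W \<open>x \<in> W\<close> unfolding openin_euclidean_subtopology_iff by blast
  let ?B = "{y\<in>X. d x y < e}"
  have "?B \<subseteq> W"
  proof
    fix y assume "y \<in> ?B"
    then show "y \<in> W" using e(2)[of y] dist_le_d[OF x, of y] by (simp add: dist_commute)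
  qed
  then show "\<exists>U V. openin (top_of_set X) U \<and> connected V \<and> x \<in> U \<and> U \<subseteq> V \<and> V \<subseteq> W"
    using openin_dball[OF x, of e] connected_dball[OF x, of e] x e(1) d_refl[OF x]
    by (intro exI[of _ ?B] conjI) simp_all
qed

section \<open>Comparison with cones and the finite difference equation\<close>

definition ball_max :: "('a \<Rightarrow> real) \<Rightarrow> real \<Rightarrow> 'a \<Rightarrow> real" where
  "ball_max u r x = (SUP y\<in>dcball x r. u y)"

lemma ball_max_attained:
  assumes "continuous_on X u" "x \<in> X" "r \<ge> 0"
  obtains y where "y \<in> X" "d x y \<le> r" "ball_max u r x = u y" "\<And>z. z \<in> X \<Longrightarrow> d x z \<le> r \<Longrightarrow> u z \<le> u y"
proof -
  have "continuous_on (dcball x r) u"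
    by (rule continuous_on_subset[OF assms(1)]) (auto simp: dcball_def)
  moreover have "dcball x r \<noteq> {}" using dcball_center[OF assms(2,3)] by auto
  ultimately obtain y where y: "y \<in> dcball x r" "\<forall>z\<in>dcball x r. u z \<le> u y"
    using continuous_attains_sup[OF compact_dcball[OF assms(2)]] by meson
  then have "ball_max u r x = u y"
    unfolding ball_max_def by (intro cSup_eq_maximum) auto
  then show ?thesis using that[of y] y by (auto simp: mem_dcball)
qed

lemma ball_max_upper:
  assumes "continuous_on X u" "x \<in> X" "z \<in> X" "d x z \<le> r"
  shows "u z \<le> ball_max u r x"
proof -
  have "r \<ge> 0" using assms(2-4) d_nonneg[of x z] by auto
  then obtain y where "ball_max u r x = u y" "\<And>z. z \<in> X \<Longrightarrow> d x z \<le> r \<Longrightarrow> u z \<le> u y"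
    using ball_max_attained[OF assms(1,2), of r] by blast
  then show ?thesis using assms(3,4) by simp
qed

text \<open>
  A ball around \<open>x\<close> lies within distance \<open>d x y\<close> of the ball of the same radius around \<open>y\<close>, so \<open>ball_max\<close>
  inherits every modulus of continuity of \<open>u\<close>.
\<close>

lemma ball_max_modulus:
  assumes u: "continuous_on X u" and xy: "x \<in> X" "y \<in> X" and r: "r \<ge> 0"
    and m: "\<And>p q. p \<in> X \<Longrightarrow> q \<in> X \<Longrightarrow> d p q \<le> d x y \<Longrightarrow> \<bar>u p - u q\<bar> \<le> e"
  shows "ball_max u r x \<le> ball_max u r y + e"
proof -
  obtain p where p: "p \<in> X" "d x p \<le> r" "ball_max u r x = u p"
    using ball_max_attained[OF u xy(1) r] by blast
  have "d y p \<le> r + d x y" using d_triangle[of y x p] p xy d_sym[of x y] by auto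
  then obtain q where q: "q \<in> X" "d y q \<le> r" "d q p \<le> d x y"
    using between_dcball[of y p r "d x y"] p xy r d_nonneg by blast
  have "u q \<le> ball_max u r y" using ball_max_upper u xy q by auto
  moreover have "\<bar>u q - u p\<bar> \<le> e" using m q p by auto
  ultimately show ?thesis using p by auto
qed

lemma continuous_on_ball_max:
  assumes u: "continuous_on X u" and r: "r \<ge> 0"
  shows "continuous_on X (ball_max u r)"
proof (rule continuous_on_if_d_modulus)
  fix e :: real assume "e > 0"
  then obtain \<rho> where "\<rho> > 0" and \<rho>: "\<forall>x\<in>X. \<forall>y\<in>X. d x y < \<rho> \<longrightarrow> \<bar>u x - u y\<bar> < e"
    using d_modulus_if_continuous_on[OF u] by blast
  have "ball_max u r x \<le> ball_max u r y + e" if "x \<in> X" "y \<in> X" "d x y < \<rho>" for x y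
    using \<rho> that by (intro ball_max_modulus u r) (auto intro!: less_imp_le)
  note le = this
  have "\<bar>ball_max u r x - ball_max u r y\<bar> \<le> e" if "x \<in> X" "y \<in> X" "d x y < \<rho>" for x y
    using le[of x y] le[of y x] that d_sym[of x y] by linarith
  then show "\<exists>\<rho>>0. \<forall>x\<in>X. \<forall>y\<in>X. d x y < \<rho> \<longrightarrow> \<bar>ball_max u r x - ball_max u r y\<bar> \<le> e"
    using \<open>\<rho> > 0\<close> by blast
qed

text \<open>
  The instance of comparison with cones from above that survives in the limit: the cone with vertex \<open>x\<close>
  and slope \<open>(m - u x) / (2 * \<epsilon>)\<close> dominates \<open>u\<close> on the sphere of radius \<open>2 * \<epsilon>\<close> and has the value
  \<open>(u x + m) / 2\<close> at distance \<open>\<epsilon>\<close>. The set \<open>S\<close> contains the labelled points. Supersolutions are the functions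
  whose negative has the property.
\<close>

definition cone_subsolution :: "'a set \<Rightarrow> ('a \<Rightarrow> real) \<Rightarrow> bool" where
  "cone_subsolution S u \<longleftrightarrow> (\<forall>x\<in>X. \<forall>\<epsilon>>0. (\<forall>z\<in>S. d x z > 2 * \<epsilon>) \<longrightarrow>
     (\<forall>y\<in>X. d x y \<le> \<epsilon> \<longrightarrow> (\<forall>m. (\<forall>w\<in>X. d x w \<le> 2 * \<epsilon> \<longrightarrow> u w \<le> m) \<longrightarrow> 2 * u y \<le> u x + m)))"

text \<open>
  The Armstrong-Smart trick: maxima over balls of radius \<open>\<epsilon>\<close> satisfy an exact finite difference
  inequality. The iterated maximum on the right is the maximum of \<open>u\<close> over the ball of radius \<open>2 * \<epsilon>\<close>, and
  \<open>u x\<close> is below the maximum around any \<open>w\<close> with \<open>d x w \<le> \<epsilon>\<close>.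
\<close>

lemma ball_max_midpoint:
  assumes u: "continuous_on X u" and cc: "cone_subsolution S u" and e: "\<epsilon> > 0"
    and x: "x \<in> X" "\<forall>z\<in>S. d x z > 2 * \<epsilon>" and w: "w \<in> X" "d x w \<le> \<epsilon>"
  shows "2 * ball_max u \<epsilon> x \<le> ball_max u \<epsilon> w + ball_max (ball_max u \<epsilon>) \<epsilon> x"
proof -
  have cont: "continuous_on X (ball_max u \<epsilon>)" using continuous_on_ball_max u e by auto
  obtain y where y: "y \<in> X" "d x y \<le> \<epsilon>" "ball_max u \<epsilon> x = u y"
    using ball_max_attained[OF u x(1) less_imp_le[OF e]] by blast
  have "u p \<le> ball_max (ball_max u \<epsilon>) \<epsilon> x" if p: "p \<in> X" "d x p \<le> 2 * \<epsilon>" for p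
  proof -
    obtain q where q: "q \<in> X" "d x q \<le> \<epsilon>" "d q p \<le> \<epsilon>"
      using between_dcball[of x p \<epsilon> \<epsilon>] p x e by auto
    then have "u p \<le> ball_max u \<epsilon> q" using ball_max_upper u p by auto
    also have "\<dots> \<le> ball_max (ball_max u \<epsilon>) \<epsilon> x" using ball_max_upper[OF cont] q x by auto
    finally show ?thesis .
  qed
  then have "2 * u y \<le> u x + ball_max (ball_max u \<epsilon>) \<epsilon> x"
    using cc x e y unfolding cone_subsolution_def by blast
  moreover have "u x \<le> ball_max u \<epsilon> w"
    using ball_max_upper[OF u, of w x \<epsilon>] x w d_sym by auto
  ultimately show ?thesis using y by auto
qed

text \<open>
  Maximum principle for the difference of a subsolution \<open>p\<close> and a supersolution \<open>- q\<close> of the finite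
  difference equation on \<open>X - B\<close>. Among the maximum points of \<open>p + q\<close> outside \<open>B\<close>, consider those where \<open>p\<close> is
  largest. At such a point the two inequalities add up to an equality, which makes the best neighbour
  for \<open>p\<close> again a maximum point of \<open>p + q\<close>. Hence \<open>p\<close> cannot increase, and both functions are constant
  on the whole ball. So the set of these points is closed under steps of size \<open>\<epsilon>\<close> and reaches \<open>B\<close>.
\<close>

lemma finite_difference_comparison:
  assumes p: "continuous_on X p" and q: "continuous_on X q" and \<epsilon>: "\<epsilon> > 0"
    and sub: "\<And>x w. x \<in> X - B \<Longrightarrow> w \<in> X \<Longrightarrow> d x w \<le> \<epsilon> \<Longrightarrow> 2 * p x \<le> p w + ball_max p \<epsilon> x"
    and super: "\<And>x w. x \<in> X - B \<Longrightarrow> w \<in> X \<Longrightarrow> d x w \<le> \<epsilon> \<Longrightarrow> 2 * q x \<le> q w + ball_max q \<epsilon> x"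
    and B: "B \<subseteq> X" "B \<noteq> {}" and K: "\<And>x. x \<in> B \<Longrightarrow> p x + q x \<le> K" and x: "x \<in> X"
  shows "p x + q x \<le> K"
proof (rule ccontr)
  assume contr: "\<not> p x + q x \<le> K"
  have cpq: "continuous_on X (\<lambda>x. p x + q x)" using p q by (rule continuous_on_add)
  obtain a where a: "a \<in> X" "\<And>y. y \<in> X \<Longrightarrow> p y + q y \<le> p a + q a"
    using continuous_attains_sup[OF compact_space _ cpq] x by blast
  define M where "M = p a + q a"
  have M: "\<And>y. y \<in> X \<Longrightarrow> p y + q y \<le> M" and "M > K"
    using a(2) a(2)[OF x] contr by (auto simp: M_def)
  define E where "E = X \<inter> (X \<inter> (\<lambda>x. p x + q x) -` {M})"
  have "closed (X \<inter> (\<lambda>x. p x + q x) -` {M})"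
    by (intro continuous_closed_preimage cpq compact_imp_closed compact_space) auto
  then have "compact E" unfolding E_def by (intro compact_Int_closed compact_space)
  moreover have "continuous_on E p" by (rule continuous_on_subset[OF p]) (auto simp: E_def)
  moreover have "a \<in> E" using a by (auto simp: E_def M_def)
  ultimately obtain b where b: "b \<in> E" "\<And>y. y \<in> E \<Longrightarrow> p y \<le> p b"
    using continuous_attains_sup[of E p] by blast
  define F where "F = {y\<in>E. p y = p b}"
  have FX: "F \<subseteq> X" by (auto simp: F_def E_def)
  \<comment> \<open>\<open>F\<close> absorbs balls: the inequalities for \<open>p\<close> and \<open>q\<close> are tested at each other's best neighbours.\<close>
  have step: "w \<in> F" if y: "y \<in> F" and w: "w \<in> X" "d y w \<le> \<epsilon>" for y w
  proof -
    have yX: "y \<in> X" "p y + q y = M" "p y = p b" using y by (auto simp: F_def E_def)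
    then have yB: "y \<in> X - B" using K \<open>M > K\<close> by force
    obtain z where z: "z \<in> X" "d y z \<le> \<epsilon>" "ball_max p \<epsilon> y = p z"
        "\<And>w. w \<in> X \<Longrightarrow> d y w \<le> \<epsilon> \<Longrightarrow> p w \<le> p z"
      using ball_max_attained[OF p yX(1) less_imp_le[OF \<epsilon>]] by blast
    obtain z' where z': "z' \<in> X" "d y z' \<le> \<epsilon>" "ball_max q \<epsilon> y = q z'"
        "\<And>w. w \<in> X \<Longrightarrow> d y w \<le> \<epsilon> \<Longrightarrow> q w \<le> q z'"
      using ball_max_attained[OF q yX(1) less_imp_le[OF \<epsilon>]] by blast
    have s: "2 * p y \<le> p z' + p z" "2 * q y \<le> q z + q z'"
      using sub[OF yB z'(1,2)] super[OF yB z(1,2)] z z' by auto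
    have ub: "p z + q z \<le> M" "p z' + q z' \<le> M" using M z z' by auto
    have "z \<in> E" using s ub yX z by (auto simp: E_def)
    then have "p z \<le> p y" using b(2) yX by auto
    moreover have "p y \<le> p z" using z(4)[OF yX(1)] yX \<epsilon> d_refl by auto
    ultimately have pz: "p z = p y" by auto
    then have "q z' = q y" using s ub yX by auto
    then have "p w = p y" "q w = q y"
      using sub[OF yB w] super[OF yB w] z(3) z'(3) z(4)[OF w] z'(4)[OF w] pz by auto
    then show ?thesis using w yX by (auto simp: F_def E_def)
  qed
  have chain: "w \<in> F" if "y \<in> F" "w \<in> X" "d y w \<le> real n * \<epsilon>" for y w n
    using that
  proof (induction n arbitrary: w)
    case 0
    then have "w = y" using d_zero[of y w] d_nonneg[of y w] FX by auto
    then show ?case using 0 by auto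
  next
    case (Suc n)
    then have "d y w \<le> real n * \<epsilon> + \<epsilon>" by (simp add: algebra_simps)
    then obtain z where "z \<in> X" "d y z \<le> real n * \<epsilon>" "d z w \<le> \<epsilon>"
      using between_dcball[of y w "real n * \<epsilon>" \<epsilon>] Suc.prems FX \<epsilon> by auto
    then show ?case using Suc step by blast
  qed
  obtain z where z: "z \<in> B" using B by auto
  obtain n where "d b z / \<epsilon> \<le> real n" using real_arch_simple by blast
  then have "d b z \<le> real n * \<epsilon>" using \<epsilon> by (simp add: field_simps)
  moreover have "b \<in> F" using b by (auto simp: F_def)
  ultimately have "z \<in> F" using chain[of b z n] z B by auto
  then show False using K[OF z] \<open>M > K\<close> by (auto simp: F_def E_def)
qed

text \<open>
  For fixed \<open>\<epsilon>\<close> the layer of points within \<open>2 * \<epsilon>\<close> of \<open>S\<close> plays the role of the boundary. There the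
  maxima over \<open>\<epsilon>\<close>-balls exceed the values on \<open>S\<close> by a modulus of continuity at \<open>3 * \<epsilon>\<close>, which vanishes
  with \<open>\<epsilon>\<close>.
\<close>

theorem cone_subsolution_comparison:
  assumes U: "continuous_on X U" and v: "continuous_on X v"
    and ccU: "cone_subsolution S U" and ccv: "cone_subsolution S (\<lambda>x. - v x)"
    and S: "S \<subseteq> X" "S \<noteq> {}" and le: "\<And>z. z \<in> S \<Longrightarrow> U z \<le> v z" and x: "x \<in> X"
  shows "U x \<le> v x"
proof (rule field_le_epsilon)
  fix e :: real assume "e > 0"
  let ?V = "\<lambda>x. - v x"
  have V: "continuous_on X ?V" using v by (rule continuous_on_minus)
  obtain r1 where "r1 > 0" and r1: "\<forall>x\<in>X. \<forall>y\<in>X. d x y < r1 \<longrightarrow> \<bar>U x - U y\<bar> < e/2"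
    using d_modulus_if_continuous_on[OF U, of "e/2"] \<open>e > 0\<close> by auto
  obtain r2 where "r2 > 0" and r2: "\<forall>x\<in>X. \<forall>y\<in>X. d x y < r2 \<longrightarrow> \<bar>?V x - ?V y\<bar> < e/2"
    using d_modulus_if_continuous_on[OF V, of "e/2"] \<open>e > 0\<close> by auto
  define \<epsilon> where "\<epsilon> = min r1 r2 / 4"
  have \<epsilon>: "\<epsilon> > 0" "3 * \<epsilon> < r1" "3 * \<epsilon> < r2" using \<open>r1 > 0\<close> \<open>r2 > 0\<close> by (auto simp: \<epsilon>_def)
  define B where "B = {y\<in>X. \<exists>z\<in>S. d y z \<le> 2 * \<epsilon>}"
  have "S \<subseteq> B" using S \<epsilon> d_refl by (force simp: B_def)
  have far: "\<forall>z\<in>S. d y z > 2 * \<epsilon>" if "y \<in> X - B" for y using that by (force simp: B_def)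
  have layer: "ball_max U \<epsilon> y + ball_max ?V \<epsilon> y \<le> e" if y: "y \<in> B" for y
  proof -
    obtain z where z: "z \<in> S" "d y z \<le> 2 * \<epsilon>" and yX: "y \<in> X" using y by (auto simp: B_def)
    obtain p where p: "p \<in> X" "d y p \<le> \<epsilon>" "ball_max U \<epsilon> y = U p"
      using ball_max_attained[OF U yX less_imp_le[OF \<epsilon>(1)]] by blast
    obtain q where q: "q \<in> X" "d y q \<le> \<epsilon>" "ball_max ?V \<epsilon> y = ?V q"
      using ball_max_attained[OF V yX less_imp_le[OF \<epsilon>(1)]] by blast
    have "d z p \<le> 3 * \<epsilon>" "d z q \<le> 3 * \<epsilon>"
      using d_triangle[of z y p] d_triangle[of z y q] d_sym[of z y] z p q yX S by auto
    then have "\<bar>U z - U p\<bar> < e/2" "\<bar>?V z - ?V q\<bar> < e/2"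
      using r1 r2 \<epsilon> p q z S by auto
    then have "U p - U z < e/2" "v z - v q < e/2" unfolding abs_less_iff by linarith+
    then show ?thesis unfolding p(3) q(3) using le[OF z(1)] by linarith
  qed
  have "ball_max U \<epsilon> x + ball_max ?V \<epsilon> x \<le> e"
  proof (rule finite_difference_comparison[where B = B])
    show "continuous_on X (ball_max U \<epsilon>)" "continuous_on X (ball_max ?V \<epsilon>)"
      using continuous_on_ball_max U V \<epsilon> by auto
    show "2 * ball_max U \<epsilon> y \<le> ball_max U \<epsilon> w + ball_max (ball_max U \<epsilon>) \<epsilon> y"
      if "y \<in> X - B" "w \<in> X" "d y w \<le> \<epsilon>" for y w
      using ball_max_midpoint[OF U ccU \<epsilon>(1) _ far] that by auto
    show "2 * ball_max ?V \<epsilon> y \<le> ball_max ?V \<epsilon> w + ball_max (ball_max ?V \<epsilon>) \<epsilon> y"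
      if "y \<in> X - B" "w \<in> X" "d y w \<le> \<epsilon>" for y w
      using ball_max_midpoint[OF V ccv \<epsilon>(1) _ far] that by auto
  qed (use \<epsilon> \<open>S \<subseteq> B\<close> S x layer in \<open>auto simp: B_def\<close>)
  moreover have "U x \<le> ball_max U \<epsilon> x" "?V x \<le> ball_max ?V \<epsilon> x"
    using ball_max_upper[OF U x x, of \<epsilon>] ball_max_upper[OF V x x, of \<epsilon>] \<epsilon>(1) d_refl[OF x] by simp_all
  ultimately show "U x \<le> v x + e" by linarith
qed

text \<open>
  Suppose \<open>u y\<close> exceeds the cone \<open>K\<close> with vertex \<open>x\<close>. On the component \<open>V\<close> of \<open>{u > K}\<close> containing \<open>y\<close>, the
  boundary values of \<open>u\<close> are those of \<open>K\<close>, whose Lipschitz constant is \<open>a\<close>, so \<open>u\<close> has Lipschitz constant \<open>a\<close> on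
  \<open>closure V\<close>. Since \<open>K\<close> has slope exactly \<open>a\<close> along a shortest path from the vertex, \<open>u\<close> cannot exceed \<open>K\<close>
  at \<open>y\<close> after starting from \<open>u = K\<close> where such a path enters \<open>V\<close>. Starting at the vertex is essential, as a
  shortest path may end at \<open>y\<close> when \<open>y\<close> is a boundary point of the domain.
\<close>

lemma cone_subsolution_if_absolutely_minimal:
  assumes u: "continuous_on X u"
    and am: "\<And>V a p q. V \<subseteq> X - S \<Longrightarrow> openin (top_of_set X) V \<Longrightarrow> connected V \<Longrightarrow> a \<ge> 0 \<Longrightarrow>
       (\<And>p q. p \<in> X \<inter> closure V - V \<Longrightarrow> q \<in> X \<inter> closure V - V \<Longrightarrow> \<bar>u p - u q\<bar> \<le> a * d p q) \<Longrightarrow>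
       p \<in> X \<inter> closure V \<Longrightarrow> q \<in> X \<inter> closure V \<Longrightarrow> \<bar>u p - u q\<bar> \<le> a * d p q"
  shows "cone_subsolution S u"
  unfolding cone_subsolution_def
proof (intro ballI allI impI)
  fix x \<epsilon> y m
  assume x: "x \<in> X" and \<epsilon>: "(0::real) < \<epsilon>" and far: "\<forall>z\<in>S. 2 * \<epsilon> < d x z"
    and y: "y \<in> X" "d x y \<le> \<epsilon>" and m: "\<forall>w\<in>X. d x w \<le> 2 * \<epsilon> \<longrightarrow> u w \<le> m"
  define a where "a = (m - u x) / (2 * \<epsilon>)"
  have a: "a \<ge> 0" "a * (2 * \<epsilon>) = m - u x"
    using m x \<epsilon> d_refl[OF x] by (auto simp: a_def)
  define K where "K w = u x + a * d x w" for w
  have K: "continuous_on X K"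
    unfolding K_def[abs_def] by (intro continuous_intros continuous_on_d x)
  show "2 * u y \<le> u x + m"
  proof (rule ccontr)
    assume neg: "\<not> 2 * u y \<le> u x + m"
    have "a * d x y \<le> a * \<epsilon>" using a y by (intro mult_left_mono) auto
    then have uy: "u y > K y" using neg a(2) by (simp add: K_def)
    define W where "W = {w\<in>X. d x w < 2 * \<epsilon>} \<inter> (X \<inter> (\<lambda>w. u w - K w) -` {0<..})"
    have oW: "openin (top_of_set X) W"
      unfolding W_def
      by (intro openin_Int openin_dball x continuous_openin_preimage_gen continuous_on_diff u K) auto
    have yW: "y \<in> W" using y \<epsilon> uy by (auto simp: W_def)
    define V where "V = connected_component_set W y"
    have VW: "V \<subseteq> W" unfolding V_def by (rule connected_component_subset)
    have "openin (top_of_set W) V"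
      unfolding V_def
      by (intro openin_connected_component_locally_connected locally_open_subset[OF locally_connected_space oW])
    then have oV: "openin (top_of_set X) V" using oW openin_trans by blast
    have cV: "connected V" unfolding V_def by (rule connected_connected_component)
    have yV: "y \<in> V" unfolding V_def using yW by simp
    have VX: "V \<subseteq> X - S"
    proof
      fix w assume "w \<in> V"
      then have "w \<in> X" "d x w < 2 * \<epsilon>" using VW by (auto simp: W_def)
      then show "w \<in> X - S" using far by force
    qed
    have cl: "K w \<le> u w" "d x w \<le> 2 * \<epsilon>" if w: "w \<in> X \<inter> closure V" for w
    proof -
      let ?C = "X \<inter> (\<lambda>w. u w - K w) -` {0..} \<inter> (X \<inter> d x -` {..2 * \<epsilon>})"
      have "closed ?C"
        by (intro closed_Int
            continuous_closed_preimage[OF continuous_on_diff[OF u K] compact_imp_closed[OF compact_space]]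
            continuous_closed_preimage[OF continuous_on_d[OF x] compact_imp_closed[OF compact_space]]) auto
      moreover have "V \<subseteq> ?C" using VW by (auto simp: W_def)
      ultimately have "closure V \<subseteq> ?C" by (rule closure_minimal[rotated])
      then show "K w \<le> u w" "d x w \<le> 2 * \<epsilon>" using w by auto
    qed
    have bd: "u p = K p" if p: "p \<in> X \<inter> closure V - V" for p
    proof -
      have "p \<notin> W"
      proof
        assume "p \<in> W"
        have "connected (insert p V)"
          using connected_intermediate_closure[OF cV, of "insert p V"] p closure_subset by auto
        then have "insert p V \<subseteq> V"
          unfolding V_def[symmetric] using connected_component_maximal[of y "insert p V" W] yV VW \<open>p \<in> W\<close>
          by (simp add: V_def)
        then show False using p by auto
      qed
      then have "u p \<le> K p" if "d x p < 2 * \<epsilon>" using that p by (auto simp: W_def)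
      moreover have "u p \<le> K p" if "d x p = 2 * \<epsilon>"
        using m p that a(2) by (simp add: K_def)
      ultimately show ?thesis using cl[of p] p by force
    qed
    have "\<bar>u p - u q\<bar> \<le> a * d p q" if p: "p \<in> X \<inter> closure V - V" and q: "q \<in> X \<inter> closure V - V" for p q
    proof -
      have "\<bar>d x p - d x q\<bar> \<le> d p q"
        using d_triangle[of x p q] d_triangle[of x q p] d_sym[of p q] p q x by auto
      then have "a * \<bar>d x p - d x q\<bar> \<le> a * d p q" using a by (intro mult_left_mono)
      moreover have "u p - u q = a * (d x p - d x q)" using bd p q by (simp add: K_def algebra_simps)
      ultimately show ?thesis using a by (simp add: abs_mult)
    qed
    then have lip: "\<bar>u p - u q\<bar> \<le> a * d p q" if "p \<in> X \<inter> closure V" "q \<in> X \<inter> closure V" for p q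
      using am[OF VX oV cV a(1) _ that] by blast
    have "x \<notin> V" using VW d_refl[OF x] by (auto simp: W_def K_def)
    then obtain p where p: "p \<in> X" "p \<in> closure V" "p \<notin> V" "d x p + d p y = d x y"
      using entry_point[OF oV yV, of x] x by blast
    have "u y - u p \<le> a * d p y"
      using lip[of y p] p y yV closure_subset d_sym[OF p(1) y(1)] by force
    then have "u y \<le> u x + a * (d x p + d p y)"
      using bd[of p] p(1-3) unfolding K_def distrib_left by auto
    then show False using uy p(4) by (simp add: K_def)
  qed
qed

section \<open>Upper limits of functions on refining scales\<close>

lemma finite_d_net:
  assumes "compact K" "K \<subseteq> X" "\<rho> > 0"
  obtains T where "finite T" "T \<subseteq> K" "\<And>k. k \<in> K \<Longrightarrow> \<exists>t\<in>T. d k t < \<rho>"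
proof -
  obtain r where r: "r > 0" "\<forall>x\<in>X. \<forall>y\<in>X. dist x y < r \<longrightarrow> d x y < \<rho>"
    using d_small[OF assms(3)] by auto
  obtain T where T: "finite T" "T \<subseteq> K" "K \<subseteq> (\<Union>x\<in>T. ball x r)"
    using compactE_image[OF assms(1), of K "\<lambda>x. ball x r"] r(1) by force
  have "\<exists>t\<in>T. d k t < \<rho>" if k: "k \<in> K" for k
  proof -
    obtain t where t: "t \<in> T" "dist t k < r" using T(3) k by auto
    then have "d k t < \<rho>" using r(2) assms(2) T(2) k by (auto simp: dist_commute)
    then show ?thesis using t by blast
  qed
  then show ?thesis using that T by blast
qed

text \<open>
  The functions \<open>v n\<close> may be discontinuous and satisfy comparison with cones only approximately. Their
  pointwise upper limit \<open>U\<close> inherits continuity from \<open>equi\<close> and the subsolution property from \<open>cone\<close>, so it lies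
  below \<open>u\<close> by uniqueness in the limit. Because of \<open>equi\<close>, estimates of \<open>v n\<close> on a finite net extend
  uniformly. The radius \<open>2 * \<epsilon> + \<beta>\<close> in \<open>cone\<close> leaves room for neighbours that lie slightly outside a ball.
\<close>

theorem asymptotic_comparison:
  fixes v :: "nat \<Rightarrow> 'a \<Rightarrow> real"
  assumes equi: "\<And>\<kappa>. \<kappa> > 0 \<Longrightarrow> \<exists>\<rho>>0. \<forall>\<^sub>F n in sequentially.
                   \<forall>x\<in>X. \<forall>y\<in>X. d x y < \<rho> \<longrightarrow> \<bar>v n x - v n y\<bar> \<le> \<kappa>"
    and bound: "\<forall>\<^sub>F n in sequentially. \<forall>x\<in>X. \<bar>v n x\<bar> \<le> C"
    and cone: "\<And>x \<epsilon> y m \<beta> \<kappa>. x \<in> X \<Longrightarrow> \<epsilon> > 0 \<Longrightarrow> \<forall>z\<in>S. d x z > 2 * \<epsilon> \<Longrightarrow> y \<in> X \<Longrightarrow>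
       d x y \<le> \<epsilon> \<Longrightarrow> \<beta> > 0 \<Longrightarrow> \<kappa> > 0 \<Longrightarrow>
       \<forall>\<^sub>F n in sequentially. \<forall>w\<in>X. d x w \<le> 2 * \<epsilon> + \<beta> \<longrightarrow> v n w \<le> m \<Longrightarrow>
       \<forall>\<^sub>F n in sequentially. 2 * v n y \<le> v n x + m + \<kappa>"
    and bc: "\<And>z \<kappa>. z \<in> S \<Longrightarrow> \<kappa> > 0 \<Longrightarrow> \<forall>\<^sub>F n in sequentially. v n z \<le> u z + \<kappa>"
    and u: "continuous_on X u" and ccu: "cone_subsolution S (\<lambda>x. - u x)"
    and S: "S \<subseteq> X" "S \<noteq> {}" and \<kappa>: "\<kappa> > 0"
  shows "\<forall>\<^sub>F n in sequentially. \<forall>x\<in>X. v n x \<le> u x + \<kappa>"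
proof -
  define U where "U x = Inf {c. \<forall>\<^sub>F n in sequentially. v n x \<le> c}" for x
  have bdd: "- C \<le> c" if "x \<in> X" "\<forall>\<^sub>F n in sequentially. v n x \<le> c" for x c
  proof -
    have "\<forall>\<^sub>F n in sequentially. - C \<le> c"
      using bound that(2) by eventually_elim (use that(1) in fastforce)
    then show ?thesis by simp
  qed
  have U_le: "U x \<le> c" if "x \<in> X" "\<forall>\<^sub>F n in sequentially. v n x \<le> c" for x c
    unfolding U_def using that bdd by (intro cInf_lower bdd_belowI[of _ "- C"]) auto
  have U_ev: "\<forall>\<^sub>F n in sequentially. v n x \<le> U x + e" if x: "x \<in> X" and "e > 0" for x e
  proof -
    have "\<forall>\<^sub>F n in sequentially. v n x \<le> C"
      using bound by eventually_elim (use x in fastforce)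
    then have "{c. \<forall>\<^sub>F n in sequentially. v n x \<le> c} \<noteq> {}" by blast
    then obtain c where c: "\<forall>\<^sub>F n in sequentially. v n x \<le> c" "c < U x + e"
      using cInf_lessD[of "{c. \<forall>\<^sub>F n in sequentially. v n x \<le> c}" "U x + e"] \<open>e > 0\<close>
      by (auto simp: U_def)
    from c(1) show ?thesis by eventually_elim (use c(2) in linarith)
  qed
  have U_cont: "continuous_on X U"
  proof (rule continuous_on_if_d_modulus)
    fix e :: real assume "e > 0"
    then obtain \<rho> where "\<rho> > 0" and \<rho>: "\<forall>\<^sub>F n in sequentially.
        \<forall>x\<in>X. \<forall>y\<in>X. d x y < \<rho> \<longrightarrow> \<bar>v n x - v n y\<bar> \<le> e" using equi by blast
    have *: "U x \<le> U y + e" if xy: "x \<in> X" "y \<in> X" "d x y < \<rho>" for x y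
    proof (rule field_le_epsilon)
      fix e' :: real assume "e' > 0"
      have "\<forall>\<^sub>F n in sequentially. v n x \<le> U y + e + e'"
        using \<rho> U_ev[OF xy(2) \<open>e' > 0\<close>]
      proof eventually_elim
        case (elim n)
        then have "\<bar>v n x - v n y\<bar> \<le> e" using xy by blast
        then show ?case using elim(2) by linarith
      qed
      then show "U x \<le> U y + e + e'" using U_le xy by blast
    qed
    have "\<bar>U x - U y\<bar> \<le> e" if "x \<in> X" "y \<in> X" "d x y < \<rho>" for x y
      using *[of x y] *[of y x] that d_sym[of x y] by linarith
    then show "\<exists>\<rho>>0. \<forall>x\<in>X. \<forall>y\<in>X. d x y < \<rho> \<longrightarrow> \<bar>U x - U y\<bar> \<le> e"
      using \<open>\<rho> > 0\<close> by blast
  qed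
  \<comment> \<open>A pointwise bound for \<open>U\<close> on a ball is an eventual uniform bound for \<open>v n\<close> on a slightly larger ball.\<close>
  have U_unif: "\<exists>\<beta>>0. \<forall>\<^sub>F n in sequentially. \<forall>w\<in>X. d x w \<le> r + \<beta> \<longrightarrow> v n w \<le> m + e"
    if x: "x \<in> X" and r: "r > 0" and e: "e > 0" and m: "\<And>w. w \<in> X \<Longrightarrow> d x w \<le> r \<Longrightarrow> U w \<le> m"
    for x r m e
  proof -
    obtain \<rho> where "\<rho> > 0" and \<rho>: "\<forall>\<^sub>F n in sequentially.
        \<forall>x\<in>X. \<forall>y\<in>X. d x y < \<rho> \<longrightarrow> \<bar>v n x - v n y\<bar> \<le> e/2"
      using equi[of "e/2"] e by auto
    obtain T where T: "finite T" "T \<subseteq> dcball x r" "\<And>k. k \<in> dcball x r \<Longrightarrow> \<exists>t\<in>T. d k t < \<rho>/2"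
      using finite_d_net[OF compact_dcball[OF x, of r], of "\<rho>/2"] \<open>\<rho> > 0\<close> by (auto simp: dcball_def)
    have "\<forall>\<^sub>F n in sequentially. \<forall>t\<in>T. v n t \<le> U t + e/2"
      using T(1,2) U_ev e by (intro eventually_ball_finite) (auto simp: dcball_def)
    with \<rho> have "\<forall>\<^sub>F n in sequentially. \<forall>w\<in>X. d x w \<le> r + \<rho>/2 \<longrightarrow> v n w \<le> m + e"
    proof eventually_elim
      case (elim n)
      show ?case
      proof (intro ballI impI)
        fix w assume w: "w \<in> X" "d x w \<le> r + \<rho>/2"
        obtain k where k: "k \<in> X" "d x k \<le> r" "d k w \<le> \<rho>/2"
          using between_dcball[OF x w] r \<open>\<rho> > 0\<close> by auto
        then obtain t where t: "t \<in> T" "d k t < \<rho>/2" using T(3)[of k] by (auto simp: mem_dcball)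
        have tX: "t \<in> X" "d x t \<le> r" using t T(2) by (auto simp: dcball_def)
        have "d w t < \<rho>" using d_triangle[of w k t] d_sym[of w k] k t w tX by auto
        then have "\<bar>v n w - v n t\<bar> \<le> e/2" using elim(1) w tX by blast
        moreover have "v n t \<le> U t + e/2" using elim(2) t by blast
        ultimately show "v n w \<le> m + e" using m[OF tX] by linarith
      qed
    qed
    then show ?thesis using \<open>\<rho> > 0\<close> half_gt_zero by blast
  qed
  have "cone_subsolution S U"
    unfolding cone_subsolution_def
  proof (intro ballI allI impI)
    fix x \<epsilon> y m
    assume x: "x \<in> X" and \<epsilon>: "(0::real) < \<epsilon>" and far: "\<forall>z\<in>S. 2 * \<epsilon> < d x z"
      and y: "y \<in> X" "d x y \<le> \<epsilon>" and m: "\<forall>w\<in>X. d x w \<le> 2 * \<epsilon> \<longrightarrow> U w \<le> m"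
    show "2 * U y \<le> U x + m"
    proof (rule field_le_epsilon)
      fix e :: real assume "e > 0"
      then have e: "e/3 > 0" by simp
      obtain \<beta> where \<beta>: "\<beta> > 0"
        "\<forall>\<^sub>F n in sequentially. \<forall>w\<in>X. d x w \<le> 2 * \<epsilon> + \<beta> \<longrightarrow> v n w \<le> m + e/3"
        using U_unif[OF x _ e, of "2 * \<epsilon>" m] \<epsilon> m by auto
      have "\<forall>\<^sub>F n in sequentially. v n y \<le> (U x + m + e) / 2"
        using cone[OF x \<epsilon> far y \<beta>(1) e \<beta>(2)] U_ev[OF x e]
      proof eventually_elim
        case (elim n)
        then show ?case by (simp add: field_simps)
      qed
      then have "U y \<le> (U x + m + e) / 2" using U_le y by blast
      then show "2 * U y \<le> U x + m + e" by simp
    qed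
  qed
  moreover have "U z \<le> u z" if "z \<in> S" for z
  proof (rule field_le_epsilon)
    fix e :: real assume "e > 0"
    show "U z \<le> u z + e" using U_le bc[OF that \<open>e > 0\<close>] that S by blast
  qed
  ultimately have Uu: "U x \<le> u x" if "x \<in> X" for x
    using cone_subsolution_comparison[OF U_cont u _ ccu S] that by blast
  obtain \<rho> where "\<rho> > 0" and \<rho>: "\<forall>\<^sub>F n in sequentially.
      \<forall>x\<in>X. \<forall>y\<in>X. d x y < \<rho> \<longrightarrow> \<bar>v n x - v n y\<bar> \<le> \<kappa>/3"
    using equi[of "\<kappa>/3"] \<kappa> by auto
  obtain r where "r > 0" and r: "\<forall>x\<in>X. \<forall>y\<in>X. d x y < r \<longrightarrow> \<bar>u x - u y\<bar> < \<kappa>/3"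
    using d_modulus_if_continuous_on[OF u, of "\<kappa>/3"] \<kappa> by auto
  obtain T where T: "finite T" "T \<subseteq> X" "\<And>k. k \<in> X \<Longrightarrow> \<exists>t\<in>T. d k t < min r \<rho>"
    using finite_d_net[OF compact_space, of "min r \<rho>"] \<open>\<rho> > 0\<close> \<open>r > 0\<close> by auto
  have "\<forall>\<^sub>F n in sequentially. \<forall>t\<in>T. v n t \<le> U t + \<kappa>/3"
    using T(1,2) U_ev \<kappa> by (intro eventually_ball_finite) auto
  with \<rho> show ?thesis
  proof eventually_elim
    case (elim n)
    show ?case
    proof
      fix x assume x: "x \<in> X"
      then obtain t where t: "t \<in> T" "d x t < min r \<rho>" using T(3) by blast
      then have tX: "t \<in> X" using T(2) by auto
      have "\<bar>v n x - v n t\<bar> \<le> \<kappa>/3" "\<bar>u x - u t\<bar> < \<kappa>/3" "v n t \<le> U t + \<kappa>/3"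
        using elim r x t tX by auto
      then show "v n x \<le> u x + \<kappa>" using Uu[OF tX] by linarith
    qed
  qed
qed

end

section \<open>The geodesic distance is a metric\<close>

lemma geo_dist_le:
  assumes "\<And>t. t \<in> {0..1} \<Longrightarrow> (\<xi> has_vector_derivative D t) (at t)" "continuous_on {0..1} D"
    and "\<And>t. t \<in> {0..1} \<Longrightarrow> \<xi> t \<in> closure \<Omega>" "\<xi> 0 = x" "\<xi> 1 = y"
    and "integral {0..1} (\<lambda>t. norm (D t)) \<le> L"
  shows "geo_dist \<Omega> x y \<le> ennreal L"
proof -
  have "\<xi> C1_differentiable_on {0..1}"
    unfolding C1_differentiable_on_def using assms(1,2) by blast
  then have "geo_dist \<Omega> x y \<le> ennreal (integral {0..1} (\<lambda>t. norm (vector_derivative \<xi> (at t))))"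
    unfolding geo_dist_def using assms(3-5)
    by (intro INF_lower) (auto simp: path_image_def pathstart_def pathfinish_def)
  also have "integral {0..1} (\<lambda>t. norm (vector_derivative \<xi> (at t))) = integral {0..1} (\<lambda>t. norm (D t))"
    by (intro integral_cong) (metis assms(1) vector_derivative_at)
  finally show ?thesis using assms(6) ennreal_leI order_trans by blast
qed

lemma geo_dist_lessE:
  assumes "geo_dist \<Omega> x y < ennreal L"
  obtains \<xi> D where "\<And>t. t \<in> {0..1} \<Longrightarrow> (\<xi> has_vector_derivative D t) (at t)" "continuous_on {0..1} D"
    "\<And>t. t \<in> {0..1} \<Longrightarrow> \<xi> t \<in> closure \<Omega>" "\<xi> 0 = x" "\<xi> 1 = y"
    "integral {0..1} (\<lambda>t. norm (D t)) < L"
proof -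
  obtain \<xi> where \<xi>: "\<xi> C1_differentiable_on {0..1}" "path_image \<xi> \<subseteq> closure \<Omega>"
      "pathstart \<xi> = x" "pathfinish \<xi> = y"
      "ennreal (integral {0..1} (\<lambda>t. norm (vector_derivative \<xi> (at t)))) < ennreal L"
    using assms unfolding geo_dist_def INF_less_iff by auto
  obtain D where D: "\<forall>t\<in>{0..1}. (\<xi> has_vector_derivative D t) (at t)" "continuous_on {0..1} D"
    using \<xi>(1) unfolding C1_differentiable_on_def by blast
  have eq: "integral {0..1} (\<lambda>t. norm (vector_derivative \<xi> (at t))) = integral {0..1} (\<lambda>t. norm (D t))"
    by (intro integral_cong) (metis D(1) vector_derivative_at)
  have "integral {0..1} (\<lambda>t. norm (D t)) < L"
    using \<xi>(5) unfolding eq by (metis ennreal_leI not_less)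
  moreover have "\<xi> t \<in> closure \<Omega>" if "t \<in> {0..1}" for t
    using \<xi>(2) that unfolding path_image_def by blast
  ultimately show ?thesis using that[of \<xi> D] D \<xi>(3,4)
    unfolding pathstart_def pathfinish_def by blast
qed

lemma integral_norm_substitution:
  fixes D :: "real \<Rightarrow> 'a::euclidean_space"
  assumes "a \<le> b" "continuous_on {c..e} D" "\<And>t. t \<in> {a..b} \<Longrightarrow> g t \<in> {c..e}"
    and "\<And>t. t \<in> {a..b} \<Longrightarrow> (g has_real_derivative g' t) (at t)" "\<And>t. t \<in> {a..b} \<Longrightarrow> 0 \<le> g' t"
    and "g a \<le> g b"
  shows "((\<lambda>t. norm (g' t *\<^sub>R D (g t))) has_integral integral {g a..g b} (\<lambda>t. norm (D t))) {a..b}"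
proof -
  have "((\<lambda>t. g' t *\<^sub>R norm (D (g t))) has_integral integral {g a..g b} (\<lambda>t. norm (D t))) {a..b}"
  proof (rule has_integral_substitution[where c = c and d = e])
    show "continuous_on {c..e} (\<lambda>t. norm (D t))" using assms(2) by (rule continuous_on_norm)
    show "(g has_real_derivative g' t) (at t within {a..b})" if "t \<in> {a..b}" for t
      using assms(4)[OF that] by (rule has_field_derivative_at_within)
  qed (use assms in auto)
  then show ?thesis
    by (rule has_integral_eq[rotated]) (use assms(5) in auto)
qed

lemma geo_dist_commute: "geo_dist \<Omega> x y = geo_dist \<Omega> y x"
proof -
  have *: "geo_dist \<Omega> y x \<le> geo_dist \<Omega> x y" for x y
  proof (rule ennreal_le_epsilon)
    fix e :: real assume fin: "geo_dist \<Omega> x y < top" and e: "0 < e"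
    obtain l where l: "geo_dist \<Omega> x y = ennreal l" "l \<ge> 0"
      using fin by (cases "geo_dist \<Omega> x y") auto
    define L where "L = l + e"
    have L: "geo_dist \<Omega> x y + ennreal e = ennreal L"
      using l e by (simp add: L_def ennreal_plus)
    have "geo_dist \<Omega> x y < ennreal L"
      using l e by (auto simp: L_def intro!: ennreal_lessI)
    then obtain \<xi> D where \<xi>: "\<And>t. t \<in> {0..1} \<Longrightarrow> (\<xi> has_vector_derivative D t) (at t)"
      "continuous_on {0..1} D" "\<And>t. t \<in> {0..1} \<Longrightarrow> \<xi> t \<in> closure \<Omega>" "\<xi> 0 = x" "\<xi> 1 = y"
      "integral {0..1} (\<lambda>t. norm (D t)) < L"
      by (rule geo_dist_lessE) blast
    have "geo_dist \<Omega> y x \<le> ennreal L"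
    proof (rule geo_dist_le)
      show "((\<lambda>t. \<xi> (1 - t)) has_vector_derivative - D (1 - t)) (at t)" if "t \<in> {0..1}" for t
      proof -
        have "((\<lambda>t. 1 - t) has_vector_derivative -1) (at t)"
          by (auto intro!: derivative_eq_intros)
        moreover have "(\<xi> has_vector_derivative D (1 - t)) (at (1 - t))" using \<xi>(1) that by auto
        ultimately show ?thesis
          using vector_diff_chain_at[of "\<lambda>t. 1 - t" "-1" t \<xi> "D (1 - t)"] by (simp add: o_def)
      qed
      show "continuous_on {0..1} (\<lambda>t. - D (1 - t))"
        by (intro continuous_on_minus continuous_on_compose2[OF \<xi>(2)] continuous_intros) auto
      have "((\<lambda>t. norm (D (1 - t))) has_integral integral {0..1} (\<lambda>t. norm (D t))) {0..1}"
        using has_integral_affinity[of "\<lambda>t. norm (D t)" "integral {0..1} (\<lambda>t. norm (D t))" 0 1 "-1" 1]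
        integrable_integral[OF integrable_continuous_real[OF continuous_on_norm[OF \<xi>(2)]]]
        by (simp add: image_affinity_atLeastAtMost)
      then show "integral {0..1} (\<lambda>t. norm (- D (1 - t))) \<le> L"
        using \<xi>(6) by (simp add: integral_unique)
    qed (use \<xi> in auto)
    then show "geo_dist \<Omega> y x \<le> geo_dist \<Omega> x y + ennreal e" using L by simp
  qed
  show ?thesis by (intro antisym *)
qed

lemma dist_le_geo_dist: "ennreal (dist x y) \<le> geo_dist \<Omega> x y"
proof (rule ccontr)
  assume "\<not> ?thesis"
  then have "geo_dist \<Omega> x y < ennreal (dist x y)" by simp
  then obtain \<xi> D where \<xi>: "\<And>t. t \<in> {0..1} \<Longrightarrow> (\<xi> has_vector_derivative D t) (at t)"
      "continuous_on {0..1} D" "\<And>t. t \<in> {0..1} \<Longrightarrow> \<xi> t \<in> closure \<Omega>" "\<xi> 0 = x" "\<xi> 1 = y"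
      "integral {0..1} (\<lambda>t. norm (D t)) < dist x y"
    by (rule geo_dist_lessE) blast
  have "(D has_integral (\<xi> 1 - \<xi> 0)) {0..1}"
    by (rule fundamental_theorem_of_calculus, simp) (rule has_vector_derivative_at_within[OF \<xi>(1)])
  then have eq: "integral {0..1} D = \<xi> 1 - \<xi> 0" by (rule integral_unique)
  have "norm (integral {0..1} D) \<le> integral {0..1} (\<lambda>t. norm (D t))"
    by (intro integral_norm_bound_integral integrable_continuous_real continuous_on_norm \<xi>(2)) auto
  then have "norm (\<xi> 1 - \<xi> 0) \<le> integral {0..1} (\<lambda>t. norm (D t))" unfolding eq .
  then show False using \<xi>(4-6) by (simp add: dist_norm norm_minus_commute)
qed

text \<open>
  A \<open>C\<^sup>1\<close> transition from \<open>0\<close> to \<open>1\<close> that is constant outside the unit interval. Reparametrized by it, a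
  curve stops smoothly at its end points and becomes constant beyond them, so that curves can be
  concatenated by adding their increments.
\<close>

definition ramp_sq :: "real \<Rightarrow> real" where "ramp_sq t = (max 0 t)\<^sup>2"

lemma DERIV_ramp_sq: "(ramp_sq has_real_derivative 2 * max 0 t) (at t)"
proof -
  consider "t < 0" | "t = 0" | "t > 0" by linarith
  then show ?thesis
  proof cases
    case 1
    have "((\<lambda>_. 0) has_real_derivative 0) (at t)" by simp
    then have "(ramp_sq has_real_derivative 0) (at t)"
      by (rule has_field_derivative_transform_within_open[where S = "{..<0}"])
         (use 1 in \<open>auto simp: ramp_sq_def\<close>)
    then show ?thesis using 1 by simp
  next
    case 3
    have "((\<lambda>t. t\<^sup>2) has_real_derivative 2 * t) (at t)" by (auto intro!: derivative_eq_intros)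
    then have "(ramp_sq has_real_derivative 2 * t) (at t)"
      by (rule has_field_derivative_transform_within_open[where S = "{0<..}"])
         (use 3 in \<open>auto simp: ramp_sq_def\<close>)
    then show ?thesis using 3 by simp
  next
    case 2
    have "(\<lambda>h. (ramp_sq (0 + h) - ramp_sq 0) / h) \<midarrow>0\<rightarrow> 0"
    proof (rule LIM_I)
      fix r :: real assume "0 < r"
      have "norm ((ramp_sq (0 + h) - ramp_sq 0) / h - 0) < r" if "h \<noteq> 0" "norm (h - 0) < r" for h
        using that \<open>0 < r\<close> by (auto simp: ramp_sq_def power2_eq_square max_def)
      then show "\<exists>s>0. \<forall>h. h \<noteq> 0 \<and> norm (h - 0) < s \<longrightarrow>
          norm ((ramp_sq (0 + h) - ramp_sq 0) / h - 0) < r"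
        using \<open>0 < r\<close> by blast
    qed
    then show ?thesis using 2 by (simp add: DERIV_def)
  qed
qed

definition smoothstep :: "real \<Rightarrow> real" where
  "smoothstep t = 2 * (ramp_sq t - 2 * ramp_sq (t - 1/2) + ramp_sq (t - 1))"

text \<open>The derivative of \<open>smoothstep\<close>: a tent with its tip of height \<open>2\<close> at \<open>1/2\<close>.\<close>

definition smoothstep' :: "real \<Rightarrow> real" where
  "smoothstep' t = 4 * (max 0 t - 2 * max 0 (t - 1/2) + max 0 (t - 1))"

lemma DERIV_smoothstep: "(smoothstep has_real_derivative smoothstep' t) (at t)"
proof -
  have "((\<lambda>t. ramp_sq (t - c)) has_real_derivative 2 * max 0 (t - c)) (at t)" for c
  proof -
    have "((\<lambda>t. t - c) has_real_derivative 1) (at t)" by (auto intro!: derivative_eq_intros)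
    then show ?thesis
      using DERIV_chain2[of ramp_sq "2 * max 0 (t - c)" "\<lambda>t. t - c" t 1 UNIV] DERIV_ramp_sq[of "t - c"]
      by simp
  qed
  from this[of "1/2"] this[of 1] show ?thesis
    unfolding smoothstep_def[abs_def] smoothstep'_def
    by (auto intro!: derivative_eq_intros DERIV_ramp_sq)
qed

lemma smoothstep_le_0: "t \<le> 0 \<Longrightarrow> smoothstep t = 0" "t \<le> 0 \<Longrightarrow> smoothstep' t = 0"
  by (auto simp: smoothstep_def smoothstep'_def ramp_sq_def)

lemma smoothstep_ge_1: "t \<ge> 1 \<Longrightarrow> smoothstep t = 1" "t \<ge> 1 \<Longrightarrow> smoothstep' t = 0"
  by (auto simp: smoothstep_def smoothstep'_def ramp_sq_def power2_eq_square field_simps)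

lemma smoothstep'_bounds: "0 \<le> smoothstep' t" "smoothstep' t \<le> 2"
  by (auto simp: smoothstep'_def max_def)

lemma continuous_on_smoothstep': "continuous_on A smoothstep'"
  unfolding smoothstep'_def[abs_def] by (intro continuous_intros)

lemma continuous_on_smoothstep: "continuous_on A smoothstep"
  using DERIV_smoothstep DERIV_continuous_on has_field_derivative_at_within by blast

lemma smoothstep_mono: "s \<le> t \<Longrightarrow> smoothstep s \<le> smoothstep t"
  using DERIV_nonneg_imp_nondecreasing[of s t smoothstep] DERIV_smoothstep smoothstep'_bounds by blast

lemma smoothstep_in: "smoothstep t \<in> {0..1}"
proof -
  have "smoothstep (min t 0) \<le> smoothstep t" "smoothstep t \<le> smoothstep (max t 1)"
    by (auto intro: smoothstep_mono)
  then show ?thesis using smoothstep_le_0[of "min t 0"] smoothstep_ge_1[of "max t 1"] by auto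
qed

lemma DERIV_smoothstep_affine:
  "((\<lambda>t. smoothstep (a * t + b)) has_real_derivative a * smoothstep' (a * t + b)) (at t)"
proof -
  have "((\<lambda>t. a * t + b) has_real_derivative a) (at t)" by (auto intro!: derivative_eq_intros)
  then show ?thesis
    using DERIV_chain2[OF DERIV_smoothstep, of "\<lambda>t. a * t + b" a t UNIV] by (simp add: mult.commute)
qed

lemma has_vector_derivative_smoothstep:
  assumes "\<And>t. t \<in> {0..1} \<Longrightarrow> (\<xi> has_vector_derivative D t) (at t)"
  shows "((\<lambda>t. \<xi> (smoothstep (a * t + b))) has_vector_derivative
           (a * smoothstep' (a * t + b)) *\<^sub>R D (smoothstep (a * t + b))) (at t)"
  using vector_diff_chain_at[OF DERIV_smoothstep_affine[unfolded has_real_derivative_iff_has_vector_derivative]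
      assms[OF smoothstep_in[of "a * t + b"]]]
  by (simp add: o_def)

lemma continuous_on_smoothstep_deriv:
  fixes D :: "real \<Rightarrow> 'a::real_normed_vector"
  assumes "continuous_on {0..1} D"
  shows "continuous_on A (\<lambda>t. (a * smoothstep' (a * t + b)) *\<^sub>R D (smoothstep (a * t + b)))"
proof -
  have affine: "continuous_on A (\<lambda>t. a * t + b)" by (intro continuous_intros)
  have "continuous_on A (\<lambda>t. smoothstep (a * t + b))"
    using continuous_on_compose2[OF continuous_on_smoothstep affine] by auto
  then have "continuous_on A (\<lambda>t. D (smoothstep (a * t + b)))"
    by (rule continuous_on_compose2[OF assms]) (use smoothstep_in in auto)
  moreover have "continuous_on A (\<lambda>t. smoothstep' (a * t + b))"
    using continuous_on_compose2[OF continuous_on_smoothstep' affine] by auto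
  ultimately show ?thesis by (intro continuous_intros)
qed

lemma has_integral_smoothstep_deriv:
  fixes D :: "real \<Rightarrow> 'a::euclidean_space"
  assumes "continuous_on {0..1} D" "a \<ge> 0" "b \<le> 0" "a + b \<ge> 1"
  shows "((\<lambda>t. norm ((a * smoothstep' (a * t + b)) *\<^sub>R D (smoothstep (a * t + b)))) has_integral
          integral {0..1} (\<lambda>t. norm (D t))) {0..1}"
proof -
  have "((\<lambda>t. norm ((a * smoothstep' (a * t + b)) *\<^sub>R D (smoothstep (a * t + b)))) has_integral
          integral {smoothstep (a * 0 + b)..smoothstep (a * 1 + b)} (\<lambda>t. norm (D t))) {0..1}"
  proof (rule integral_norm_substitution[where c = 0 and e = 1])
    show "((\<lambda>t. smoothstep (a * t + b)) has_real_derivative a * smoothstep' (a * t + b)) (at t)" for t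
      by (rule DERIV_smoothstep_affine)
  qed (use assms smoothstep_in smoothstep_mono smoothstep'_bounds in auto)
  then show ?thesis using assms by (simp add: smoothstep_le_0 smoothstep_ge_1)
qed

text \<open>
  Run through \<open>\<xi>\<close> during the first half of the unit interval and through \<open>\<zeta>\<close> during the second: the sum
  of the two reparametrized curves minus the common point \<open>y\<close> is of class \<open>C\<^sup>1\<close>, since one summand is
  always constant.
\<close>

lemma geo_dist_triangle: "geo_dist \<Omega> x z \<le> geo_dist \<Omega> x y + geo_dist \<Omega> y z"
proof (rule ennreal_le_epsilon)
  fix e :: real assume fin: "geo_dist \<Omega> x y + geo_dist \<Omega> y z < top" and e: "0 < e"
  obtain a b where ab: "geo_dist \<Omega> x y = ennreal a" "geo_dist \<Omega> y z = ennreal b" "a \<ge> 0" "b \<ge> 0"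
    using fin by (cases "geo_dist \<Omega> x y"; cases "geo_dist \<Omega> y z") auto
  have "geo_dist \<Omega> x y < ennreal (a + e/2)" "geo_dist \<Omega> y z < ennreal (b + e/2)"
    using ab e by (auto intro!: ennreal_lessI)
  then obtain \<xi> D \<zeta> E where
    \<xi>: "\<And>t. t \<in> {0..1} \<Longrightarrow> (\<xi> has_vector_derivative D t) (at t)"
      "continuous_on {0..1} D" "\<And>t. t \<in> {0..1} \<Longrightarrow> \<xi> t \<in> closure \<Omega>" "\<xi> 0 = x" "\<xi> 1 = y"
      "integral {0..1} (\<lambda>t. norm (D t)) < a + e/2" and
    \<zeta>: "\<And>t. t \<in> {0..1} \<Longrightarrow> (\<zeta> has_vector_derivative E t) (at t)"
      "continuous_on {0..1} E" "\<And>t. t \<in> {0..1} \<Longrightarrow> \<zeta> t \<in> closure \<Omega>" "\<zeta> 0 = y" "\<zeta> 1 = z"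
      "integral {0..1} (\<lambda>t. norm (E t)) < b + e/2"
    by (elim geo_dist_lessE) blast
  define D2 where "D2 t = (2 * smoothstep' (2 * t + 0)) *\<^sub>R D (smoothstep (2 * t + 0))" for t
  define E2 where "E2 t = (2 * smoothstep' (2 * t + (-1))) *\<^sub>R E (smoothstep (2 * t + (-1)))" for t
  define F where "F t = \<xi> (smoothstep (2 * t + 0)) + \<zeta> (smoothstep (2 * t + (-1))) - y" for t
  have cD: "continuous_on {0..1} D2" "continuous_on {0..1} E2"
    unfolding D2_def[abs_def] E2_def[abs_def]
    by (intro continuous_on_smoothstep_deriv \<xi>(2) \<zeta>(2))+
  have I: "integral {0..1} (\<lambda>t. norm (D2 t)) < a + e/2" "integral {0..1} (\<lambda>t. norm (E2 t)) < b + e/2"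
    using has_integral_smoothstep_deriv[OF \<xi>(2), of 2 0] has_integral_smoothstep_deriv[OF \<zeta>(2), of 2 "-1"]
      \<xi>(6) \<zeta>(6) unfolding D2_def E2_def by (simp_all add: integral_unique)
  have "geo_dist \<Omega> x z \<le> ennreal (a + b + e)"
  proof (rule geo_dist_le)
    show "(F has_vector_derivative D2 t + E2 t) (at t)" if "t \<in> {0..1}" for t
      unfolding F_def[abs_def] D2_def E2_def
      by (intro has_vector_derivative_diff_const[THEN iffD2] has_vector_derivative_add
          has_vector_derivative_smoothstep \<xi>(1) \<zeta>(1))
    show "continuous_on {0..1} (\<lambda>t. D2 t + E2 t)" by (intro continuous_on_add cD)
    show "F t \<in> closure \<Omega>" for t
    proof (cases "2 * t \<le> 1")
      case True
      then show ?thesis using \<xi>(3)[OF smoothstep_in] by (simp add: F_def smoothstep_le_0 \<zeta>(4))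
    next
      case False
      then show ?thesis using \<zeta>(3)[OF smoothstep_in, of "2 * t + (-1)"] by (simp add: F_def smoothstep_ge_1 \<xi>(5))
    qed
    show "F 0 = x" "F 1 = z" by (simp_all add: F_def smoothstep_le_0 smoothstep_ge_1 \<xi> \<zeta>)
    have "integral {0..1} (\<lambda>t. norm (D2 t + E2 t)) \<le> integral {0..1} (\<lambda>t. norm (D2 t) + norm (E2 t))"
      by (intro integral_le integrable_continuous_real continuous_intros cD norm_triangle_ineq)
    also have "\<dots> = integral {0..1} (\<lambda>t. norm (D2 t)) + integral {0..1} (\<lambda>t. norm (E2 t))"
      by (intro integral_add integrable_continuous_real continuous_intros cD)
    finally show "integral {0..1} (\<lambda>t. norm (D2 t + E2 t)) \<le> a + b + e" using I by simp
  qed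
  then show "geo_dist \<Omega> x z \<le> geo_dist \<Omega> x y + geo_dist \<Omega> y z + ennreal e"
    using ab e by (simp add: ennreal_plus)
qed

lemma geo_dist_subcurve:
  assumes \<xi>: "\<And>t. t \<in> {0..1} \<Longrightarrow> (\<xi> has_vector_derivative D t) (at t)" "continuous_on {0..1} D"
    "\<And>t. t \<in> {0..1} \<Longrightarrow> \<xi> t \<in> closure \<Omega>" and ab: "0 \<le> a" "a \<le> b" "b \<le> 1"
  shows "geo_dist \<Omega> (\<xi> a) (\<xi> b) \<le> ennreal (integral {a..b} (\<lambda>t. norm (D t)))"
proof -
  define g where "g t = a + t * (b - a)" for t
  have g_in: "g t \<in> {0..1}" if "t \<in> {0..1}" for t
  proof -
    have "0 \<le> t * (b - a)" using that ab by auto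
    moreover have "t * (b - a) \<le> 1 * (b - a)" using that ab by (intro mult_right_mono) auto
    ultimately show ?thesis using ab by (auto simp: g_def)
  qed
  have dg: "(g has_real_derivative (b - a)) (at t)" for t
    unfolding g_def[abs_def] by (auto intro!: derivative_eq_intros)
  have cg: "continuous_on A g" for A unfolding g_def[abs_def] by (intro continuous_intros)
  show ?thesis
  proof (rule geo_dist_le)
    show "((\<lambda>t. \<xi> (g t)) has_vector_derivative (b - a) *\<^sub>R D (g t)) (at t)" if "t \<in> {0..1}" for t
      using vector_diff_chain_at[OF dg[unfolded has_real_derivative_iff_has_vector_derivative] \<xi>(1)[OF g_in[OF that]]]
      by (simp add: o_def)
    show "continuous_on {0..1} (\<lambda>t. (b - a) *\<^sub>R D (g t))"
      by (intro continuous_intros continuous_on_compose2[OF \<xi>(2) cg]) (use g_in in auto)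
    have "((\<lambda>t. norm ((b - a) *\<^sub>R D (g t))) has_integral integral {g 0..g 1} (\<lambda>t. norm (D t))) {0..1}"
    proof (rule integral_norm_substitution[where c = 0 and e = 1])
      show "(g has_real_derivative (b - a)) (at t)" for t by (rule dg)
    qed (use ab g_in \<xi>(2) in \<open>auto simp: g_def\<close>)
    then have "integral {0..1} (\<lambda>t. norm ((b - a) *\<^sub>R D (g t))) = integral {g 0..g 1} (\<lambda>t. norm (D t))"
      by (rule integral_unique)
    then show "integral {0..1} (\<lambda>t. norm ((b - a) *\<^sub>R D (g t))) \<le> integral {a..b} (\<lambda>t. norm (D t))"
      by (simp only: g_def) simp
  qed (use \<xi>(3) g_in in \<open>auto simp: g_def\<close>)
qed

text \<open>
  Parametrizing by arc length would give speed at most \<open>L\<close> but fails where the derivative of \<open>\<xi>\<close>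
  vanishes. The function \<open>\<sigma>\<close> with \<open>\<sigma>' = norm D + \<theta>\<close> is strictly increasing with a \<open>C\<^sup>1\<close> inverse \<open>\<tau>\<close>, and the slack
  \<open>\<theta>\<close> between \<open>L\<close> and the length makes it map \<open>[0,1]\<close> onto \<open>[0,L]\<close>. The factor \<open>2\<close> is the maximal slope
  of \<open>smoothstep\<close>, which makes the curve constant near its ends and defined on the whole line.
\<close>

lemma bounded_speed_curve:
  fixes \<Omega> :: "'a::euclidean_space set"
  assumes "geo_dist \<Omega> x y < ennreal L"
  obtains f f' :: "real \<Rightarrow> 'a" where "\<And>t. (f has_vector_derivative f' t) (at t)" "continuous_on UNIV f'"
    "\<And>t. f t \<in> closure \<Omega>" "\<And>t. t \<le> 0 \<Longrightarrow> f t = x" "\<And>t. t \<ge> 1 \<Longrightarrow> f t = y" "\<And>t. norm (f' t) \<le> 2 * L"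
proof -
  obtain \<xi> D where \<xi>: "\<And>t. t \<in> {0..1} \<Longrightarrow> (\<xi> has_vector_derivative D t) (at t)"
      "continuous_on {0..1} D" "\<And>t. t \<in> {0..1} \<Longrightarrow> \<xi> t \<in> closure \<Omega>" "\<xi> 0 = x" "\<xi> 1 = y"
      "integral {0..1} (\<lambda>t. norm (D t)) < L"
    using assms by (rule geo_dist_lessE) blast
  define clamp where "clamp t = max 0 (min 1 t)" for t :: real
  define \<theta> where "\<theta> = L - integral {0..1} (\<lambda>t. norm (D t))"
  have \<theta>: "\<theta> > 0" using \<xi>(6) by (simp add: \<theta>_def)
  have L: "L > 0" using \<xi>(6) integral_nonneg[of "\<lambda>t. norm (D t)" "{0..1}"]
      integrable_continuous_real[OF continuous_on_norm[OF \<xi>(2)]] by auto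
  define q where "q s = norm (D (clamp s)) + \<theta>" for s
  have "continuous_on UNIV clamp" unfolding clamp_def[abs_def] by (intro continuous_intros)
  then have "continuous_on UNIV (\<lambda>s. D (clamp s))"
    by (rule continuous_on_compose2[OF \<xi>(2)]) (auto simp: clamp_def)
  then have q_cont: "continuous_on A q" for A
    unfolding q_def[abs_def] by (intro continuous_intros) (blast intro: continuous_on_subset)
  have q_ge: "q s \<ge> \<theta>" "q s > 0" "q s \<ge> norm (D (clamp s))" for s
    using \<theta> by (auto simp: q_def intro: add_nonneg_pos)
  \<comment> \<open>Working on \<open>(-1, 2)\<close> makes \<open>0\<close> and \<open>1\<close> interior points, so that \<open>\<tau>\<close> is differentiable at both ends of \<open>[0,L]\<close>.\<close>
  define \<sigma> where "\<sigma> t = integral {-1..t} q - integral {-1..0} q" for t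
  have d\<sigma>: "(\<sigma> has_real_derivative q t) (at t)" if "t \<in> {-1<..<2}" for t
  proof -
    have "((\<lambda>t. integral {-1..t} q) has_real_derivative q t) (at t within {-1..2})"
      using that by (intro integral_has_real_derivative q_cont) auto
    then have "((\<lambda>t. integral {-1..t} q) has_real_derivative q t) (at t within {-1<..<2})"
      by (rule DERIV_subset) auto
    then have "((\<lambda>t. integral {-1..t} q) has_real_derivative q t) (at t)"
      using that at_within_open[of t "{-1<..<2}"] by simp
    then show ?thesis unfolding \<sigma>_def[abs_def] by (auto intro!: derivative_eq_intros)
  qed
  have \<sigma>0: "\<sigma> 0 = 0" by (simp add: \<sigma>_def)
  have "integral {-1..0} q + integral {0..1} q = integral {-1..1} q"
    by (rule Henstock_Kurzweil_Integration.integral_combine) (auto intro: integrable_continuous_real q_cont)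
  moreover have "integral {0..1} q = integral {0..1} (\<lambda>t. norm (D t) + \<theta>)"
    by (rule integral_cong) (auto simp: q_def clamp_def)
  moreover have "integral {0..1} (\<lambda>t. norm (D t) + \<theta>) = integral {0..1} (\<lambda>t. norm (D t)) + \<theta>"
    using integral_add[OF integrable_continuous_real[OF continuous_on_norm[OF \<xi>(2)]] integrable_const_ivl[of \<theta> 0 1]]
    by simp
  ultimately have \<sigma>1: "\<sigma> 1 = L" by (simp add: \<sigma>_def \<theta>_def)
  have incr: "\<sigma> t - \<sigma> s \<ge> \<theta> * (t - s)" if st: "s \<in> {-1<..<2}" "t \<in> {-1<..<2}" "s \<le> t" for s t
  proof (cases "s = t")
    case False
    then obtain z where "s < z" "z < t" "\<sigma> t - \<sigma> s = (t - s) * q z"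
      using MVT2[of s t \<sigma> q] d\<sigma> st by auto
    then show ?thesis using q_ge(1)[of z] st by (simp add: mult.commute mult_left_mono)
  qed simp
  have \<sigma>_cont: "continuous_on {-1<..<2} \<sigma>"
    using d\<sigma> by (meson DERIV_continuous_on has_field_derivative_at_within)
  define \<tau> where "\<tau> = inv_into {-1<..<2} \<sigma>"
  have inj: "inj_on \<sigma> {-1<..<2}"
  proof (rule inj_onI)
    fix s t assume st: "s \<in> {-1<..<2}" "t \<in> {-1<..<2}" "\<sigma> s = \<sigma> t"
    have "\<theta> * (t - s) \<le> 0" if "s \<le> t" using incr[of s t] st that by auto
    moreover have "\<theta> * (s - t) \<le> 0" if "t \<le> s" using incr[of t s] st that by auto
    ultimately show "s = t" using \<theta> by (smt (verit) mult_pos_pos)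
  qed
  have \<sigma>_range: "\<exists>t\<in>{-1/2..3/2}. \<sigma> t = s" if "s \<in> {\<sigma> (-1/2)..\<sigma> (3/2)}" for s
  proof -
    have "continuous_on {-1/2..3/2} \<sigma>" by (rule continuous_on_subset[OF \<sigma>_cont]) auto
    then have "\<exists>t\<ge>-1/2. t \<le> 3/2 \<and> \<sigma> t = s"
      using that by (intro IVT') auto
    then show ?thesis by (metis atLeastAtMost_iff)
  qed
  have \<tau>: "\<tau> s \<in> {-1<..<2}" "\<sigma> (\<tau> s) = s" if s: "s \<in> {\<sigma> (-1/2)..\<sigma> (3/2)}" for s
  proof -
    have "s \<in> \<sigma> ` {-1<..<2}" using \<sigma>_range[OF s] by force
    then show "\<tau> s \<in> {-1<..<2}" "\<sigma> (\<tau> s) = s"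
      unfolding \<tau>_def by (rule inv_into_into, rule f_inv_into_f)
  qed
  have rng: "\<sigma> (-1/2) < 0" "L < \<sigma> (3/2)"
    using incr[of "-1/2" 0] incr[of 1 "3/2"] \<sigma>0 \<sigma>1 \<theta> by auto
  have \<tau>_lip: "\<bar>\<tau> s - \<tau> r\<bar> \<le> \<bar>s - r\<bar> / \<theta>"
    if s: "s \<in> {\<sigma> (-1/2)..\<sigma> (3/2)}" and r: "r \<in> {\<sigma> (-1/2)..\<sigma> (3/2)}" for s r
  proof -
    have "\<theta> * \<bar>\<tau> s - \<tau> r\<bar> \<le> \<bar>s - r\<bar>"
      using incr[of "\<tau> s" "\<tau> r"] incr[of "\<tau> r" "\<tau> s"] \<tau>[OF s] \<tau>[OF r]
      by (cases "\<tau> s \<le> \<tau> r") auto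
    then show ?thesis using \<theta> by (simp add: field_simps)
  qed
  have \<tau>01: "\<tau> 0 = 0" "\<tau> L = 1"
    using inj \<sigma>0 \<sigma>1 unfolding \<tau>_def by (metis inv_into_f_f greaterThanLessThan_iff neg_less_0_iff_less zero_less_one zero_less_numeral one_less_numeral_iff semiring_norm(76) less_trans)+
  have \<tau>_in: "\<tau> s \<in> {0..1}" if s: "s \<in> {0..L}" for s
  proof -
    have s': "s \<in> {\<sigma> (-1/2)..\<sigma> (3/2)}" using s rng by auto
    have "0 \<le> \<tau> s"
    proof (rule ccontr)
      assume "\<not> 0 \<le> \<tau> s"
      then have "\<theta> * (0 - \<tau> s) > 0" using \<theta> by (intro mult_pos_pos) auto
      then show False using incr[of "\<tau> s" 0] \<tau>[OF s'] \<sigma>0 s \<open>\<not> 0 \<le> \<tau> s\<close> by auto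
    qed
    moreover have "\<tau> s \<le> 1"
    proof (rule ccontr)
      assume "\<not> \<tau> s \<le> 1"
      then have "\<theta> * (\<tau> s - 1) > 0" using \<theta> by (intro mult_pos_pos) auto
      then show False using incr[of 1 "\<tau> s"] \<tau>[OF s'] \<sigma>1 s \<open>\<not> \<tau> s \<le> 1\<close> by auto
    qed
    ultimately show ?thesis by auto
  qed
  have \<tau>_cont: "isCont \<tau> s" if s: "s \<in> {\<sigma> (-1/2)<..<\<sigma> (3/2)}" for s
  proof -
    have "continuous_on {\<sigma> (-1/2)<..<\<sigma> (3/2)} \<tau>"
    proof (rule continuous_onI)
      fix r e :: real assume r: "r \<in> {\<sigma> (-1/2)<..<\<sigma> (3/2)}" and "e > 0"
      have "dist (\<tau> p) (\<tau> r) \<le> e" if "p \<in> {\<sigma> (-1/2)<..<\<sigma> (3/2)}" "dist p r < e * \<theta>" for p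
      proof -
        have "\<bar>\<tau> p - \<tau> r\<bar> \<le> \<bar>p - r\<bar> / \<theta>" using \<tau>_lip that r by auto
        also have "\<dots> \<le> e" using that \<theta> by (simp add: dist_real_def field_simps)
        finally show ?thesis by (simp add: dist_real_def)
      qed
      then show "\<exists>d>0. \<forall>p\<in>{\<sigma> (-1/2)<..<\<sigma> (3/2)}. dist p r < d \<longrightarrow> dist (\<tau> p) (\<tau> r) \<le> e"
        using \<open>e > 0\<close> \<theta> by (intro exI[of _ "e * \<theta>"]) auto
    qed
    then show ?thesis using s by (simp add: continuous_on_eq_continuous_at)
  qed
  have d\<tau>: "(\<tau> has_real_derivative inverse (q (\<tau> s))) (at s)" if s: "s \<in> {0..L}" for s
  proof (rule DERIV_inverse_function[where f = \<sigma> and a = "\<sigma> (-1/2)" and b = "\<sigma> (3/2)"])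
    show "(\<sigma> has_real_derivative q (\<tau> s)) (at (\<tau> s))" using d\<sigma> \<tau> s rng by auto
    show "q (\<tau> s) \<noteq> 0" using q_ge(2)[of "\<tau> s"] by auto
    show "isCont \<tau> s" using \<tau>_cont s rng by auto
  qed (use s rng \<tau> in auto)
  define w where "w t = L * smoothstep t" for t
  have w_in: "w t \<in> {0..L}" for t
    using smoothstep_in[of t] L by (auto simp: w_def)
  have dw: "(w has_real_derivative L * smoothstep' t) (at t)" for t
    unfolding w_def[abs_def] by (intro DERIV_cmult DERIV_smoothstep)
  have w_cont: "continuous_on UNIV w"
    unfolding w_def[abs_def] by (intro continuous_on_mult_left continuous_on_smoothstep)
  define f where "f t = \<xi> (\<tau> (w t))" for t
  define f' where "f' t = (L * smoothstep' t * inverse (q (\<tau> (w t)))) *\<^sub>R D (\<tau> (w t))" for t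
  show thesis
  proof
    show "(f has_vector_derivative f' t) (at t)" for t
    proof -
      have "((\<lambda>t. \<tau> (w t)) has_real_derivative inverse (q (\<tau> (w t))) * (L * smoothstep' t)) (at t)"
        using DERIV_chain2[OF d\<tau>[OF w_in] dw] .
      then show ?thesis
        using vector_diff_chain_at[of "\<lambda>t. \<tau> (w t)" _ t \<xi>, OF _ \<xi>(1)[OF \<tau>_in[OF w_in[of t]]]]
        unfolding f_def[abs_def] f'_def
        by (simp add: has_real_derivative_iff_has_vector_derivative o_def mult.commute)
    qed
    have "continuous_on {0..L} \<tau>"
      using \<tau>_cont rng by (intro continuous_at_imp_continuous_on) auto
    then have \<tau>w: "continuous_on UNIV (\<lambda>t. \<tau> (w t))"
      by (rule continuous_on_compose2[OF _ w_cont]) (use w_in in auto)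
    then have "continuous_on UNIV (\<lambda>t. D (\<tau> (w t)))"
      by (rule continuous_on_compose2[OF \<xi>(2)]) (use w_in \<tau>_in in auto)
    moreover have "continuous_on UNIV (\<lambda>t. q (\<tau> (w t)))"
      by (rule continuous_on_compose2[OF q_cont \<tau>w]) auto
    ultimately show "continuous_on UNIV f'"
      unfolding f'_def[abs_def] using q_ge(2)
      by (intro continuous_intros continuous_on_smoothstep') (auto simp: less_imp_neq[symmetric])
    show "f t \<in> closure \<Omega>" for t unfolding f_def by (intro \<xi>(3) \<tau>_in w_in)
    show "f t = x" if "t \<le> 0" for t using that by (simp add: f_def w_def smoothstep_le_0 \<tau>01 \<xi>)
    show "f t = y" if "t \<ge> 1" for t using that by (simp add: f_def w_def smoothstep_ge_1 \<tau>01 \<xi>)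
    show "norm (f' t) \<le> 2 * L" for t
    proof -
      let ?s = "\<tau> (w t)"
      have "clamp ?s = ?s" using \<tau>_in[OF w_in[of t]] by (auto simp: clamp_def)
      then have "inverse (q ?s) * norm (D ?s) \<le> 1"
        using q_ge(2,3)[of ?s] by (simp add: field_simps)
      then have "(L * smoothstep' t) * (inverse (q ?s) * norm (D ?s)) \<le> (L * 2) * 1"
        using L smoothstep'_bounds[of t] q_ge(2)[of ?s] by (intro mult_mono) auto
      moreover have "norm (f' t) = (L * smoothstep' t) * (inverse (q ?s) * norm (D ?s))"
        using L smoothstep'_bounds[of t] q_ge(2)[of ?s] by (simp add: f'_def abs_mult)
      ultimately show ?thesis by simp
    qed
  qed
qed

section \<open>Distances to boundary points\<close>

text \<open>
  A point \<open>x\<close> of the closure is approached by points \<open>a k\<close> of the domain at distance at most \<open>c / 8^k\<close>, and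
  consecutive ones are joined by curves of length at most \<open>5 * c / 8^k\<close>. The \<open>k\<close>-th curve is traversed
  during the interval \<open>[1 - 2^-k, 1 - 2^-(k+1)]\<close>, hence with speed \<open>O(4^-k)\<close>. The speeds are summable
  and tend to zero, so the sum of the increments converges to a curve that is of class \<open>C\<^sup>1\<close> up to its end
  point \<open>x\<close>. Bounding its length by the sum \<open>20 * c * 4/3\<close> of the maximal speeds gives the constant.
\<close>

lemma geo_dist_to_closure:
  fixes \<Omega> :: "'a::euclidean_space set"
  assumes near: "\<And>a b. a \<in> \<Omega> \<Longrightarrow> b \<in> \<Omega> \<Longrightarrow> dist a b \<le> \<rho> \<Longrightarrow> geo_dist \<Omega> a b \<le> ennreal (2 * dist a b)"
    and x: "x \<in> closure \<Omega>" and y: "y \<in> \<Omega>" and c: "dist y x \<le> c" "0 < c" "2 * c \<le> \<rho>"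
  shows "geo_dist \<Omega> y x \<le> ennreal (27 * c)"
proof -
  have "\<exists>a\<in>\<Omega>. dist a x \<le> c / 8 ^ k \<and> (k = 0 \<longrightarrow> a = y)" for k :: nat
  proof (cases "k = 0")
    case False
    then show ?thesis
      using x c(2) closure_approachable[of x \<Omega>] by (meson divide_pos_pos less_imp_le zero_less_numeral zero_less_power)
  qed (use y c in auto)
  then obtain a where a: "\<And>k. a k \<in> \<Omega>" "\<And>k. dist (a k) x \<le> c / 8 ^ k" "a 0 = y"
    by metis
  have "\<exists>f f'. (\<forall>t. (f has_vector_derivative f' t) (at t)) \<and> continuous_on UNIV f' \<and>
      (\<forall>t. f t \<in> closure \<Omega>) \<and> (\<forall>t\<le>0. f t = a k) \<and> (\<forall>t\<ge>1. f t = a (Suc k)) \<and>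
      (\<forall>t. norm (f' t) \<le> 10 * c / 8 ^ k)" for k
  proof -
    have "c / 8 ^ Suc k \<le> c / 8 ^ k" using c by (simp add: field_simps)
    then have d: "dist (a k) (a (Suc k)) \<le> 2 * c / 8 ^ k"
      using a(2)[of k] a(2)[of "Suc k"] dist_triangle3[of "a k" "a (Suc k)" x] by (simp add: dist_commute)
    also have "2 * c / 8 ^ k \<le> 2 * c / 1"
      using c by (intro divide_left_mono) auto
    also have "\<dots> \<le> \<rho>" using c by simp
    finally have "geo_dist \<Omega> (a k) (a (Suc k)) \<le> ennreal (2 * dist (a k) (a (Suc k)))"
      using near a by blast
    also have "2 * dist (a k) (a (Suc k)) \<le> 4 * c / 8 ^ k" using d by simp
    then have "ennreal (2 * dist (a k) (a (Suc k))) < ennreal (5 * c / 8 ^ k)"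
      using c by (intro ennreal_lessI) (auto simp: field_simps intro: order_le_less_trans)
    finally obtain f f' where "\<And>t. (f has_vector_derivative f' t) (at t)" "continuous_on UNIV f'"
      "\<And>t. f t \<in> closure \<Omega>" "\<And>t. t \<le> 0 \<Longrightarrow> f t = a k" "\<And>t. t \<ge> 1 \<Longrightarrow> f t = a (Suc k)"
      "\<And>t. norm (f' t) \<le> 2 * (5 * c / 8 ^ k)"
      by (rule bounded_speed_curve) blast
    then show ?thesis by (intro exI[of _ f] exI[of _ f']) simp
  qed
  then obtain F F' where F: "\<And>k t. (F k has_vector_derivative F' k t) (at t)"
    "\<And>k. continuous_on UNIV (F' k)" "\<And>k t. F k t \<in> closure \<Omega>"
    "\<And>k t. t \<le> 0 \<Longrightarrow> F k t = a k" "\<And>k t. t \<ge> 1 \<Longrightarrow> F k t = a (Suc k)"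
    "\<And>k t. norm (F' k t) \<le> 10 * c / 8 ^ k"
    by metis
  \<comment> \<open>\<open>u k\<close> maps the \<open>k\<close>-th time interval affinely onto \<open>[0,1]\<close>.\<close>
  define u where "u k t = 2 ^ Suc k * t - (2 ^ Suc k - 2)" for k :: nat and t :: real
  have u_Suc: "u (Suc k) t = 2 * u k t - 2" for k t by (simp add: u_def algebra_simps)
  define G where "G k t = F k (u k t) - a k" for k t
  define G' where "G' k t = 2 ^ Suc k *\<^sub>R F' k (u k t)" for k t
  define g' where "g' t = (\<Sum>k. G' k t)" for t
  have dG: "(G k has_vector_derivative G' k t) (at t)" for k t
  proof -
    have "(u k has_vector_derivative 2 ^ Suc k) (at t)"
      unfolding u_def[abs_def] by (auto intro!: derivative_eq_intros)
    then show ?thesis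
      using vector_diff_chain_at[of "u k" _ t "F k", OF _ F(1)[of k "u k t"]]
      unfolding G_def[abs_def] G'_def by (auto simp: o_def has_vector_derivative_diff_const)
  qed
  have cG': "continuous_on UNIV (G' k)" for k
    unfolding G'_def[abs_def] u_def[abs_def]
    by (intro continuous_intros continuous_on_compose2[OF F(2)]) auto
  have bG': "norm (G' k t) \<le> 20 * c * (1/4) ^ k" for k t
  proof -
    have "norm (G' k t) \<le> 2 ^ Suc k * (10 * c / 8 ^ k)"
      unfolding G'_def norm_scaleR using F(6)[of k "u k t"] by (intro mult_mono) auto
    also have "\<dots> = 20 * c * (2 ^ k / 8 ^ k)" by simp
    also have "(2::real) ^ k / 8 ^ k = (1/4) ^ k" by (simp add: power_divide[symmetric])
    finally show ?thesis .
  qed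
  have sm: "summable (\<lambda>k. 20 * c * (1/4::real) ^ k)" by (intro summable_mult summable_geometric) auto
  have ul: "uniform_limit UNIV (\<lambda>n t. \<Sum>k<n. G' k t) g' sequentially"
    unfolding g'_def[abs_def] by (rule Weierstrass_m_test[OF bG' sm])
  have cg': "continuous_on UNIV g'"
    by (rule uniform_limit_theorem[OF _ ul]) (auto intro!: always_eventually continuous_on_sum cG')
  have bg': "norm (g' t) \<le> 80/3 * c" for t
  proof -
    have "norm (g' t) \<le> (\<Sum>k. 20 * c * (1/4) ^ k)"
      unfolding g'_def by (rule norm_suminf_le[OF bG' sm])
    also have "\<dots> = 80/3 * c"
      using suminf_mult[OF summable_geometric[of "1/4::real"], of "20 * c"] suminf_geometric[of "1/4::real"] by simp
    finally show ?thesis .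
  qed
  have G0: "G k 0 = 0" for k
  proof -
    have "u k 0 \<le> 0" by (simp add: u_def)
    then show ?thesis by (simp add: G_def F(4))
  qed
  have "\<exists>g. \<forall>t\<in>UNIV. (\<lambda>k. G k t) sums g t \<and> (g has_derivative (\<lambda>h. h *\<^sub>R g' t)) (at t within UNIV)"
  proof (rule has_derivative_series[where f' = "\<lambda>k t h. h *\<^sub>R G' k t" and x = 0 and l = 0])
    show "(G k has_derivative (\<lambda>h. h *\<^sub>R G' k t)) (at t within UNIV)" for k t
      using dG[of k t] by (simp add: has_vector_derivative_def)
    fix e :: real assume "e > 0"
    from uniform_limitD[OF ul this]
    show "\<forall>\<^sub>F n in sequentially. \<forall>t\<in>UNIV. \<forall>h. norm ((\<Sum>i<n. h *\<^sub>R G' i t) - h *\<^sub>R g' t) \<le> e * norm h"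
    proof eventually_elim
      case (elim n)
      show ?case
      proof (intro ballI allI)
        fix t h
        have "norm ((\<Sum>i<n. h *\<^sub>R G' i t) - h *\<^sub>R g' t) = \<bar>h\<bar> * norm ((\<Sum>i<n. G' i t) - g' t)"
          by (simp add: scaleR_sum_right[symmetric] scaleR_diff_right[symmetric])
        also have "\<dots> \<le> \<bar>h\<bar> * e"
          using elim by (intro mult_left_mono) (auto simp: dist_norm less_imp_le)
        finally show "norm ((\<Sum>i<n. h *\<^sub>R G' i t) - h *\<^sub>R g' t) \<le> e * norm h" by (simp add: mult.commute)
      qed
    qed
  qed (simp_all add: G0)
  then obtain g where g: "\<And>t. (\<lambda>k. G k t) sums g t" "\<And>t. (g has_vector_derivative g' t) (at t)"
    by (auto simp: has_vector_derivative_def)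
  \<comment> \<open>Partial sums stay in the closure, since at any time at most one increment is neither zero nor complete.\<close>
  have part: "y + (\<Sum>k<n. G k t) \<in> closure \<Omega> \<and> (u n t \<ge> 0 \<longrightarrow> y + (\<Sum>k<n. G k t) = a n)" for n t
  proof (induction n)
    case 0
    then show ?case using a(3) y closure_subset by auto
  next
    case (Suc n)
    show ?case
    proof (cases "u n t \<ge> 0")
      case True
      have "y + (\<Sum>k<Suc n. G k t) = (y + (\<Sum>k<n. G k t)) + G n t" by (simp add: add.assoc)
      also have "\<dots> = a n + G n t" using Suc True by simp
      finally have eq: "y + (\<Sum>k<Suc n. G k t) = F n (u n t)" by (simp add: G_def)
      have "F n (u n t) = a (Suc n)" if "u (Suc n) t \<ge> 0" using that F(5) by (simp add: u_Suc)
      then show ?thesis using F(3) unfolding eq by auto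
    next
      case False
      then have "y + (\<Sum>k<Suc n. G k t) = y + (\<Sum>k<n. G k t)" using F(4) by (simp add: G_def)
      then show ?thesis using Suc False by (simp add: u_Suc)
    qed
  qed
  have lim: "(\<lambda>n. y + (\<Sum>k<n. G k t)) \<longlonglongrightarrow> y + g t" for t
    using g(1)[of t] unfolding sums_def by (intro tendsto_intros)
  have "a \<longlonglongrightarrow> x"
  proof (rule metric_tendsto_imp_tendsto)
    have "(\<lambda>k. c * (1/8) ^ k) \<longlonglongrightarrow> c * 0" by (intro tendsto_mult_left LIMSEQ_realpow_zero) auto
    then show "(\<lambda>k. c * (1/8) ^ k) \<longlonglongrightarrow> 0" by simp
    show "\<forall>\<^sub>F k in sequentially. dist (a k) x \<le> dist (c * (1/8) ^ k) 0"
      using a(2) c by (auto simp: power_divide)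
  qed
  moreover have "(\<lambda>n. y + (\<Sum>k<n. G k 1)) = a"
  proof
    show "y + (\<Sum>k<n. G k 1) = a n" for n using part[where n = n and t = 1] by (simp add: u_def)
  qed
  ultimately have y1: "y + g 1 = x" using lim[of 1] LIMSEQ_unique by metis
  have "geo_dist \<Omega> y x \<le> ennreal (80/3 * c)"
  proof (rule geo_dist_le)
    show "((\<lambda>t. y + g t) has_vector_derivative g' t) (at t)" for t
      using has_vector_derivative_add[OF has_vector_derivative_const g(2)[of t], of y] by simp
    show "continuous_on {0..1} g'" using cg' continuous_on_subset by blast
    show "y + g t \<in> closure \<Omega>" for t
      using lim[of t] part by (rule_tac closed_sequentially[OF closed_closure]) auto
    show "y + g 0 = y" using g(1)[of 0] sums_unique2[of "\<lambda>_. 0" 0 "g 0"] by (simp add: G0)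
    have "integral {0..1} (\<lambda>t. norm (g' t)) \<le> integral {0..1} (\<lambda>t::real. 80/3 * c)"
      using bg' by (intro integral_le integrable_continuous_real continuous_intros
          continuous_on_subset[OF cg']) auto
    then show "integral {0..1} (\<lambda>t. norm (g' t)) \<le> 80/3 * c" by simp
  qed (rule y1)
  also have "\<dots> \<le> ennreal (27 * c)" using c by (intro ennreal_leI) auto
  finally show ?thesis .
qed

lemma geo_dist_refl: "x \<in> closure \<Omega> \<Longrightarrow> geo_dist \<Omega> x x = 0"
  using geo_dist_le[of "\<lambda>_. x" "\<lambda>_. 0" \<Omega> x x 0] by auto

lemma domain_assumption_interior:
  assumes "domain_assumption \<Omega>" "\<kappa> > 0"
  shows "\<exists>\<rho>>0. \<forall>x\<in>\<Omega>. \<forall>y\<in>\<Omega>. dist x y \<le> \<rho> \<longrightarrow> geo_dist \<Omega> x y \<le> ennreal ((1 + \<kappa>) * dist x y)"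
proof -
  obtain \<phi> r where \<phi>: "((\<lambda>s. \<phi> s / s) \<longlongrightarrow> 0) (at_right (0::real))" and r: "r > (0::real)"
    "\<And>x y. x \<in> \<Omega> \<Longrightarrow> y \<in> \<Omega> \<Longrightarrow> norm (x - y) \<le> r \<Longrightarrow>
       geo_dist \<Omega> x y \<le> ennreal (norm (x - y) + \<phi> (norm (x - y)))"
    using assms(1) unfolding domain_assumption_def by blast
  obtain b where b: "b > 0" "\<And>s. 0 < s \<Longrightarrow> s < b \<Longrightarrow> \<phi> s / s < \<kappa>"
    using order_tendstoD(2)[OF \<phi> assms(2)] unfolding eventually_at_right_field by auto
  have "geo_dist \<Omega> x y \<le> ennreal ((1 + \<kappa>) * dist x y)"
    if xy: "x \<in> \<Omega>" "y \<in> \<Omega>" "dist x y \<le> min r (b/2)" for x y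
  proof (cases "x = y")
    case True
    then show ?thesis using geo_dist_refl[of y \<Omega>] xy closure_subset by auto
  next
    case False
    then have "\<phi> (dist x y) / dist x y < \<kappa>" using b xy by (intro b(2)) auto
    then have "norm (x - y) + \<phi> (norm (x - y)) \<le> (1 + \<kappa>) * dist x y"
      using False by (simp add: dist_norm field_simps)
    then show ?thesis using r(2)[of x y] xy ennreal_leI order_trans by (fastforce simp: dist_norm)
  qed
  then show ?thesis using r(1) b(1) by (intro exI[of _ "min r (b/2)"]) auto
qed

text \<open>
  Approximate both points from inside the domain. By \<open>geo_dist_to_closure\<close> the detour costs only a multiple of
  the Euclidean approximation error, so the first order estimate passes to the closure.
\<close>

lemma domain_assumption_closure:
  fixes \<Omega> :: "'a::euclidean_space set"
  assumes dom: "domain_assumption \<Omega>" and \<kappa>: "\<kappa> > 0"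
  shows "\<exists>\<rho>>0. \<forall>x\<in>closure \<Omega>. \<forall>y\<in>closure \<Omega>. dist x y < \<rho> \<longrightarrow>
           geo_dist \<Omega> x y \<le> ennreal ((1 + \<kappa>) * dist x y)"
proof -
  obtain \<rho>1 where \<rho>1: "\<rho>1 > 0" "\<And>x y. x \<in> \<Omega> \<Longrightarrow> y \<in> \<Omega> \<Longrightarrow> dist x y \<le> \<rho>1 \<Longrightarrow>
      geo_dist \<Omega> x y \<le> ennreal (2 * dist x y)"
    using domain_assumption_interior[OF dom zero_less_one] by auto
  obtain \<rho> where \<rho>: "\<rho> > 0" "\<And>x y. x \<in> \<Omega> \<Longrightarrow> y \<in> \<Omega> \<Longrightarrow> dist x y \<le> \<rho> \<Longrightarrow>
      geo_dist \<Omega> x y \<le> ennreal ((1 + \<kappa>) * dist x y)"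
    using domain_assumption_interior[OF dom \<kappa>] by blast
  have "geo_dist \<Omega> x y \<le> ennreal ((1 + \<kappa>) * dist x y)"
    if x: "x \<in> closure \<Omega>" and y: "y \<in> closure \<Omega>" and xy: "dist x y < \<rho>" for x y
  proof (rule ennreal_le_epsilon)
    fix e :: real assume "e > 0"
    define c where "c = min (e / (54 + 2 * (1 + \<kappa>))) (min (\<rho>1 / 2) ((\<rho> - dist x y) / 2))"
    have "c > 0" using \<open>e > 0\<close> \<kappa> \<rho>1(1) xy by (auto simp: c_def)
    have c': "c \<le> e / (54 + 2 * (1 + \<kappa>))" "c \<le> \<rho>1 / 2" "c \<le> (\<rho> - dist x y) / 2"
      unfolding c_def by (rule min.cobounded1, rule min.coboundedI2, rule min.cobounded1,
          rule min.coboundedI2, rule min.cobounded2)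
    have c: "c > 0" "c \<le> e / (54 + 2 * (1 + \<kappa>))" "2 * c \<le> \<rho>1" "2 * c \<le> \<rho> - dist x y"
      using \<open>c > 0\<close> c' by (simp_all add: field_simps)
    have ce: "(54 + 2 * (1 + \<kappa>)) * c \<le> e" using c(2) \<kappa> by (simp add: field_simps)
    obtain a b where ab: "a \<in> \<Omega>" "dist a x \<le> c" "b \<in> \<Omega>" "dist b y \<le> c"
      using x y c(1) unfolding closure_approachable by (meson less_imp_le)
    have dab: "dist a b \<le> dist x y + 2 * c"
      using dist_triangle[of a b x] dist_triangle[of x b y] ab by (simp add: dist_commute)
    have "geo_dist \<Omega> x y \<le> geo_dist \<Omega> x a + (geo_dist \<Omega> a b + geo_dist \<Omega> b y)"
      by (meson add_left_mono geo_dist_triangle order_trans)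
    also have "\<dots> \<le> ennreal (27 * c) + (ennreal ((1 + \<kappa>) * (dist x y + 2 * c)) + ennreal (27 * c))"
    proof (intro add_mono)
      show "geo_dist \<Omega> x a \<le> ennreal (27 * c)"
        using geo_dist_to_closure[OF \<rho>1(2) x ab(1,2) c(1,3)] by (simp add: geo_dist_commute)
      show "geo_dist \<Omega> b y \<le> ennreal (27 * c)"
        by (rule geo_dist_to_closure[OF \<rho>1(2) y ab(3,4) c(1,3)])
      have "geo_dist \<Omega> a b \<le> ennreal ((1 + \<kappa>) * dist a b)" using dab c(4) ab by (intro \<rho>(2)) auto
      also have "\<dots> \<le> ennreal ((1 + \<kappa>) * (dist x y + 2 * c))"
        using dab \<kappa> by (intro ennreal_leI mult_left_mono) auto
      finally show "geo_dist \<Omega> a b \<le> ennreal ((1 + \<kappa>) * (dist x y + 2 * c))" .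
    qed
    also have "\<dots> = ennreal (27 * c + ((1 + \<kappa>) * (dist x y + 2 * c) + 27 * c))"
      using c \<kappa> by (simp add: ennreal_plus[symmetric] del: ennreal_plus)
    also have "\<dots> \<le> ennreal ((1 + \<kappa>) * dist x y + e)"
      using ce by (intro ennreal_leI) (simp add: algebra_simps)
    finally show "geo_dist \<Omega> x y \<le> ennreal ((1 + \<kappa>) * dist x y) + ennreal e"
      using \<kappa> \<open>e > 0\<close> by (simp add: ennreal_plus[symmetric] del: ennreal_plus)
  qed
  then show ?thesis using \<rho>(1) by blast
qed

lemma geo_dist_finite:
  fixes \<Omega> :: "'a::euclidean_space set"
  assumes dom: "domain_assumption \<Omega>" and con: "connected \<Omega>" and xy: "x \<in> closure \<Omega>" "y \<in> closure \<Omega>"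
  shows "geo_dist \<Omega> x y < \<infinity>"
proof (rule connected_equivalence_relation[OF connected_imp_connected_closure[OF con] xy,
        of "\<lambda>x y. geo_dist \<Omega> x y < \<infinity>"])
  show "geo_dist \<Omega> z w < \<infinity>" if "geo_dist \<Omega> w z < \<infinity>" for w z
    using that by (simp add: geo_dist_commute)
  show "geo_dist \<Omega> p w < \<infinity>" if "geo_dist \<Omega> p z < \<infinity>" "geo_dist \<Omega> z w < \<infinity>" for p z w
    using geo_dist_triangle[of \<Omega> p w z] that ennreal_add_less_top
    by (metis infinity_ennreal_def order_le_less_trans)
  obtain \<rho> where \<rho>: "\<rho> > 0" "\<And>x y. x \<in> closure \<Omega> \<Longrightarrow> y \<in> closure \<Omega> \<Longrightarrow> dist x y < \<rho> \<Longrightarrow>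
      geo_dist \<Omega> x y \<le> ennreal (2 * dist x y)"
    using domain_assumption_closure[OF dom zero_less_one] by auto
  fix a assume a: "a \<in> closure \<Omega>"
  have "geo_dist \<Omega> a z < \<infinity>" if "z \<in> closure \<Omega> \<inter> ball a \<rho>" for z
    using \<rho>(2)[OF a, of z] that by (auto intro: order_le_less_trans)
  then show "\<exists>T. openin (top_of_set (closure \<Omega>)) T \<and> a \<in> T \<and> (\<forall>z\<in>T. geo_dist \<Omega> a z < \<infinity>)"
    using a \<rho>(1) by (intro exI[of _ "closure \<Omega> \<inter> ball a \<rho>"]) auto
qed

abbreviation geo_real :: "'a::euclidean_space set \<Rightarrow> 'a \<Rightarrow> 'a \<Rightarrow> real" where
  "geo_real \<Omega> x y \<equiv> enn2real (geo_dist \<Omega> x y)"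

lemma ennreal_geo_real:
  assumes "domain_assumption \<Omega>" "connected \<Omega>" "x \<in> closure \<Omega>" "y \<in> closure \<Omega>"
  shows "ennreal (geo_real \<Omega> x y) = geo_dist \<Omega> x y"
  using geo_dist_finite[OF assms] by (simp add: less_top)

lemma geo_near_isometric:
  fixes \<Omega> :: "'a::euclidean_space set"
  assumes dom: "domain_assumption \<Omega>" and con: "connected \<Omega>" and bd: "bounded \<Omega>"
  shows "compact_near_isometric (closure \<Omega>) (geo_real \<Omega>)"
proof
  show "compact (closure \<Omega>)" using bd by simp
  show "geo_real \<Omega> x x = 0" if "x \<in> closure \<Omega>" for x using geo_dist_refl[OF that] by simp
  show "geo_real \<Omega> x y = geo_real \<Omega> y x" for x y by (simp add: geo_dist_commute)
  fix x y assume xy: "x \<in> closure \<Omega>" "y \<in> closure \<Omega>"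
  note e = ennreal_geo_real[OF dom con]
  show "geo_real \<Omega> x z \<le> geo_real \<Omega> x y + geo_real \<Omega> y z" if z: "z \<in> closure \<Omega>" for z
  proof -
    have "ennreal (geo_real \<Omega> x z) \<le> ennreal (geo_real \<Omega> x y + geo_real \<Omega> y z)"
      unfolding ennreal_plus[OF enn2real_nonneg enn2real_nonneg] e[OF xy] e[OF xy(2) z] e[OF xy(1) z]
      by (rule geo_dist_triangle)
    then show ?thesis by (subst (asm) ennreal_le_iff) auto
  qed
  show "dist x y \<le> geo_real \<Omega> x y"
  proof -
    have "ennreal (dist x y) \<le> ennreal (geo_real \<Omega> x y)"
      unfolding e[OF xy] by (rule dist_le_geo_dist)
    then show ?thesis by (subst (asm) ennreal_le_iff) auto
  qed
next
  fix \<kappa> :: real assume "\<kappa> > 0"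
  obtain \<rho> where \<rho>: "\<rho> > 0" "\<And>x y. x \<in> closure \<Omega> \<Longrightarrow> y \<in> closure \<Omega> \<Longrightarrow> dist x y < \<rho> \<Longrightarrow>
      geo_dist \<Omega> x y \<le> ennreal ((1 + \<kappa>) * dist x y)"
    using domain_assumption_closure[OF dom \<open>\<kappa> > 0\<close>] by blast
  have "geo_real \<Omega> x y \<le> (1 + \<kappa>) * dist x y" if "x \<in> closure \<Omega>" "y \<in> closure \<Omega>" "dist x y < \<rho>" for x y
    using \<rho>(2)[OF that] \<open>\<kappa> > 0\<close> by (simp add: enn2real_leI)
  then show "\<exists>\<rho>>0. \<forall>x\<in>closure \<Omega>. \<forall>y\<in>closure \<Omega>. dist x y < \<rho> \<longrightarrow> geo_real \<Omega> x y \<le> (1 + \<kappa>) * dist x y"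
    using \<rho>(1) by blast
qed

text \<open>
  On an almost shortest curve from \<open>x\<close> to \<open>y\<close> the distance from \<open>x\<close> takes every intermediate value, and the
  remaining piece of the curve bounds the distance to \<open>y\<close>.
\<close>

lemma geo_length_space:
  fixes \<Omega> :: "'a::euclidean_space set"
  assumes dom: "domain_assumption \<Omega>" and con: "connected \<Omega>" and bd: "bounded \<Omega>"
  shows "compact_length_space (closure \<Omega>) (geo_real \<Omega>)"
proof -
  interpret compact_near_isometric "closure \<Omega>" "geo_real \<Omega>" by (rule geo_near_isometric[OF assms])
  show ?thesis
  proof
    fix x y s \<theta> assume xy: "x \<in> closure \<Omega>" "y \<in> closure \<Omega>" and s: "0 \<le> s" "s \<le> geo_real \<Omega> x y"
      and \<theta>: "(0::real) < \<theta>"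
    have "ennreal (geo_real \<Omega> x y) < ennreal (geo_real \<Omega> x y + \<theta>)"
      using s \<theta> by (intro ennreal_lessI) auto
    then have "geo_dist \<Omega> x y < ennreal (geo_real \<Omega> x y + \<theta>)"
      unfolding ennreal_geo_real[OF dom con xy] .
    then obtain \<xi> D where \<xi>: "\<And>t. t \<in> {0..1} \<Longrightarrow> (\<xi> has_vector_derivative D t) (at t)"
        "continuous_on {0..1} D" "\<And>t. t \<in> {0..1} \<Longrightarrow> \<xi> t \<in> closure \<Omega>" "\<xi> 0 = x" "\<xi> 1 = y"
        "integral {0..1} (\<lambda>t. norm (D t)) < geo_real \<Omega> x y + \<theta>"
      by (rule geo_dist_lessE) blast
    have "continuous_on {0..1} \<xi>"
      by (rule continuous_at_imp_continuous_on) (blast intro: \<xi>(1) has_vector_derivative_continuous)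
    then have "continuous_on {0..1} (\<lambda>t. geo_real \<Omega> x (\<xi> t))"
      by (rule continuous_on_compose2[OF continuous_on_d[OF xy(1)]]) (use \<xi>(3) in auto)
    then have "\<exists>t\<ge>0. t \<le> 1 \<and> geo_real \<Omega> x (\<xi> t) = s"
      using s \<xi>(4,5) d_refl[OF xy(1)] by (intro IVT') auto
    then obtain t where t: "0 \<le> t" "t \<le> 1" "geo_real \<Omega> x (\<xi> t) = s" by blast
    have I: "(\<lambda>t. norm (D t)) integrable_on {0..1}"
      by (intro integrable_continuous_real continuous_on_norm \<xi>(2))
    have nn: "integral {a..b} (\<lambda>t. norm (D t)) \<ge> 0" if "{a..b} \<subseteq> {0..1}" for a b
      by (intro integral_nonneg integrable_on_subinterval[OF I that]) auto
    have l1: "geo_real \<Omega> (\<xi> 0) (\<xi> t) \<le> integral {0..t} (\<lambda>t. norm (D t))"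
      using geo_dist_subcurve[OF \<xi>(1-3), of 0 t] t nn[of 0 t] by (simp add: enn2real_leI)
    have l2: "geo_real \<Omega> (\<xi> t) (\<xi> 1) \<le> integral {t..1} (\<lambda>t. norm (D t))"
      using geo_dist_subcurve[OF \<xi>(1-3), of t 1] t nn[of t 1] by (simp add: enn2real_leI)
    have "integral {0..t} (\<lambda>t. norm (D t)) + integral {t..1} (\<lambda>t. norm (D t)) = integral {0..1} (\<lambda>t. norm (D t))"
      by (rule Henstock_Kurzweil_Integration.integral_combine[OF t(1,2) I])
    then have "geo_real \<Omega> (\<xi> t) y \<le> geo_real \<Omega> x y - s + \<theta>"
      using l1 l2 \<xi>(4-6) t(3) by simp
    then show "\<exists>z\<in>closure \<Omega>. geo_real \<Omega> x z = s \<and> geo_real \<Omega> z y \<le> geo_real \<Omega> x y - s + \<theta>"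
      using \<xi>(3)[of t] t by auto
  qed
qed

lemma geo_topology_eq:
  fixes \<Omega> :: "'a::euclidean_space set"
  assumes "domain_assumption \<Omega>" "connected \<Omega>" "bounded \<Omega>"
  shows "geo_topology \<Omega> = top_of_set (closure \<Omega>)"
proof -
  interpret compact_near_isometric "closure \<Omega>" "geo_real \<Omega>" by (rule geo_near_isometric[OF assms])
  have "Metric_space (closure \<Omega>) (geo_real \<Omega>)"
  proof
    show "geo_real \<Omega> x y = geo_real \<Omega> y x" for x y by (simp add: geo_dist_commute)
    show "geo_real \<Omega> x y = 0 \<longleftrightarrow> x = y" if "x \<in> closure \<Omega>" "y \<in> closure \<Omega>" for x y
      using d_zero[OF that] d_refl[OF that(1)] by auto
    show "geo_real \<Omega> x z \<le> geo_real \<Omega> x y + geo_real \<Omega> y z"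
      if "x \<in> closure \<Omega>" "y \<in> closure \<Omega>" "z \<in> closure \<Omega>" for x y z
      using d_triangle[OF that] .
  qed simp
  then show ?thesis unfolding geo_topology_def by (rule mtopology_eq_top_of_set)
qed

section \<open>Absolutely minimizing extensions are sub- and supersolutions\<close>

lemma lip_const_le:
  assumes "\<And>x y. x \<in> A \<Longrightarrow> y \<in> A \<Longrightarrow> x \<noteq> y \<Longrightarrow> D x y = ennreal (r x y) \<and> 0 < r x y \<and> \<bar>v x - v y\<bar> \<le> L * r x y"
  shows "lip_const D v A \<le> ennreal L"
  unfolding lip_const_def
proof (rule SUP_least, clarify)
  fix x y assume xy: "x \<in> A" "y \<in> A" "x \<noteq> y"
  then have r: "D x y = ennreal (r x y)" "0 < r x y" "\<bar>v x - v y\<bar> \<le> L * r x y" using assms by auto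
  then have "ennreal \<bar>v x - v y\<bar> / D x y = ennreal (\<bar>v x - v y\<bar> / r x y)" by (simp add: divide_ennreal)
  also have "\<dots> \<le> ennreal L" using r by (intro ennreal_leI) (simp add: field_simps)
  finally show "ennreal \<bar>v x - v y\<bar> / D x y \<le> ennreal L" .
qed

lemma lip_constD:
  assumes "lip_const D v A \<le> ennreal L" "x \<in> A" "y \<in> A" "x \<noteq> y" "D x y = ennreal r" "0 < r" "0 \<le> L"
  shows "\<bar>v x - v y\<bar> \<le> L * r"
proof -
  have "ennreal \<bar>v x - v y\<bar> / D x y \<le> lip_const D v A"
    unfolding lip_const_def using assms(2-4) by (intro SUP_upper2[of "(x, y)"]) auto
  then have "ennreal (\<bar>v x - v y\<bar> / r) \<le> lip_const D v A"
    using assms(5,6) by (simp add: divide_ennreal)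
  from order_trans[OF this assms(1)] have "ennreal (\<bar>v x - v y\<bar> / r) \<le> ennreal L" .
  then have "\<bar>v x - v y\<bar> / r \<le> L" using assms(7) by (simp add: ennreal_le_iff)
  then show ?thesis using assms(6) by (simp add: field_simps)
qed

lemma lip_const_uminus: "lip_const D (\<lambda>x. - v x) A = lip_const D v A"
proof -
  have "\<bar>- v x - - v y\<bar> = \<bar>v x - v y\<bar>" for x y by simp
  then show ?thesis unfolding lip_const_def by simp
qed

lemma is_AMLE_uminus: "is_AMLE \<Omega> \<O> g u \<Longrightarrow> is_AMLE \<Omega> \<O> (\<lambda>x. - g x) (\<lambda>x. - u x)"
  unfolding is_AMLE_def lip_const_uminus by (auto intro: continuous_on_minus)

lemma is_AMLE_cone_subsolution:
  fixes \<Omega> :: "'a::euclidean_space set"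
  assumes dom: "domain_assumption \<Omega>" and con: "connected \<Omega>" and bd: "bounded \<Omega>"
    and u: "is_AMLE \<Omega> \<O> g u"
  shows "compact_length_space.cone_subsolution (closure \<Omega>) (geo_real \<Omega>) \<O> u"
proof -
  interpret compact_length_space "closure \<Omega>" "geo_real \<Omega>" by (rule geo_length_space[OF dom con bd])
  note topo = geo_topology_eq[OF dom con bd]
  show ?thesis
  proof (rule cone_subsolution_if_absolutely_minimal)
    show "continuous_on (closure \<Omega>) u" using u by (simp add: is_AMLE_def)
    fix V a p q
    assume V: "V \<subseteq> closure \<Omega> - \<O>" "openin (top_of_set (closure \<Omega>)) V" "connected V" and a: "(0::real) \<le> a"
      and fr: "\<And>p q. p \<in> closure \<Omega> \<inter> closure V - V \<Longrightarrow> q \<in> closure \<Omega> \<inter> closure V - V \<Longrightarrow>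
                 \<bar>u p - u q\<bar> \<le> a * geo_real \<Omega> p q"
      and pq: "p \<in> closure \<Omega> \<inter> closure V" "q \<in> closure \<Omega> \<inter> closure V"
    have cl: "geo_topology \<Omega> closure_of V = closure \<Omega> \<inter> closure V"
      unfolding topo using V(1) by (subst closure_of_subtopology) (simp add: Int_absorb1 subset_iff)
    have fro: "geo_topology \<Omega> frontier_of V = closure \<Omega> \<inter> closure V - V"
      unfolding frontier_of_def cl unfolding topo interior_of_openin[OF V(2)] ..
    have "connectedin (geo_topology \<Omega>) V"
      unfolding topo connectedin_subtopology using V(1,3) by auto
    then have eq: "lip_const (geo_dist \<Omega>) u (geo_topology \<Omega> closure_of V) =
        lip_const (geo_dist \<Omega>) u (geo_topology \<Omega> frontier_of V)"
      using u V(1,2) unfolding is_AMLE_def topo by blast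
    have pos: "geo_dist \<Omega> w z = ennreal (geo_real \<Omega> w z) \<and> 0 < geo_real \<Omega> w z"
      if "w \<in> closure \<Omega>" "z \<in> closure \<Omega>" "w \<noteq> z" for w z
    proof
      show "geo_dist \<Omega> w z = ennreal (geo_real \<Omega> w z)"
        by (rule ennreal_geo_real[OF dom con that(1,2), symmetric])
      have "geo_real \<Omega> w z \<noteq> 0" using d_zero[OF that(1,2)] that(3) by blast
      then show "0 < geo_real \<Omega> w z" using d_nonneg[OF that(1,2)] by linarith
    qed
    have "lip_const (geo_dist \<Omega>) u (closure \<Omega> \<inter> closure V - V) \<le> ennreal a"
      by (rule lip_const_le[where r = "geo_real \<Omega>"]) (use pos fr in auto)
    then have "lip_const (geo_dist \<Omega>) u (closure \<Omega> \<inter> closure V) \<le> ennreal a"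
      using eq unfolding cl fro by simp
    then show "\<bar>u p - u q\<bar> \<le> a * geo_real \<Omega> p q"
      using lip_constD[of "geo_dist \<Omega>" u "closure \<Omega> \<inter> closure V" a p q "geo_real \<Omega> p q"] pos[of p q] pq a
        d_refl[of p]
      by (cases "p = q") auto
  qed
qed

section \<open>Weighted graphs and their distance\<close>

lemma kernel_nonneg: "kernel_assumption \<eta> \<Longrightarrow> t > 0 \<Longrightarrow> 0 \<le> \<eta> t"
  by (simp add: kernel_assumption_def)

lemma kernel_eq_0:
  assumes "kernel_assumption \<eta>" "t > 1" shows "\<eta> t = 0"
proof (rule ccontr)
  assume "\<eta> t \<noteq> 0"
  then have "t \<in> closure {t. t > 0 \<and> \<eta> t \<noteq> 0}" using assms(2) closure_subset by fastforce
  then show False using assms unfolding kernel_assumption_def by auto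
qed

lemma kernel_sigma_pos: "kernel_assumption \<eta> \<Longrightarrow> kernel_sigma \<eta> > 0"
  by (simp add: kernel_assumption_def)

lemma kernel_le_sigma:
  assumes "kernel_assumption \<eta>" "t > 0" shows "t * \<eta> t \<le> kernel_sigma \<eta>"
  unfolding kernel_sigma_def using assms by (intro cSUP_upper) (auto simp: kernel_assumption_def)

text \<open>
  As \<open>\<eta>\<close> is nonincreasing, all edges of length at most \<open>t0 * h\<close> are at least as strong as those of the
  optimal length \<open>t0 * h\<close>, for which the graph cost equals the Euclidean length.
\<close>

lemma kernel_optimal_radius:
  assumes "kernel_assumption \<eta>"
  obtains t0 where "0 < t0" "t0 \<le> 1" "\<And>t. 0 < t \<Longrightarrow> t \<le> t0 \<Longrightarrow> kernel_sigma \<eta> \<le> t0 * \<eta> t"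
proof -
  obtain t0 where t0: "0 < t0" "t0 \<le> 1" "kernel_sigma \<eta> = t0 * \<eta> t0"
    using assms unfolding kernel_assumption_def by auto
  have "kernel_sigma \<eta> \<le> t0 * \<eta> t" if "0 < t" "t \<le> t0" for t
  proof -
    have "\<eta> t0 \<le> \<eta> t"
      using assms that t0(1) unfolding kernel_assumption_def by (auto dest: monotone_onD[of _ _ _ _ t t0])
    then show ?thesis using t0 by (simp add: mult_left_mono)
  qed
  then show ?thesis using that t0 by blast
qed

lemma graph_weight_commute: "graph_weight \<eta> h x y = graph_weight \<eta> h y x"
  by (simp add: graph_weight_def norm_minus_commute)

lemma graph_weight_nonneg:
  assumes "kernel_assumption \<eta>" "h > 0" shows "0 \<le> graph_weight \<eta> h x y"
  using assms kernel_nonneg[OF assms(1)] kernel_sigma_pos[OF assms(1)]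
  by (auto simp: graph_weight_def scaled_kernel_def)

text \<open>
  The normalization by \<open>kernel_sigma\<close> ensures that no edge is cheaper than its Euclidean length.
\<close>

lemma graph_weight_pos:
  assumes \<eta>: "kernel_assumption \<eta>" and h: "h > 0" and w: "graph_weight \<eta> h x y > 0"
  shows "dist x y \<le> h" "dist x y \<le> 1 / graph_weight \<eta> h x y"
proof -
  have xy: "x \<noteq> y" and e: "graph_weight \<eta> h x y = \<eta> (dist x y / h) / (kernel_sigma \<eta> * h)"
    using w by (auto simp: graph_weight_def scaled_kernel_def dist_norm split: if_splits)
  have "\<eta> (dist x y / h) \<noteq> 0" using w e by auto
  then have "\<not> dist x y / h > 1" using kernel_eq_0[OF \<eta>] by blast
  then show "dist x y \<le> h" using h by (simp add: field_simps)
  have "dist x y / h * \<eta> (dist x y / h) \<le> kernel_sigma \<eta>"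
    using xy h by (intro kernel_le_sigma[OF \<eta>]) auto
  then have "dist x y * graph_weight \<eta> h x y \<le> 1"
    unfolding e using kernel_sigma_pos[OF \<eta>] h by (simp add: field_simps)
  then show "dist x y \<le> 1 / graph_weight \<eta> h x y" using w by (simp add: field_simps)
qed

lemma graph_weight_near:
  assumes \<eta>: "kernel_assumption \<eta>" and h: "h > 0" and "0 < t0"
    and t0: "\<And>t. 0 < t \<Longrightarrow> t \<le> t0 \<Longrightarrow> kernel_sigma \<eta> \<le> t0 * \<eta> t"
    and xy: "x \<noteq> y" "dist x y \<le> t0 * h"
  shows "graph_weight \<eta> h x y > 0" "1 / graph_weight \<eta> h x y \<le> t0 * h"
proof -
  have e: "graph_weight \<eta> h x y = \<eta> (dist x y / h) / (kernel_sigma \<eta> * h)"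
    using xy by (auto simp: graph_weight_def scaled_kernel_def dist_norm)
  have k: "kernel_sigma \<eta> \<le> t0 * \<eta> (dist x y / h)"
    using xy h by (intro t0) (auto simp: field_simps)
  then have "\<eta> (dist x y / h) > 0"
    using kernel_sigma_pos[OF \<eta>] \<open>0 < t0\<close> by (meson less_le_trans zero_less_mult_pos)
  then show "graph_weight \<eta> h x y > 0" "1 / graph_weight \<eta> h x y \<le> t0 * h"
    using k kernel_sigma_pos[OF \<eta>] h unfolding e by (simp_all add: field_simps mult_left_mono)
qed

definition path_cost :: "(real \<Rightarrow> real) \<Rightarrow> real \<Rightarrow> nat \<Rightarrow> (nat \<Rightarrow> 'a::euclidean_space) \<Rightarrow> ennreal" where
  "path_cost \<eta> h N p = (\<Sum>i=1..N. inverse (ennreal (graph_weight \<eta> h (p (i - 1)) (p i))))"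

lemma path_cost_0 [simp]: "path_cost \<eta> h 0 p = 0"
  by (simp add: path_cost_def)

lemma path_cost_Suc [simp]:
  "path_cost \<eta> h (Suc N) p = path_cost \<eta> h N p + inverse (ennreal (graph_weight \<eta> h (p N) (p (Suc N))))"
  by (simp add: path_cost_def)

lemma graph_dist_le_path:
  fixes p :: "nat \<Rightarrow> 'a::euclidean_space"
  assumes "\<And>i. i \<le> N \<Longrightarrow> p i \<in> V" "p 0 = x" "p N = y"
  shows "graph_dist \<eta> h V x y \<le> path_cost \<eta> h N p"
proof (cases "x = y")
  case False
  then have eq: "graph_dist \<eta> h V x y = (INF (N, p)\<in>{(N :: nat, p :: nat \<Rightarrow> 'a). (\<forall>i\<le>N. p i \<in> V) \<and> p 0 = x \<and> p N = y}.
              path_cost \<eta> h N p)"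
    by (simp add: graph_dist_def path_cost_def)
  show ?thesis unfolding eq by (rule INF_lower2[of "(N, p)"]) (use assms in auto)
qed (simp add: graph_dist_def)

lemma graph_dist_greatest:
  fixes x :: "'a::euclidean_space"
  assumes "x \<in> V"
    and "\<And>(N :: nat) p. (\<And>i. i \<le> N \<Longrightarrow> p i \<in> V) \<Longrightarrow> p 0 = x \<Longrightarrow> p N = y \<Longrightarrow>
           c \<le> path_cost \<eta> h N p"
  shows "c \<le> graph_dist \<eta> h V x y"
proof (cases "x = y")
  case True
  then show ?thesis using assms(1) assms(2)[of 0 "\<lambda>_. x"] by simp
next
  case False
  then have eq: "graph_dist \<eta> h V x y = (INF (N, p)\<in>{(N :: nat, p :: nat \<Rightarrow> 'a). (\<forall>i\<le>N. p i \<in> V) \<and> p 0 = x \<and> p N = y}.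
              path_cost \<eta> h N p)"
    by (simp add: graph_dist_def path_cost_def)
  show ?thesis unfolding eq by (rule INF_greatest) (use assms(2) in auto)
qed

lemma graph_dist_step:
  assumes x: "x \<in> V" and z: "z \<in> V"
  shows "graph_dist \<eta> h V x z \<le> graph_dist \<eta> h V x y + inverse (ennreal (graph_weight \<eta> h y z))"
proof (cases "graph_dist \<eta> h V x z \<le> inverse (ennreal (graph_weight \<eta> h y z))")
  case False
  let ?w = "inverse (ennreal (graph_weight \<eta> h y z))"
  have fin: "?w \<noteq> top" using False by (metis top_greatest)
  have "graph_dist \<eta> h V x z - ?w \<le> graph_dist \<eta> h V x y"
  proof (rule graph_dist_greatest[OF x])
    fix N :: nat and p assume p: "\<And>i. i \<le> N \<Longrightarrow> p i \<in> V" "p 0 = x" "p N = y"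
    define q where "q i = (if i \<le> N then p i else z)" for i
    have "graph_dist \<eta> h V x z \<le> path_cost \<eta> h (Suc N) q"
      using p z by (intro graph_dist_le_path) (auto simp: q_def)
    also have "\<dots> = path_cost \<eta> h N q + ?w"
      using p by (simp add: q_def)
    also have "path_cost \<eta> h N q = path_cost \<eta> h N p"
      unfolding path_cost_def by (rule sum.cong) (auto simp: q_def)
    finally show "graph_dist \<eta> h V x z - ?w \<le> path_cost \<eta> h N p"
      using fin by (simp add: ennreal_minus_le_iff add.commute)
  qed
  then show ?thesis using fin by (simp add: ennreal_minus_le_iff add.commute)
qed (simp add: add_increasing)

text \<open>
  A vertex on a cheapest path preceding \<open>y\<close>. It is found by minimizing over the last step, which avoids
  showing that a cheapest path exists.
\<close>

lemma graph_dist_predecessor: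
  assumes V: "finite V" and x: "x \<in> V" and y: "x \<noteq> y" and fin: "graph_dist \<eta> h V x y < \<infinity>"
    and w: "\<And>p. 0 \<le> graph_weight \<eta> h p y"
  obtains p where "p \<in> V" "graph_weight \<eta> h p y > 0"
    "graph_dist \<eta> h V x p + inverse (ennreal (graph_weight \<eta> h p y)) \<le> graph_dist \<eta> h V x y"
proof -
  define f where "f p = graph_dist \<eta> h V x p + inverse (ennreal (graph_weight \<eta> h p y))" for p
  obtain p where p: "p \<in> V" "\<And>q. q \<in> V \<Longrightarrow> f p \<le> f q"
  proof -
    have "Min (f ` V) \<in> f ` V" using V x by (intro Min_in) auto
    then obtain p where "p \<in> V" "f p = Min (f ` V)" by force
    then show ?thesis using that V by simp
  qed
  have "f p \<le> graph_dist \<eta> h V x y"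
  proof (rule graph_dist_greatest[OF x])
    fix N :: nat and q assume q: "\<And>i. i \<le> N \<Longrightarrow> q i \<in> V" "q 0 = x" "q N = y"
    then obtain M where M: "N = Suc M" using y by (cases N) auto
    have "f p \<le> f (q M)" using q M p by auto
    also have "\<dots> \<le> path_cost \<eta> h M q +
        inverse (ennreal (graph_weight \<eta> h (q M) y))"
      unfolding f_def using q M by (intro add_right_mono graph_dist_le_path) auto
    also have "\<dots> = path_cost \<eta> h N q"
      using q M by simp
    finally show "f p \<le> path_cost \<eta> h N q" .
  qed
  moreover have "graph_weight \<eta> h p y \<noteq> 0"
  proof
    assume "graph_weight \<eta> h p y = 0"
    then have "f p = \<infinity>" by (simp add: f_def)
    then show False using \<open>f p \<le> graph_dist \<eta> h V x y\<close> fin by simp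
  qed
  ultimately show ?thesis using that p(1) w[of p] unfolding f_def by force
qed

text \<open>
  A metric that is bounded by \<open>C\<close> times the cost of every edge is bounded by \<open>C\<close> times the cost of every path.
\<close>

lemma graph_dist_ge:
  fixes d :: "'a::euclidean_space \<Rightarrow> 'a \<Rightarrow> real"
  assumes x: "x \<in> V" and refl: "d x x = 0" and C: "0 < C"
    and tri: "\<And>y z. y \<in> V \<Longrightarrow> z \<in> V \<Longrightarrow> d x z \<le> d x y + d y z"
    and nn: "\<And>y z. y \<in> V \<Longrightarrow> z \<in> V \<Longrightarrow> 0 \<le> d y z"
    and edge: "\<And>y z. y \<in> V \<Longrightarrow> z \<in> V \<Longrightarrow> graph_weight \<eta> h y z > 0 \<Longrightarrow> d y z \<le> C / graph_weight \<eta> h y z"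
    and w: "\<And>y z :: 'a. 0 \<le> graph_weight \<eta> h y z"
  shows "ennreal (d x y / C) \<le> graph_dist \<eta> h V x y"
proof (rule graph_dist_greatest[OF x])
  fix N :: nat and p assume "\<And>i. i \<le> N \<Longrightarrow> p i \<in> V" "p 0 = x" "p N = y"
  then show "ennreal (d x y / C) \<le> path_cost \<eta> h N p"
  proof (induction N arbitrary: y)
    case 0
    then show ?case using refl by simp
  next
    case (Suc N)
    have pV: "p N \<in> V" "y \<in> V" using Suc.prems by auto
    have "d x y / C \<le> d x (p N) / C + d (p N) y / C"
      using tri[OF pV] C by (simp add: add_divide_distrib[symmetric] divide_right_mono)
    then have "ennreal (d x y / C) \<le> ennreal (d x (p N) / C + d (p N) y / C)" by (rule ennreal_leI)
    also have "\<dots> = ennreal (d x (p N) / C) + ennreal (d (p N) y / C)"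
      using nn pV x C by (intro ennreal_plus) auto
    also have "\<dots> \<le> path_cost \<eta> h N p + inverse (ennreal (graph_weight \<eta> h (p N) y))"
    proof (rule add_mono)
      show "ennreal (d x (p N) / C) \<le> path_cost \<eta> h N p"
        using Suc.prems by (intro Suc.IH) auto
      show "ennreal (d (p N) y / C) \<le> inverse (ennreal (graph_weight \<eta> h (p N) y))"
      proof (cases "graph_weight \<eta> h (p N) y > 0")
        case True
        then have "d (p N) y / C \<le> inverse (graph_weight \<eta> h (p N) y)"
          using edge[OF pV True] C by (simp add: field_simps)
        then show ?thesis using True by (simp add: inverse_ennreal ennreal_leI)
      next
        case False
        then have "graph_weight \<eta> h (p N) y = 0" using w[of "p N" y] by simp
        then show ?thesis by simp
      qed
    qed
    also have "\<dots> = path_cost \<eta> h (Suc N) p" using Suc.prems by simp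
    finally show ?case .
  qed
qed

section \<open>Infinity harmonic functions on a finite graph\<close>

text \<open>
  Comparison with cones, where \<open>e\<close> plays the role of the distance from the vertex of the cone. If \<open>u\<close>
  exceeds the cone \<open>c + a * e\<close>, let \<open>b\<close> maximize the excess and, among the maximizers, \<open>u\<close>. Towards the vertex,
  \<open>u\<close> drops from \<open>b\<close> at least as fast as the cone, whose weighted slope there is \<open>a\<close> (\<open>pred\<close>). By the equation it
  rises equally fast towards some neighbour \<open>z\<close>. The cone rises with weighted slope at most \<open>a\<close> (\<open>slope\<close>), so \<open>z\<close>
  is again a maximizer, with a larger value of \<open>u\<close>.
\<close>

lemma graph_cone_comparison:
  fixes W :: "'a \<Rightarrow> 'a \<Rightarrow> real" and u e :: "'a \<Rightarrow> real"
  assumes V: "finite V" "A \<subseteq> V" and a: "a > 0" and W: "\<And>y z. 0 \<le> W y z"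
    and pred: "\<And>y. y \<in> A \<Longrightarrow> \<exists>p\<in>V. W y p > 0 \<and> e p + 1 / W y p \<le> e y"
    and slope: "\<And>y z. y \<in> A \<Longrightarrow> z \<in> V \<Longrightarrow> W y z > 0 \<Longrightarrow> e z \<le> e y + 1 / W y z"
    and harmonic: "\<And>y. y \<in> A \<Longrightarrow> (MIN z\<in>V. W y z * (u z - u y)) + (MAX z\<in>V. W y z * (u z - u y)) = 0"
    and bdry: "\<And>y z. y \<in> A \<Longrightarrow> z \<in> V - A \<Longrightarrow> W y z > 0 \<Longrightarrow> u z \<le> c + a * e z"
    and y: "y \<in> A"
  shows "u y \<le> c + a * e y"
proof (rule ccontr)
  assume contr: "\<not> ?thesis"
  define k where "k y = u y - c - a * e y" for y
  have A: "finite A" "A \<noteq> {}" using V finite_subset y by auto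
  define M where "M = Max (k ` A)"
  have M: "\<And>z. z \<in> A \<Longrightarrow> k z \<le> M" "M \<in> k ` A" using A by (auto simp: M_def)
  have "M > 0" using M(1)[OF y] contr by (simp add: k_def)
  define E where "E = {z\<in>A. k z = M}"
  have E: "finite E" "E \<noteq> {}" using A(1) M(2) by (auto simp: E_def)
  have "Max (u ` E) \<in> u ` E" using E by (intro Max_in) auto
  then obtain b where b: "b \<in> E" "u b = Max (u ` E)" by force
  have bmax: "u z \<le> u b" if "z \<in> E" for z using b(2) E that by simp
  have bA: "b \<in> A" "k b = M" using b by (auto simp: E_def)
  obtain p where p: "p \<in> V" "W b p > 0" "e p + 1 / W b p \<le> e b" using pred bA by blast
  have "k p \<le> M"
  proof (cases "p \<in> A")
    case False
    then have "k p \<le> 0" using bdry[OF bA(1), of p] p by (simp add: k_def)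
    then show ?thesis using \<open>M > 0\<close> by simp
  qed (rule M(1))
  then have "u p - u b \<le> a * (e p - e b)" using bA(2) by (simp add: k_def algebra_simps)
  also have "\<dots> \<le> a * (- (1 / W b p))" using p a by (intro mult_left_mono) auto
  finally have "W b p * (u p - u b) \<le> W b p * (a * (- (1 / W b p)))"
    using p by (intro mult_left_mono) auto
  then have "W b p * (u p - u b) \<le> - a" using p by simp
  moreover have "(MIN z\<in>V. W b z * (u z - u b)) \<le> W b p * (u p - u b)"
    using V p by (intro Min_le) auto
  ultimately have mx: "(MAX z\<in>V. W b z * (u z - u b)) \<ge> a" using harmonic[OF bA(1)] by linarith
  have "(MAX z\<in>V. W b z * (u z - u b)) \<in> (\<lambda>z. W b z * (u z - u b)) ` V"
    using V p by (intro Max_in) auto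
  then obtain z where z: "z \<in> V" "W b z * (u z - u b) \<ge> a" using mx by auto
  then have Wz: "W b z > 0" using a W[of b z] by (metis less_le mult_zero_left not_le)
  then have uz: "u z - u b \<ge> a * (1 / W b z)" using z(2) by (simp add: field_simps)
  have "a * (1 / W b z) > 0" using a Wz by simp
  then have "u z > u b" using uz by linarith
  have "a * e z \<le> a * (e b + 1 / W b z)" using slope[OF bA(1) z(1) Wz] a by (intro mult_left_mono) auto
  then have "k z \<ge> M" using uz bA(2) unfolding k_def distrib_left by linarith
  have "z \<in> A"
  proof (rule ccontr)
    assume "z \<notin> A"
    then have "k z \<le> 0" using bdry[OF bA(1), of z] z Wz by (simp add: k_def)
    then show False using \<open>k z \<ge> M\<close> \<open>M > 0\<close> by simp
  qed
  then have "z \<in> E" using M(1)[of z] \<open>k z \<ge> M\<close> by (simp add: E_def)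
  then show False using bmax[of z] \<open>u z > u b\<close> by simp
qed

lemma path_cost_reverse: "path_cost \<eta> h N (\<lambda>i. p (N - i)) = path_cost \<eta> h N p"
  unfolding path_cost_def
proof (rule sum.reindex_bij_witness[of _ "\<lambda>i. N + 1 - i" "\<lambda>i. N + 1 - i"])
  fix i assume "i \<in> {1..N}"
  then have "N + 1 - i - 1 = N - i" "N - (i - 1) = N + 1 - i" by auto
  then show "inverse (ennreal (graph_weight \<eta> h (p (N + 1 - i - 1)) (p (N + 1 - i)))) =
      inverse (ennreal (graph_weight \<eta> h (p (N - (i - 1))) (p (N - i))))"
    by (simp add: graph_weight_commute)
qed auto

lemma graph_dist_commute:
  fixes x :: "'a::euclidean_space"
  assumes "x \<in> V" "y \<in> V"
  shows "graph_dist \<eta> h V x y = graph_dist \<eta> h V y x"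
proof -
  have *: "graph_dist \<eta> h V y x \<le> graph_dist \<eta> h V x y" if "x \<in> V" for x y :: 'a
  proof (rule graph_dist_greatest[OF that])
    fix N :: nat and p assume p: "\<And>i. i \<le> N \<Longrightarrow> p i \<in> V" "p 0 = x" "p N = y"
    have "graph_dist \<eta> h V y x \<le> path_cost \<eta> h N (\<lambda>i. p (N - i))"
      unfolding path_cost_def using p by (intro graph_dist_le_path[unfolded path_cost_def]) auto
    then show "graph_dist \<eta> h V y x \<le> path_cost \<eta> h N p" by (simp add: path_cost_reverse)
  qed
  show ?thesis using *[OF assms(1)] *[OF assms(2)] by (rule antisym[rotated])
qed

lemma graph_dist_refl [simp]: "graph_dist \<eta> h V x x = 0"
  by (simp add: graph_dist_def)

abbreviation graph_real :: "(real \<Rightarrow> real) \<Rightarrow> real \<Rightarrow> 'a::euclidean_space set \<Rightarrow> 'a \<Rightarrow> 'a \<Rightarrow> real" where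
  "graph_real \<eta> h V x y \<equiv> enn2real (graph_dist \<eta> h V x y)"

lemma Min_uminus_image:
  fixes f :: "'a \<Rightarrow> real"
  assumes "finite V" "V \<noteq> {}"
  shows "(MIN y\<in>V. - f y) = - (MAX y\<in>V. f y)" "(MAX y\<in>V. - f y) = - (MIN y\<in>V. f y)"
proof -
  have "(MAX y\<in>V. f y) \<in> f ` V" "(MIN y\<in>V. f y) \<in> f ` V"
    using assms by (intro Max_in Min_in; simp)+
  then obtain a b where ab: "a \<in> V" "b \<in> V" "(MAX y\<in>V. f y) = f a" "(MIN y\<in>V. f y) = f b" by blast
  have "f y \<le> f a" "f b \<le> f y" if "y \<in> V" for y
    unfolding ab(3,4)[symmetric] using that assms(1) by simp_all
  then show "(MIN y\<in>V. - f y) = - (MAX y\<in>V. f y)" "(MAX y\<in>V. - f y) = - (MIN y\<in>V. f y)"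
    unfolding ab(3,4) using ab(1,2) assms(1) by (intro Min_eqI Max_eqI; auto)+
qed

lemma solves_graph_inf_laplace_uminus:
  fixes V :: "'a::euclidean_space set"
  assumes V: "finite V" and s: "solves_graph_inf_laplace \<eta> h V B g u"
  shows "solves_graph_inf_laplace \<eta> h V B (\<lambda>x. - g x) (\<lambda>x. - u x)"
  unfolding solves_graph_inf_laplace_def
proof (intro conjI ballI)
  fix x assume x: "x \<in> V - B"
  define f where "f y = scaled_kernel \<eta> h (norm (x - y)) * (u y - u x)" for y
  have f: "scaled_kernel \<eta> h (norm (x - y)) * (- u y - - u x) = - f y" for y
    by (simp add: f_def algebra_simps)
  have "(MIN y\<in>V. f y) + (MAX y\<in>V. f y) = 0"
    using s x unfolding solves_graph_inf_laplace_def f_def by blast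
  then show "(MIN y\<in>V. scaled_kernel \<eta> h (norm (x - y)) * (- u y - - u x)) +
     (MAX y\<in>V. scaled_kernel \<eta> h (norm (x - y)) * (- u y - - u x)) = 0"
    unfolding f using Min_uminus_image[OF V, of f] x by force
qed (use s in \<open>auto simp: solves_graph_inf_laplace_def\<close>)

lemma solution_cone_comparison:
  fixes V :: "'a::euclidean_space set"
  assumes \<eta>: "kernel_assumption \<eta>" and h: "h > 0" and V: "finite V" and A: "A \<subseteq> V - B" "x \<notin> A"
    and x: "x \<in> V" and a: "a > 0"
    and fin: "\<And>y. y \<in> V \<Longrightarrow> graph_dist \<eta> h V x y < \<infinity>"
    and u: "solves_graph_inf_laplace \<eta> h V B g u"
    and bdry: "\<And>y z. y \<in> A \<Longrightarrow> z \<in> V - A \<Longrightarrow> graph_weight \<eta> h y z > 0 \<Longrightarrow> u z \<le> c + a * graph_real \<eta> h V x z"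
    and y: "y \<in> A"
  shows "u y \<le> c + a * graph_real \<eta> h V x y"
proof (rule graph_cone_comparison[where V = V and A = A and W = "graph_weight \<eta> h" and u = u and a = a])
  have e: "graph_dist \<eta> h V x y = ennreal (graph_real \<eta> h V x y)" if "y \<in> V" for y
    using fin[OF that] by (simp add: less_top)
  show "\<exists>p\<in>V. graph_weight \<eta> h y p > 0 \<and> graph_real \<eta> h V x p + 1 / graph_weight \<eta> h y p \<le> graph_real \<eta> h V x y"
    if y: "y \<in> A" for y
  proof -
    have yV: "y \<in> V" "x \<noteq> y" using y A by auto
    obtain p where p: "p \<in> V" "graph_weight \<eta> h p y > 0"
      "graph_dist \<eta> h V x p + inverse (ennreal (graph_weight \<eta> h p y)) \<le> graph_dist \<eta> h V x y"
      using graph_dist_predecessor[OF V x yV(2) fin[OF yV(1)] graph_weight_nonneg[OF \<eta> h]] by blast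
    have "ennreal (graph_real \<eta> h V x p + 1 / graph_weight \<eta> h p y) =
        ennreal (graph_real \<eta> h V x p) + ennreal (1 / graph_weight \<eta> h p y)"
      using p(2) by (intro ennreal_plus) auto
    also have "\<dots> \<le> ennreal (graph_real \<eta> h V x y)"
      using p(3) unfolding inverse_ennreal[OF p(2)] e[OF p(1), symmetric] e[OF yV(1), symmetric]
      by (simp add: inverse_eq_divide)
    finally have "graph_real \<eta> h V x p + 1 / graph_weight \<eta> h p y \<le> graph_real \<eta> h V x y"
      by (subst (asm) ennreal_le_iff) auto
    then show ?thesis using p by (intro bexI[of _ p]) (auto simp: graph_weight_commute)
  qed
  show "graph_real \<eta> h V x z \<le> graph_real \<eta> h V x y + 1 / graph_weight \<eta> h y z"
    if "y \<in> A" "z \<in> V" "graph_weight \<eta> h y z > 0" for y z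
  proof -
    have yV: "y \<in> V" using that A by auto
    have "ennreal (graph_real \<eta> h V x z) \<le> ennreal (graph_real \<eta> h V x y) + inverse (ennreal (graph_weight \<eta> h y z))"
      using graph_dist_step[OF x that(2), of \<eta> h y] unfolding e[OF that(2), symmetric] e[OF yV, symmetric] .
    also have "\<dots> = ennreal (graph_real \<eta> h V x y + 1 / graph_weight \<eta> h y z)"
      unfolding inverse_ennreal[OF that(3)] inverse_eq_divide
      using that(3) by (intro ennreal_plus[symmetric]) auto
    finally show ?thesis using that(3) by (subst (asm) ennreal_le_iff) auto
  qed
  show "(MIN z\<in>V. graph_weight \<eta> h y z * (u z - u y)) + (MAX z\<in>V. graph_weight \<eta> h y z * (u z - u y)) = 0"
    if "y \<in> A" for y
  proof -
    have eq: "(\<lambda>z. graph_weight \<eta> h y z * (u z - u y)) = (\<lambda>z. scaled_kernel \<eta> h (norm (y - z)) * (u z - u y))"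
      by (auto simp: graph_weight_def)
    have "y \<in> V - B" using that A(1) by auto
    then show ?thesis using u unfolding solves_graph_inf_laplace_def eq by blast
  qed
qed (use A V a y graph_weight_nonneg[OF \<eta> h] bdry in auto)

text \<open>
  The solution does not increase the Lipschitz constant \<open>L\<close> of the labels. Cones of slope \<open>L\<close> with vertex in
  \<open>B\<close> bound \<open>u\<close> from above and, applied to \<open>- u\<close>, from below. The lower bound says that the cone with an
  arbitrary vertex \<open>x\<close> dominates \<open>u\<close> on \<open>B\<close>, so comparison applies a second time.
\<close>

lemma solution_lipschitz:
  fixes V :: "'a::euclidean_space set"
  assumes \<eta>: "kernel_assumption \<eta>" and h: "h > 0" and V: "finite V" "B \<subseteq> V"
    and L: "L > 0"
    and fin: "\<And>x y. x \<in> V \<Longrightarrow> y \<in> V \<Longrightarrow> graph_dist \<eta> h V x y < \<infinity>"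
    and u: "solves_graph_inf_laplace \<eta> h V B g u"
    and lip: "\<And>x y. x \<in> B \<Longrightarrow> y \<in> B \<Longrightarrow> \<bar>g x - g y\<bar> \<le> L * graph_real \<eta> h V x y"
    and xy: "x \<in> V" "y \<in> V"
  shows "\<bar>u x - u y\<bar> \<le> L * graph_real \<eta> h V x y"
proof -
  have ug: "u z = g z" if "z \<in> B" for z using u that by (simp add: solves_graph_inf_laplace_def)
  have from_B: "u y \<le> u x + L * graph_real \<eta> h V x y"
    if u: "solves_graph_inf_laplace \<eta> h V B g u" and lip: "\<And>x y. x \<in> B \<Longrightarrow> y \<in> B \<Longrightarrow> \<bar>g x - g y\<bar> \<le> L * graph_real \<eta> h V x y"
      and x: "x \<in> B" and y: "y \<in> V" for u g x y
  proof -
    have onB: "u z \<le> u x + L * graph_real \<eta> h V x z" if "z \<in> B" for z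
      using lip[OF that x] lip[OF x that] u x that by (simp add: solves_graph_inf_laplace_def abs_le_iff)
    show ?thesis
    proof (cases "y \<in> B")
      case False
      show ?thesis
      proof (rule solution_cone_comparison[OF \<eta> h V(1) _ _ _ L _ u, where A = "V - B"])
        show "u z \<le> u x + L * graph_real \<eta> h V x z" if "z \<in> V - (V - B)" for z using onB that by auto
      qed (use x y V False fin in auto)
    qed (rule onB)
  qed
  have neg: "solves_graph_inf_laplace \<eta> h V B (\<lambda>x. - g x) (\<lambda>x. - u x)" by (rule solves_graph_inf_laplace_uminus[OF V(1) u])
  have upper: "u y \<le> u x + L * graph_real \<eta> h V x y" if xy: "x \<in> V" "y \<in> V" for x y
  proof -
    have toB: "u z \<le> u x + L * graph_real \<eta> h V x z" if z: "z \<in> B" for z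
    proof -
      have "\<bar>- g x - - g y\<bar> = \<bar>g x - g y\<bar>" for x y by simp
      then have "- u x \<le> - u z + L * graph_real \<eta> h V z x" using from_B[OF neg _ z xy(1)] lip by simp
      moreover have "z \<in> V" using z V by auto
      ultimately show ?thesis using graph_dist_commute[OF xy(1), of z] by simp
    qed
    show ?thesis
    proof (cases "y \<in> B \<or> y = x")
      case True
      then show ?thesis using toB by auto
    next
      case False
      show ?thesis
      proof (rule solution_cone_comparison[OF \<eta> h V(1) _ _ xy(1) L _ u, where A = "V - B - {x}"])
        show "u z \<le> u x + L * graph_real \<eta> h V x z" if "z \<in> V - (V - B - {x})" for z
          using toB that by auto
      qed (use xy V False fin in auto)
    qed
  qed
  show ?thesis
    using upper[OF xy] upper[OF xy(2,1)] graph_dist_commute[OF xy] by (simp add: abs_le_iff)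
qed

section \<open>Graph distances approximate the geodesic distance\<close>

locale graph_approximation = compact_length_space X d
  for X :: "'a::euclidean_space set" and d +
  fixes V :: "nat \<Rightarrow> 'a set" and \<eta> :: "real \<Rightarrow> real" and h \<delta> :: "nat \<Rightarrow> real" and \<pi> :: "nat \<Rightarrow> 'a \<Rightarrow> 'a"
  assumes V_subset: "V n \<subseteq> X" and V_finite: "finite (V n)"
    and proj_in: "x \<in> X \<Longrightarrow> \<pi> n x \<in> V n"
    and proj_dist: "x \<in> X \<Longrightarrow> dist x (\<pi> n x) \<le> \<delta> n"
    and proj_id: "x \<in> V n \<Longrightarrow> \<pi> n x = x"
    and kernel: "kernel_assumption \<eta>"
    and h_pos: "h n > 0"
    and h_lim: "h \<longlonglongrightarrow> 0"
    and \<delta>_lim: "(\<lambda>n. \<delta> n / h n) \<longlonglongrightarrow> 0"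
begin

abbreviation D :: "nat \<Rightarrow> 'a \<Rightarrow> 'a \<Rightarrow> ennreal" where
  "D n \<equiv> graph_dist \<eta> (h n) (V n)"

lemma eventually_h_small: "e > 0 \<Longrightarrow> \<forall>\<^sub>F n in sequentially. h n < e"
  using order_tendstoD(2)[OF h_lim] by blast

lemma eventually_\<delta>_small:
  assumes "e > 0"
  shows "\<forall>\<^sub>F n in sequentially. \<delta> n < e"
proof -
  have "(\<lambda>n. \<delta> n / h n * h n) \<longlonglongrightarrow> 0 * 0" by (intro tendsto_mult \<delta>_lim h_lim)
  moreover have "\<delta> n / h n * h n = \<delta> n" for n using h_pos[of n] by simp
  ultimately have "\<delta> \<longlonglongrightarrow> 0" by simp
  then show ?thesis using order_tendstoD(2) assms by blast
qed

lemma eventually_proj_near: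
  assumes "e > 0"
  shows "\<forall>\<^sub>F n in sequentially. \<forall>x\<in>X. d x (\<pi> n x) < e"
proof -
  obtain \<rho> where "\<rho> > 0" and \<rho>: "\<forall>x\<in>X. \<forall>y\<in>X. dist x y < \<rho> \<longrightarrow> d x y < e"
    using d_small[OF assms] by blast
  show ?thesis
    using eventually_\<delta>_small[OF \<open>\<rho> > 0\<close>]
  proof eventually_elim
    case (elim n)
    show ?case
    proof
      fix x assume x: "x \<in> X"
      have "\<pi> n x \<in> X" using proj_in[OF x] V_subset by blast
      moreover have "dist x (\<pi> n x) < \<rho>" using proj_dist[OF x, of n] elim by simp
      ultimately show "d x (\<pi> n x) < e" using \<rho> x by blast
    qed
  qed
qed

text \<open>
  Edges have length at most \<open>h n\<close>, and at this scale \<open>d\<close> exceeds the Euclidean length by a factor close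
  to one only. As \<open>d\<close> is bounded, the relative error becomes an additive one.
\<close>

lemma eventually_graph_dist_ge:
  assumes \<kappa>: "\<kappa> > 0"
  shows "\<forall>\<^sub>F n in sequentially. \<forall>x\<in>V n. \<forall>y\<in>V n. ennreal (d x y - \<kappa>) \<le> D n x y"
proof -
  obtain M where M: "M > 0" "\<forall>x\<in>X. \<forall>y\<in>X. d x y \<le> M" using d_bounded by blast
  define c where "c = \<kappa> / M"
  have c: "c > 0" "c * M = \<kappa>" using \<kappa> M(1) by (auto simp: c_def)
  obtain \<rho> where "\<rho> > 0" and \<rho>: "\<forall>x\<in>X. \<forall>y\<in>X. dist x y < \<rho> \<longrightarrow> d x y \<le> (1 + c) * dist x y"
    using d_near[OF c(1)] by blast
  show ?thesis
    using eventually_h_small[OF \<open>\<rho> > 0\<close>]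
  proof eventually_elim
    case (elim n)
    show ?case
    proof (intro ballI)
      fix x y assume xy: "x \<in> V n" "y \<in> V n"
      have VX: "z \<in> X" if "z \<in> V n" for z using V_subset that by blast
      have "ennreal (d x y / (1 + c)) \<le> D n x y"
      proof (rule graph_dist_ge[OF xy(1)])
        show "d y z \<le> (1 + c) / graph_weight \<eta> (h n) y z"
          if yz: "y \<in> V n" "z \<in> V n" "graph_weight \<eta> (h n) y z > 0" for y z
        proof -
          note w = graph_weight_pos[OF kernel h_pos yz(3)]
          have "d y z \<le> (1 + c) * dist y z" using \<rho> VX yz w(1) elim by simp
          also have "\<dots> \<le> (1 + c) * (1 / graph_weight \<eta> (h n) y z)"
            using c w(2) by (intro mult_left_mono) auto
          finally show ?thesis by simp
        qed
      qed (use VX xy c d_refl d_triangle d_nonneg graph_weight_nonneg[OF kernel h_pos] in auto)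
      moreover have "d x y - \<kappa> \<le> d x y / (1 + c)"
      proof -
        have "c * d x y \<le> \<kappa>"
          using M(2) VX xy c mult_left_mono[of "d x y" M c] by simp
        moreover have "\<kappa> * 1 \<le> \<kappa> * (1 + c)" using \<kappa> c by (intro mult_left_mono) auto
        ultimately have "(d x y - \<kappa>) * (1 + c) \<le> d x y" by (simp add: algebra_simps)
        then show ?thesis using c by (simp add: pos_le_divide_eq)
      qed
      ultimately show "ennreal (d x y - \<kappa>) \<le> D n x y" by (meson ennreal_leI order_trans)
    qed
  qed
qed

text \<open>
  Cut a shortest path from \<open>x\<close> to \<open>y\<close> into \<open>m\<close> pieces of length at most \<open>s\<close> and project the division points to
  the graph. Projecting moves each point by at most \<open>\<delta> n\<close>, so the resulting edges have length at most \<open>t0 * h n\<close>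
  and cost at most \<open>t0 * h n\<close>.
\<close>

lemma graph_dist_chain:
  assumes t0: "0 < t0" "\<And>t. 0 < t \<Longrightarrow> t \<le> t0 \<Longrightarrow> kernel_sigma \<eta> \<le> t0 * \<eta> t"
    and s: "s \<ge> 0" "s + 2 * \<delta> n \<le> t0 * h n"
    and x: "x \<in> X" and y: "y \<in> X" "d x y \<le> real m * s"
  shows "D n (\<pi> n x) (\<pi> n y) \<le> ennreal (real m * (t0 * h n))"
  using y
proof (induction m arbitrary: y)
  case 0
  then have "x = y" using d_zero[of x y] d_nonneg[of x y] x by simp
  then show ?case by simp
next
  case (Suc m)
  then have "d x y \<le> real m * s + s" by (simp add: algebra_simps)
  then obtain z where z: "z \<in> X" "d x z \<le> real m * s" "d z y \<le> s"
    using between_dcball[of x y "real m * s" s] Suc.prems x s by auto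
  have IH: "D n (\<pi> n x) (\<pi> n z) \<le> ennreal (real m * (t0 * h n))" by (rule Suc.IH[OF z(1,2)])
  have th: "t0 * h n > 0" using t0 h_pos by simp
  show ?case
  proof (cases "\<pi> n z = \<pi> n y")
    case True
    have "real m * (t0 * h n) \<le> real (Suc m) * (t0 * h n)" using th by (intro mult_right_mono) auto
    then show ?thesis using IH True by (metis ennreal_leI order_trans)
  next
    case False
    have "dist (\<pi> n z) (\<pi> n y) \<le> dist z (\<pi> n z) + dist z y + dist y (\<pi> n y)"
      using dist_triangle[of "\<pi> n z" "\<pi> n y" z] dist_triangle[of z "\<pi> n y" y] by (simp add: dist_commute)
    also have "\<dots> \<le> t0 * h n"
      using proj_dist[OF z(1), of n] proj_dist[OF Suc.prems(1), of n] dist_le_d[OF z(1) Suc.prems(1)] z(3) s(2) by simp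
    finally have w: "graph_weight \<eta> (h n) (\<pi> n z) (\<pi> n y) > 0"
        "1 / graph_weight \<eta> (h n) (\<pi> n z) (\<pi> n y) \<le> t0 * h n"
      using graph_weight_near[OF kernel h_pos t0 False] by auto
    have "D n (\<pi> n x) (\<pi> n y) \<le> D n (\<pi> n x) (\<pi> n z) + inverse (ennreal (graph_weight \<eta> (h n) (\<pi> n z) (\<pi> n y)))"
      using proj_in x Suc.prems(1) by (intro graph_dist_step) auto
    also have "\<dots> \<le> ennreal (real m * (t0 * h n)) + ennreal (t0 * h n)"
      unfolding inverse_ennreal[OF w(1)] using w(2) by (intro add_mono IH ennreal_leI) (simp add: inverse_eq_divide)
    also have "\<dots> = ennreal (real (Suc m) * (t0 * h n))"
    proof -
      have "real (Suc m) * (t0 * h n) = real m * (t0 * h n) + t0 * h n" by (simp add: algebra_simps)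
      moreover have "0 \<le> real m * (t0 * h n)" by (rule mult_nonneg_nonneg) (use th in auto)
      ultimately show ?thesis using th by (simp only: ennreal_plus less_imp_le)
    qed
    finally show ?thesis .
  qed
qed

text \<open>
  Use \<open>graph_dist_chain\<close> with pieces of length \<open>s = (1 - \<theta>) * t0 * h n\<close>, which is admissible once \<open>2 * \<delta> n\<close> is at most
  \<open>\<theta> * t0 * h n\<close>. Here \<open>\<delta> n / h n \<longlonglongrightarrow> 0\<close> is essential. The cost of the pieces exceeds \<open>d x y\<close> by the factor
  \<open>1 / (1 - \<theta>) \<le> 1 + 2 * \<theta>\<close>, and rounding their number up costs at most one more edge.
\<close>

lemma eventually_graph_dist_le:
  assumes \<kappa>: "\<kappa> > 0"
  shows "\<forall>\<^sub>F n in sequentially. \<forall>x\<in>X. \<forall>y\<in>X. D n (\<pi> n x) (\<pi> n y) \<le> ennreal (d x y + \<kappa>)"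
proof -
  obtain t0 where t0: "0 < t0" "t0 \<le> 1" "\<And>t. 0 < t \<Longrightarrow> t \<le> t0 \<Longrightarrow> kernel_sigma \<eta> \<le> t0 * \<eta> t"
    using kernel_optimal_radius[OF kernel] by blast
  obtain M where M: "M > 0" "\<forall>x\<in>X. \<forall>y\<in>X. d x y \<le> M" using d_bounded by blast
  define \<theta> where "\<theta> = min (1/2) (\<kappa> / (4 * M))"
  have \<theta>: "0 < \<theta>" "\<theta> \<le> 1/2" using \<kappa> M(1) by (auto simp: \<theta>_def)
  have "\<theta> \<le> \<kappa> / (4 * M)" by (simp add: \<theta>_def)
  then have \<theta>M: "2 * \<theta> * M \<le> \<kappa> / 2" using M(1) by (simp add: field_simps)
  have "t0 * \<theta> / 2 > 0" using t0 \<theta> by simp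
  then have "\<forall>\<^sub>F n in sequentially. \<delta> n / h n < t0 * \<theta> / 2" using order_tendstoD(2)[OF \<delta>_lim] by blast
  moreover have "\<forall>\<^sub>F n in sequentially. h n < \<kappa> / 2" using eventually_h_small[of "\<kappa> / 2"] \<kappa> by simp
  ultimately show ?thesis
  proof eventually_elim
    case (elim n)
    define b where "b = t0 * h n"
    have "t0 * h n \<le> 1 * h n" by (rule mult_right_mono) (use t0 h_pos[of n] in auto)
    then have b: "0 < b" "b \<le> \<kappa> / 2"
      unfolding b_def using mult_pos_pos[OF t0(1) h_pos[of n]] elim(2) by linarith+
    define s where "s = (1 - \<theta>) * b"
    have s: "s > 0" using \<theta> b by (simp add: s_def)
    have "2 * \<delta> n \<le> \<theta> * b" using elim(1) h_pos[of n] by (simp add: b_def field_simps)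
    then have sd: "s + 2 * \<delta> n \<le> t0 * h n" by (simp add: s_def b_def algebra_simps)
    have bs: "b \<le> (1 + 2 * \<theta>) * s"
    proof -
      have "\<theta> * (2 * \<theta>) \<le> \<theta> * 1" using \<theta> by (intro mult_left_mono) auto
      then have "1 \<le> (1 + 2 * \<theta>) * (1 - \<theta>)" by (simp add: algebra_simps)
      then have "1 * b \<le> (1 + 2 * \<theta>) * (1 - \<theta>) * b" using b by (intro mult_right_mono) auto
      then show ?thesis by (simp add: s_def mult.assoc)
    qed
    show ?case
    proof (intro ballI)
      fix x y assume xy: "x \<in> X" "y \<in> X"
      have dn: "0 \<le> d x y" using d_nonneg xy by simp
      define m where "m = nat \<lceil>d x y / s\<rceil>"
      have "0 \<le> d x y / s" using dn s by simp
      then have "real m = real_of_int \<lceil>d x y / s\<rceil>" by (simp add: m_def)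
      then have "d x y / s \<le> real m" "real m \<le> d x y / s + 1" by linarith+
      then have m: "d x y \<le> real m * s" "(real m - 1) * s \<le> d x y" using s by (simp_all add: field_simps)
      have "real m * b \<le> d x y + \<kappa>"
      proof (cases "m = 0")
        case False
        then have "(real m - 1) * b \<le> (real m - 1) * ((1 + 2 * \<theta>) * s)" using bs by (intro mult_left_mono) auto
        also have "\<dots> = (1 + 2 * \<theta>) * ((real m - 1) * s)" by (simp add: algebra_simps)
        also have "\<dots> \<le> (1 + 2 * \<theta>) * d x y" using m(2) \<theta> by (intro mult_left_mono) auto
        also have "\<dots> \<le> d x y + 2 * \<theta> * M"
          using M(2) xy \<theta> mult_left_mono[of "d x y" M "2 * \<theta>"] by (simp add: algebra_simps)
        finally have "(real m - 1) * b \<le> d x y + \<kappa> / 2" using \<theta>M by linarith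
        then show ?thesis using b(2) by (simp add: algebra_simps)
      qed (use dn \<kappa> in simp)
      then show "D n (\<pi> n x) (\<pi> n y) \<le> ennreal (d x y + \<kappa>)"
        using graph_dist_chain[OF t0(1,3) less_imp_le[OF s] sd xy m(1)] unfolding b_def
        by (meson ennreal_leI order_trans)
    qed
  qed
qed

lemma eventually_graph_dist_finite:
  "\<forall>\<^sub>F n in sequentially. \<forall>x\<in>V n. \<forall>y\<in>V n. D n x y < \<infinity>"
  using eventually_graph_dist_le[OF zero_less_one]
proof eventually_elim
  case (elim n)
  show ?case
  proof (intro ballI)
    fix x y assume xy: "x \<in> V n" "y \<in> V n"
    then have "x \<in> X" "y \<in> X" using V_subset by blast+
    then have "D n (\<pi> n x) (\<pi> n y) \<le> ennreal (d x y + 1)" using elim by blast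
    then show "D n x y < \<infinity>" using proj_id xy by (auto intro: order_le_less_trans)
  qed
qed

end

section \<open>Convergence of the graph solutions\<close>

text \<open>
  The labelled vertices are \<open>B n\<close> with labels \<open>gn n\<close>, and \<open>\<pi>S\<close> projects the limit set \<open>S\<close> of labelled points
  to them.
\<close>

locale graph_solutions = graph_approximation X d V \<eta> h \<delta> \<pi>
  for X :: "'a::euclidean_space set" and d V \<eta> h \<delta> \<pi> +
  fixes S :: "'a set" and B :: "nat \<Rightarrow> 'a set" and \<pi>S :: "nat \<Rightarrow> 'a \<Rightarrow> 'a"
    and gn u :: "nat \<Rightarrow> 'a \<Rightarrow> real" and g :: "'a \<Rightarrow> real" and L C0 :: real
  assumes S: "S \<subseteq> X" "S \<noteq> {}" "closed S"
    and B_subset: "B n \<subseteq> V n"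
    and B_near: "b \<in> B n \<Longrightarrow> \<exists>z\<in>S. dist b z \<le> \<delta> n"
    and projS_in: "z \<in> S \<Longrightarrow> \<pi>S n z \<in> B n"
    and projS_dist: "z \<in> S \<Longrightarrow> dist z (\<pi>S n z) \<le> \<delta> n"
    and L: "L > 0"
    and gn_lip: "x \<in> B n \<Longrightarrow> y \<in> B n \<Longrightarrow> D n x y < \<infinity> \<Longrightarrow> \<bar>gn n x - gn n y\<bar> \<le> L * enn2real (D n x y)"
    and gn_near: "z \<in> S \<Longrightarrow> \<bar>gn n (\<pi>S n z) - g z\<bar> \<le> C0 * \<delta> n" and C0: "C0 > 0"
    and solves: "solves_graph_inf_laplace \<eta> (h n) (V n) (B n) (gn n) (u n)"
begin

lemma eventually_lipschitz:
  assumes \<kappa>: "\<kappa> > 0"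
  shows "\<forall>\<^sub>F n in sequentially. \<forall>x\<in>X. \<forall>y\<in>X. \<bar>u n (\<pi> n x) - u n (\<pi> n y)\<bar> \<le> L * (d x y + \<kappa>)"
  using eventually_graph_dist_le[OF \<kappa>] eventually_graph_dist_finite
proof eventually_elim
  case (elim n)
  show ?case
  proof (intro ballI)
    fix x y assume xy: "x \<in> X" "y \<in> X"
    have "\<bar>u n (\<pi> n x) - u n (\<pi> n y)\<bar> \<le> L * enn2real (D n (\<pi> n x) (\<pi> n y))"
    proof (rule solution_lipschitz[OF kernel h_pos V_finite B_subset L _ solves])
      show "\<bar>gn n x - gn n y\<bar> \<le> L * enn2real (D n x y)" if "x \<in> B n" "y \<in> B n" for x y
      proof (rule gn_lip[OF that])
        have "x \<in> V n" "y \<in> V n" using that B_subset by blast+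
        then show "D n x y < \<infinity>" using elim(2) by blast
      qed
    qed (use elim(2) proj_in xy in auto)
    also have "enn2real (D n (\<pi> n x) (\<pi> n y)) \<le> d x y + \<kappa>"
    proof (rule enn2real_leI)
      show "D n (\<pi> n x) (\<pi> n y) \<le> ennreal (d x y + \<kappa>)" using elim(1) xy by blast
    qed (use d_nonneg[OF xy] \<kappa> in simp)
    then have "L * enn2real (D n (\<pi> n x) (\<pi> n y)) \<le> L * (d x y + \<kappa>)" using L by simp
    finally show "\<bar>u n (\<pi> n x) - u n (\<pi> n y)\<bar> \<le> L * (d x y + \<kappa>)" .
  qed
qed

lemma eventually_boundary:
  assumes z: "z \<in> S" and \<kappa>: "\<kappa> > 0"
  shows "\<forall>\<^sub>F n in sequentially. \<bar>u n (\<pi> n z) - g z\<bar> \<le> \<kappa>"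
proof -
  define e where "e = \<kappa> / (4 * L)"
  have e: "e > 0" "L * (e + e) = \<kappa> / 2" using \<kappa> L by (simp_all add: e_def)
  obtain \<rho> where "\<rho> > 0" and \<rho>: "\<forall>x\<in>X. \<forall>y\<in>X. dist x y < \<rho> \<longrightarrow> d x y < e"
    using d_small[OF e(1)] by blast
  have "\<kappa> / (2 * C0) > 0" using \<kappa> C0 by simp
  from eventually_\<delta>_small[OF this] eventually_\<delta>_small[OF \<open>\<rho> > 0\<close>] eventually_lipschitz[OF e(1)]
  show ?thesis
  proof eventually_elim
    case (elim n)
    let ?b = "\<pi>S n z"
    have b: "?b \<in> B n" "?b \<in> V n" "?b \<in> X" "z \<in> X"
      using projS_in[OF z, of n] B_subset[of n] V_subset[of n] S(1) z by blast+
    have "dist z ?b < \<rho>" using projS_dist[OF z, of n] elim(2) by simp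
    then have "d z ?b < e" using \<rho> b by blast
    then have "L * (d z ?b + e) \<le> L * (e + e)" using L by (intro mult_left_mono) auto
    moreover have "\<bar>u n (\<pi> n z) - u n (\<pi> n ?b)\<bar> \<le> L * (d z ?b + e)" using elim(3) b by blast
    moreover have "u n (\<pi> n ?b) = gn n ?b"
      using proj_id[OF b(2)] solves[of n] b(1) by (simp add: solves_graph_inf_laplace_def)
    moreover have "\<bar>gn n ?b - g z\<bar> \<le> \<kappa> / 2"
    proof -
      have "C0 * \<delta> n \<le> C0 * (\<kappa> / (2 * C0))" using elim(1) C0 by (intro mult_left_mono) auto
      then show ?thesis using gn_near[OF z, of n] C0 by simp
    qed
    ultimately show ?case using e(2) by linarith
  qed
qed

lemma eventually_bounded: "\<exists>C>0. \<forall>\<^sub>F n in sequentially. \<forall>x\<in>X. \<bar>u n (\<pi> n x)\<bar> \<le> C"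
proof -
  obtain M where M: "M > 0" "\<forall>x\<in>X. \<forall>y\<in>X. d x y \<le> M" using d_bounded by blast
  obtain z where z: "z \<in> S" using S by blast
  have "\<forall>\<^sub>F n in sequentially. \<forall>x\<in>X. \<bar>u n (\<pi> n x)\<bar> \<le> \<bar>g z\<bar> + 1 + L * (M + 1)"
    using eventually_boundary[OF z zero_less_one] eventually_lipschitz[OF zero_less_one]
  proof eventually_elim
    case (elim n)
    show ?case
    proof
      fix x assume x: "x \<in> X"
      have zX: "z \<in> X" using z S by blast
      have "\<bar>u n (\<pi> n x) - u n (\<pi> n z)\<bar> \<le> L * (d x z + 1)" using elim(2) x zX by blast
      moreover have "L * (d x z + 1) \<le> L * (M + 1)" using M(2) x zX L by (intro mult_left_mono) auto
      ultimately show "\<bar>u n (\<pi> n x)\<bar> \<le> \<bar>g z\<bar> + 1 + L * (M + 1)" using elim(1) by linarith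
    qed
  qed
  moreover have "\<bar>g z\<bar> + 1 + L * (M + 1) > 0" using L M(1) by (simp add: add_nonneg_pos)
  ultimately show ?thesis by blast
qed

lemma gap_to_labels:
  assumes x: "x \<in> X" and far: "\<forall>z\<in>S. d x z > r"
  shows "\<exists>\<gamma>>0. \<forall>z\<in>S. d x z \<ge> r + \<gamma>"
proof -
  have "compact (X \<inter> S)" by (rule compact_Int_closed[OF compact_space S(3)])
  then have "compact S" using S(1) by (simp add: Int_absorb1)
  then obtain z where z: "z \<in> S" "\<And>w. w \<in> S \<Longrightarrow> d x z \<le> d x w"
    using continuous_attains_inf[OF _ S(2) continuous_on_subset[OF continuous_on_d[OF x] S(1)]] by blast
  have "d x z - r > 0" using far z(1) by simp
  then show ?thesis using z(2) by (intro exI[of _ "d x z - r"]) auto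
qed

text \<open>
  Comparison with the graph cone with vertex \<open>\<pi> n x\<close> on the vertices \<open>A\<close> within distance \<open>2 * \<epsilon>\<close> of \<open>x\<close>. Far
  neighbours of \<open>A\<close> lie just outside this ball, where the graph distance from the vertex is at least
  \<open>R = 2 * \<epsilon> - \<tau>\<close> and \<open>u\<close> is at most \<open>m\<close>. So the cone with slope \<open>a\<close>, which reaches \<open>m + \<kappa>/2\<close> at distance \<open>R\<close>,
  dominates \<open>u\<close> there. At \<open>\<pi> n y\<close> the graph distance is at most \<open>\<epsilon> + \<tau>\<close>, which exceeds \<open>R / 2\<close> by \<open>3 * \<tau> / 2\<close>.
\<close>

lemma asymptotic_cone:
  assumes x: "x \<in> X" and \<epsilon>: "\<epsilon> > 0" and far: "\<forall>z\<in>S. d x z > 2 * \<epsilon>" and y: "y \<in> X" "d x y \<le> \<epsilon>"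
    and \<beta>: "\<beta> > 0" and \<kappa>: "\<kappa> > 0"
    and m: "\<forall>\<^sub>F n in sequentially. \<forall>w\<in>X. d x w \<le> 2 * \<epsilon> + \<beta> \<longrightarrow> u n (\<pi> n w) \<le> m"
  shows "\<forall>\<^sub>F n in sequentially. 2 * u n (\<pi> n y) \<le> u n (\<pi> n x) + m + \<kappa>"
proof -
  obtain \<gamma> where \<gamma>: "\<gamma> > 0" "\<forall>z\<in>S. d x z \<ge> 2 * \<epsilon> + \<gamma>" using gap_to_labels[OF x far] by blast
  obtain C where C: "C > 0" "\<forall>\<^sub>F n in sequentially. \<forall>x\<in>X. \<bar>u n (\<pi> n x)\<bar> \<le> C" using eventually_bounded by blast
  define T where "T = \<bar>m\<bar> + \<kappa> + C"
  have T: "T > 0" using \<kappa> C by (simp add: T_def)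
  \<comment> \<open>\<open>T / \<epsilon>\<close> bounds the slope \<open>a\<close> below, so \<open>3 * \<tau> * a \<le> \<kappa>/2\<close>; the bound \<open>\<tau> \<le> \<epsilon>\<close> gives \<open>R \<ge> \<epsilon>\<close>.\<close>
  define \<tau> where "\<tau> = min \<epsilon> (\<kappa> * \<epsilon> / (6 * T))"
  have \<tau>: "\<tau> > 0" "\<tau> \<le> \<epsilon>" using \<epsilon> \<kappa> T by (auto simp: \<tau>_def)
  have "\<tau> \<le> \<kappa> * \<epsilon> / (6 * T)" by (simp add: \<tau>_def)
  then have \<tau>T: "3 * \<tau> * T \<le> \<kappa> / 2 * \<epsilon>" using T by (simp add: field_simps)
  have \<tau>2: "\<tau> / 2 > 0" using \<tau> by simp
  define e where "e = min \<gamma> \<beta>"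
  have e: "e > 0" "e \<le> \<gamma>" "e \<le> \<beta>" using \<gamma> \<beta> by (auto simp: e_def)
  obtain \<rho> where "\<rho> > 0" and \<rho>: "\<forall>x\<in>X. \<forall>y\<in>X. dist x y < \<rho> \<longrightarrow> d x y < e"
    using d_small[OF e(1)] by blast
  from m C(2) eventually_proj_near[OF \<tau>2] eventually_graph_dist_ge[OF \<tau>2] eventually_graph_dist_le[OF \<tau>(1)]
    eventually_graph_dist_finite eventually_h_small[OF \<open>\<rho> > 0\<close>] eventually_\<delta>_small[OF \<open>\<rho> > 0\<close>]
    eventually_proj_near[OF \<epsilon>]
  show ?thesis
  proof eventually_elim
    case (elim n)
    define x' y' where "x' = \<pi> n x" and "y' = \<pi> n y"
    have V: "x' \<in> V n" "y' \<in> V n" using proj_in x y by (auto simp: x'_def y'_def)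
    have VX: "z \<in> X" if "z \<in> V n" for z using V_subset that by blast
    have u_le: "u n z \<le> m" if "z \<in> V n" "d x z \<le> 2 * \<epsilon> + \<beta>" for z
    proof -
      have "u n (\<pi> n z) \<le> m" using elim(1) VX[OF that(1)] that(2) by blast
      then show ?thesis using proj_id[OF that(1)] by simp
    qed
    define c where "c = u n x'"
    have c: "c \<le> m" "\<bar>c\<bar> \<le> C"
      using elim(1,2) x d_refl[OF x] \<epsilon> \<beta> by (auto simp: c_def x'_def)
    define R where "R = 2 * \<epsilon> - \<tau>"
    have R: "R \<ge> \<epsilon>" "R > 0" using \<tau> \<epsilon> by (auto simp: R_def)
    define t where "t = m + \<kappa> / 2 - c"
    have t: "t > 0" "t \<le> T" using c \<kappa> by (auto simp: t_def T_def)
    define a where "a = t / R"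
    have a: "a > 0" "a * R = t" using t R by (auto simp: a_def)
    define A where "A = {w\<in>V n. w \<noteq> x' \<and> d x w \<le> 2 * \<epsilon>}"
    have "w \<notin> B n" if w: "w \<in> A" for w
    proof
      assume "w \<in> B n"
      then obtain z where z: "z \<in> S" "dist w z \<le> \<delta> n" using B_near by blast
      have wzX: "w \<in> X" "z \<in> X" using w VX z S by (auto simp: A_def)
      have "dist w z < \<rho>" using z(2) elim(8) by simp
      then have "d w z < \<gamma>" using \<rho> wzX e(2) by force
      then have "d x z < 2 * \<epsilon> + \<gamma>" using d_triangle[OF x wzX] w by (simp add: A_def)
      then show False using \<gamma>(2) z(1) by force
    qed
    then have A: "A \<subseteq> V n - B n" "x' \<notin> A" by (auto simp: A_def)
    have cone: "u n w \<le> c + a * enn2real (D n x' w)" if w: "w \<in> A" for w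
    proof (rule solution_cone_comparison[OF kernel h_pos V_finite A V(1) a(1) _ solves _ w])
      show "D n x' z < \<infinity>" if "z \<in> V n" for z using elim(6) V(1) that by blast
      show "u n z \<le> c + a * enn2real (D n x' z)"
        if w: "w \<in> A" and z: "z \<in> V n - A" and wt: "graph_weight \<eta> (h n) w z > 0" for w z
      proof (cases "z = x'")
        case False
        then have dz: "d x z > 2 * \<epsilon>" using z by (auto simp: A_def)
        have wzX: "w \<in> X" "z \<in> X" using w z VX by (auto simp: A_def)
        have "dist w z < \<rho>" using graph_weight_pos(1)[OF kernel h_pos wt] elim(7) by simp
        then have "d w z < \<beta>" using \<rho> wzX e(3) by force
        then have "d x z \<le> 2 * \<epsilon> + \<beta>" using d_triangle[OF x wzX] w by (simp add: A_def)
        then have "u n z \<le> m" using u_le z by simp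
        also have "m \<le> c + a * R" using a(2) \<kappa> by (simp add: t_def)
        also have "c + a * R \<le> c + a * enn2real (D n x' z)"
        proof -
          have "d x x' < \<tau> / 2" using elim(3) x by (simp add: x'_def)
          then have "R \<le> d x' z - \<tau> / 2"
            using d_triangle[OF x VX[OF V(1)] wzX(2)] dz by (simp add: R_def)
          moreover have "ennreal (d x' z - \<tau> / 2) \<le> D n x' z" using elim(4) V(1) z by blast
          ultimately have "ennreal R \<le> D n x' z" by (meson ennreal_leI order_trans)
          moreover have "D n x' z < \<infinity>" using elim(6) V(1) z by blast
          ultimately have "R \<le> enn2real (D n x' z)"
            using enn2real_mono[of "ennreal R" "D n x' z"] R(2) by simp
          then show ?thesis using a(1) by simp
        qed
        finally show ?thesis .
      qed (simp add: c_def)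
    qed
    have "u n y' \<le> c + a * (\<epsilon> + \<tau>)"
    proof (cases "y' = x'")
      case True
      then show ?thesis using a(1) \<epsilon> \<tau> by (simp add: c_def)
    next
      case False
      have "d y y' < \<epsilon>" using elim(9) y by (simp add: y'_def)
      then have "d x y' \<le> 2 * \<epsilon>" using d_triangle[OF x y(1) VX[OF V(2)]] y(2) by simp
      then have "y' \<in> A" using False V(2) by (simp add: A_def)
      moreover have "enn2real (D n x' y') \<le> \<epsilon> + \<tau>"
      proof (rule enn2real_leI)
        have "D n x' y' \<le> ennreal (d x y + \<tau>)" using elim(5) x y(1) by (simp add: x'_def y'_def)
        also have "\<dots> \<le> ennreal (\<epsilon> + \<tau>)" using y(2) by (intro ennreal_leI) simp
        finally show "D n x' y' \<le> ennreal (\<epsilon> + \<tau>)" .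
      qed (use \<epsilon> \<tau> in simp)
      then have "a * enn2real (D n x' y') \<le> a * (\<epsilon> + \<tau>)" using a(1) by simp
      ultimately show ?thesis using cone by force
    qed
    moreover have "2 * (a * (\<epsilon> + \<tau>)) \<le> t + \<kappa> / 2"
    proof -
      have "a * \<epsilon> \<le> a * R" using a(1) R(1) by (intro mult_left_mono) auto
      then have "a * \<epsilon> \<le> T" using a(2) t(2) by simp
      then have "3 * \<tau> * (a * \<epsilon>) \<le> 3 * \<tau> * T" using \<tau> by (intro mult_left_mono) auto
      then have "(3 * \<tau> * a) * \<epsilon> \<le> \<kappa> / 2 * \<epsilon>" using \<tau>T by (simp add: mult_ac)
      then have "3 * \<tau> * a \<le> \<kappa> / 2" using \<epsilon> by (rule mult_right_le_imp_le)
      moreover have "2 * (a * (\<epsilon> + \<tau>)) = a * R + 3 * \<tau> * a" by (simp add: R_def algebra_simps)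
      ultimately show ?thesis using a(2) by simp
    qed
    ultimately have "2 * u n y' \<le> c + m + \<kappa>" unfolding t_def by linarith
    then show "2 * u n (\<pi> n y) \<le> u n (\<pi> n x) + m + \<kappa>" by (simp add: c_def x'_def y'_def)
  qed
qed

lemma eventually_le:
  assumes w: "continuous_on X w" "\<And>z. z \<in> S \<Longrightarrow> w z = g z" and cc: "cone_subsolution S (\<lambda>x. - w x)"
    and \<kappa>: "\<kappa> > 0"
  shows "\<forall>\<^sub>F n in sequentially. \<forall>x\<in>X. u n (\<pi> n x) \<le> w x + \<kappa>"
proof -
  obtain C where C: "\<forall>\<^sub>F n in sequentially. \<forall>x\<in>X. \<bar>u n (\<pi> n x)\<bar> \<le> C" using eventually_bounded by blast
  show ?thesis
  proof (rule asymptotic_comparison[where S = S, OF _ C asymptotic_cone _ w(1) cc S(1,2) \<kappa>])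
    fix e :: real assume "e > 0"
    then have e: "e / (2 * L) > 0" using L by simp
    have "\<forall>\<^sub>F n in sequentially. \<forall>x\<in>X. \<forall>y\<in>X. d x y < e / (2 * L) \<longrightarrow> \<bar>u n (\<pi> n x) - u n (\<pi> n y)\<bar> \<le> e"
      using eventually_lipschitz[OF e]
    proof eventually_elim
      case (elim n)
      show ?case
      proof (intro ballI impI)
        fix x y assume xy: "x \<in> X" "y \<in> X" "d x y < e / (2 * L)"
        have "\<bar>u n (\<pi> n x) - u n (\<pi> n y)\<bar> \<le> L * (d x y + e / (2 * L))" using elim xy by blast
        also have "\<dots> \<le> L * (e / (2 * L) + e / (2 * L))" using xy L by (intro mult_left_mono) auto
        also have "\<dots> = e" using L by (simp add: field_simps)
        finally show "\<bar>u n (\<pi> n x) - u n (\<pi> n y)\<bar> \<le> e" .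
      qed
    qed
    then show "\<exists>\<rho>>0. \<forall>\<^sub>F n in sequentially. \<forall>x\<in>X. \<forall>y\<in>X. d x y < \<rho> \<longrightarrow> \<bar>u n (\<pi> n x) - u n (\<pi> n y)\<bar> \<le> e"
      using e by blast
  next
    fix z e assume z: "z \<in> S" and e: "(0::real) < e"
    show "\<forall>\<^sub>F n in sequentially. u n (\<pi> n z) \<le> w z + e"
      using eventually_boundary[OF z e] by eventually_elim (use w(2)[OF z] in \<open>simp add: abs_le_iff\<close>)
  qed
qed

lemma graph_solutions_uminus:
  "graph_solutions X d V \<eta> h \<delta> \<pi> S B \<pi>S (\<lambda>n x. - gn n x) (\<lambda>n x. - u n x) (\<lambda>x. - g x) L C0"
proof
  show "\<bar>- gn n x - - gn n y\<bar> \<le> L * enn2real (D n x y)" if "x \<in> B n" "y \<in> B n" "D n x y < \<infinity>" for n x y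
    using gn_lip[OF that] by (simp add: abs_minus_commute)
  show "\<bar>- gn n (\<pi>S n z) - - g z\<bar> \<le> C0 * \<delta> n" if "z \<in> S" for n z
    using gn_near[OF that, of n] by (simp add: abs_minus_commute)
  show "solves_graph_inf_laplace \<eta> (h n) (V n) (B n) (\<lambda>x. - gn n x) (\<lambda>x. - u n x)" for n
    by (rule solves_graph_inf_laplace_uminus[OF V_finite solves])
qed (use S B_subset B_near projS_in projS_dist L C0 in auto)

lemma uniform_limit_solutions:
  assumes w: "continuous_on X w" "\<And>z. z \<in> S \<Longrightarrow> w z = g z"
    and cc: "cone_subsolution S w" "cone_subsolution S (\<lambda>x. - w x)"
  shows "uniform_limit X (\<lambda>n. u n \<circ> \<pi> n) w sequentially"
proof (rule uniform_limitI)
  fix e :: real assume "e > 0"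
  then have e: "e / 2 > 0" by simp
  interpret neg: graph_solutions X d V \<eta> h \<delta> \<pi> S B \<pi>S "\<lambda>n x. - gn n x" "\<lambda>n x. - u n x" "\<lambda>x. - g x" L C0
    by (rule graph_solutions_uminus)
  have "\<forall>\<^sub>F n in sequentially. \<forall>x\<in>X. - u n (\<pi> n x) \<le> - w x + e / 2"
    by (rule neg.eventually_le) (use w cc e in \<open>auto intro: continuous_on_minus\<close>)
  moreover have "\<forall>\<^sub>F n in sequentially. \<forall>x\<in>X. u n (\<pi> n x) \<le> w x + e / 2"
    by (rule eventually_le[OF w(1) _ cc(2) e]) (rule w(2))
  ultimately show "\<forall>\<^sub>F n in sequentially. \<forall>x\<in>X. dist ((u n \<circ> \<pi> n) x) (w x) < e"
  proof eventually_elim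
    case (elim n)
    show ?case
    proof
      fix x assume x: "x \<in> X"
      have "u n (\<pi> n x) \<le> w x + e / 2" "- u n (\<pi> n x) \<le> - w x + e / 2" using elim x by auto
      then show "dist ((u n \<circ> \<pi> n) x) (w x) < e" using \<open>e > 0\<close> by (simp add: dist_real_def abs_less_iff)
    qed
  qed
qed

end

section \<open>The convergence theorem\<close>

lemma infdist_le_hausdorff_dist:
  fixes A B :: "'a::metric_space set"
  assumes "bounded A" "bounded B" "A \<noteq> {}" "B \<noteq> {}"
  shows "x \<in> A \<Longrightarrow> infdist x B \<le> hausdorff_dist A B" "x \<in> B \<Longrightarrow> infdist x A \<le> hausdorff_dist A B"
proof -
  have bdd: "bdd_above ((\<lambda>x. infdist x B) ` A)" if "bounded A" "B \<noteq> {}" for A B :: "'a set"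
  proof -
    from that(2) obtain b where b: "b \<in> B" by blast
    from that(1) obtain r where r: "\<forall>x\<in>A. dist b x \<le> r"
      using bounded_any_center[of A b] by blast
    have "infdist x B \<le> r" if "x \<in> A" for x
      using infdist_le[OF b, of x] r that by (fastforce simp: dist_commute[of b])
    then show ?thesis by (intro bdd_aboveI2)
  qed
  show "infdist x B \<le> hausdorff_dist A B" if "x \<in> A"
    unfolding hausdorff_dist_def by (intro max.coboundedI1 cSUP_upper that bdd assms)
  show "infdist x A \<le> hausdorff_dist A B" if "x \<in> B"
    unfolding hausdorff_dist_def by (intro max.coboundedI2 cSUP_upper that bdd assms)
qed

lemma closest_point_projectionD:
  assumes "closest_point_projection S P \<pi>" "x \<in> S"
  shows "\<pi> x \<in> P" "p \<in> P \<Longrightarrow> dist x (\<pi> x) \<le> dist x p" "dist x (\<pi> x) \<le> infdist x P"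
proof -
  show in_P: "\<pi> x \<in> P"
    using assms unfolding closest_point_projection_def is_arg_min_def by blast
  have le: "dist x (\<pi> x) \<le> dist x p" if "p \<in> P" for p
    using assms that unfolding closest_point_projection_def is_arg_min_def dist_norm by force
  then show "dist x (\<pi> x) \<le> dist x p" if "p \<in> P" using that .
  show "dist x (\<pi> x) \<le> infdist x P"
    unfolding infdist_def using le in_P by (auto intro!: cINF_greatest)
qed

text \<open>
  Distinct vertices thus have positive graph distance, which turns the extended Lipschitz constant of
  the labels into a real estimate.
\<close>

lemma dist_le_graph_dist:
  fixes x :: "'a::euclidean_space"
  assumes \<eta>: "kernel_assumption \<eta>" and h: "h > 0" and x: "x \<in> V"
  shows "ennreal (dist x y) \<le> graph_dist \<eta> h V x y"
proof -
  have "ennreal (dist x y / 1) \<le> graph_dist \<eta> h V x y"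
    by (rule graph_dist_ge[OF x])
      (use graph_weight_pos(2)[OF \<eta> h] graph_weight_nonneg[OF \<eta> h] in \<open>auto intro: dist_triangle\<close>)
  then show ?thesis by simp
qed

lemma graph_lip_const_bound:
  fixes V :: "'a::euclidean_space set"
  assumes \<eta>: "kernel_assumption \<eta>" and h: "h > 0" and x: "x \<in> A" "x \<in> V" and y: "y \<in> A"
    and lip: "lip_const (graph_dist \<eta> h V) g A \<le> ennreal L" and L: "L \<ge> 0"
    and fin: "graph_dist \<eta> h V x y < \<infinity>"
  shows "\<bar>g x - g y\<bar> \<le> L * graph_real \<eta> h V x y"
proof (cases "x = y")
  case False
  have e: "graph_dist \<eta> h V x y = ennreal (graph_real \<eta> h V x y)" using fin by (simp add: less_top)
  have "ennreal (dist x y) \<le> ennreal (graph_real \<eta> h V x y)"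
    using dist_le_graph_dist[OF \<eta> h x(2), of y] unfolding e[symmetric] .
  then have "dist x y \<le> graph_real \<eta> h V x y" by (subst (asm) ennreal_le_iff) auto
  then have "0 < graph_real \<eta> h V x y" using False by (metis less_le_trans zero_less_dist_iff)
  then show ?thesis using lip_constD[OF lip x(1) y False e _ L] by simp
qed simp

theorem corollary2p3:
  fixes \<Omega> \<O> :: "'a::euclidean_space set"
    and g u :: "'a \<Rightarrow> real"
    and \<Omega>n \<O>n :: "nat \<Rightarrow> 'a set"
    and gn un :: "nat \<Rightarrow> 'a \<Rightarrow> real"
    and \<pi> \<pi>\<O> :: "nat \<Rightarrow> 'a \<Rightarrow> 'a"
    and \<eta> :: "real \<Rightarrow> real"
    and h \<delta> :: "nat \<Rightarrow> real"
  assumes "open \<Omega>" "bounded \<Omega>" "connected \<Omega>" "\<Omega> \<noteq> {}"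
    and "domain_assumption \<Omega>"
    and "\<O> \<subseteq> closure \<Omega>" "\<O> \<noteq> {}" "closed \<O>"
    and "\<And>n. \<Omega>n n \<subseteq> closure \<Omega>" "\<And>n. finite (\<Omega>n n)"
    and "\<And>n. \<O>n n \<subseteq> \<Omega>n n" "\<And>n. \<O>n n \<noteq> {}"
    and "\<And>n. \<delta> n = graph_resolution \<Omega> \<O> (\<Omega>n n) (\<O>n n)"
    and "\<And>n. closest_point_projection (closure \<Omega>) (\<Omega>n n) (\<pi> n)"
    and "\<And>n. closest_point_projection \<O> (\<O>n n) (\<pi>\<O> n)"
    and "kernel_assumption \<eta>"
    and "\<And>n. h n > 0"
    and "(SUP n. lip_const (graph_dist \<eta> (h n) (\<Omega>n n)) (gn n) (\<O>n n)) < \<infinity>"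
    and "lip_const (geo_dist \<Omega>) g \<O> < \<infinity>"
    and "\<exists>C0>0. \<forall>n. \<forall>z\<in>\<O>. \<bar>gn n (\<pi>\<O> n z) - g z\<bar> \<le> C0 * \<delta> n"
    and "\<And>n. solves_graph_inf_laplace \<eta> (h n) (\<Omega>n n) (\<O>n n) (gn n) (un n)"
    and "is_AMLE \<Omega> \<O> g u"
    and "(\<lambda>n. \<delta> n / h n) \<longlonglongrightarrow> 0"
    and "h \<longlonglongrightarrow> 0"
  shows "uniform_limit (closure \<Omega>) (\<lambda>n. un n \<circ> \<pi> n) u sequentially"
proof -
  have con: "compact_length_space (closure \<Omega>) (geo_real \<Omega>)"
    by (rule geo_length_space) (use assms(2,3,5) in auto)
  interpret compact_length_space "closure \<Omega>" "geo_real \<Omega>" by (rule con)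
  have bdd: "bounded (closure \<Omega>)" "closure \<Omega> \<noteq> {}" using assms(2,4) by auto
  have bV: "bounded (\<Omega>n n)" "\<Omega>n n \<noteq> {}" for n using assms(9,11,12) bounded_subset[OF bdd(1)] by blast+
  have bO: "bounded \<O>" using assms(6) bounded_subset[OF bdd(1)] by blast
  have bB: "bounded (\<O>n n)" for n using assms(11) bounded_subset[OF bV(1)] by blast
  have res: "hausdorff_dist (\<Omega>n n) (closure \<Omega>) \<le> \<delta> n" "hausdorff_dist (\<O>n n) \<O> \<le> \<delta> n" for n
    unfolding assms(13) graph_resolution_def by auto
  obtain l where l: "(SUP n. lip_const (graph_dist \<eta> (h n) (\<Omega>n n)) (gn n) (\<O>n n)) = ennreal l"
    using assms(18) by (metis ennreal_enn2real infinity_ennreal_def)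
  define L where "L = max l 1"
  have lip: "lip_const (graph_dist \<eta> (h n) (\<Omega>n n)) (gn n) (\<O>n n) \<le> ennreal L" for n
  proof -
    have "lip_const (graph_dist \<eta> (h n) (\<Omega>n n)) (gn n) (\<O>n n) \<le> ennreal l"
      unfolding l[symmetric] by (rule SUP_upper) simp
    also have "\<dots> \<le> ennreal L" by (simp add: L_def ennreal_leI)
    finally show ?thesis .
  qed
  obtain C0 where C0: "C0 > 0" "\<And>n z. z \<in> \<O> \<Longrightarrow> \<bar>gn n (\<pi>\<O> n z) - g z\<bar> \<le> C0 * \<delta> n"
    using assms(20) by blast
  interpret graph_solutions "closure \<Omega>" "geo_real \<Omega>" \<Omega>n \<eta> h \<delta> \<pi> \<O> \<O>n \<pi>\<O> gn un g L C0
  proof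
    note P = closest_point_projectionD[OF assms(14)]
    show "\<pi> n x \<in> \<Omega>n n" if "x \<in> closure \<Omega>" for n x by (rule P(1)[OF that])
    show "dist x (\<pi> n x) \<le> \<delta> n" if "x \<in> closure \<Omega>" for n x
      using P(3)[OF that, of n] infdist_le_hausdorff_dist(2)[OF bV(1) bdd(1) bV(2) bdd(2) that, of n] res(1)[of n]
      by linarith
    show "\<pi> n x = x" if "x \<in> \<Omega>n n" for n x
      using P(2)[of x x n] that assms(9)[of n] by auto
    note Q = closest_point_projectionD[OF assms(15)]
    show "\<pi>\<O> n z \<in> \<O>n n" if "z \<in> \<O>" for n z by (rule Q(1)[OF that])
    show "dist z (\<pi>\<O> n z) \<le> \<delta> n" if "z \<in> \<O>" for n z
      using Q(3)[OF that, of n] infdist_le_hausdorff_dist(2)[OF bB bO assms(12,7) that, of n] res(2)[of n]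
      by linarith
    show "\<exists>z\<in>\<O>. dist b z \<le> \<delta> n" if b: "b \<in> \<O>n n" for n b
    proof -
      obtain z where "z \<in> \<O>" "infdist b \<O> = dist b z"
        using infdist_attains_inf[OF assms(8,7)] by blast
      then show ?thesis
        using infdist_le_hausdorff_dist(1)[OF bB bO assms(12,7) b] res(2)[of n] by force
    qed
    show "\<bar>gn n x - gn n y\<bar> \<le> L * graph_real \<eta> (h n) (\<Omega>n n) x y"
      if "x \<in> \<O>n n" "y \<in> \<O>n n" "graph_dist \<eta> (h n) (\<Omega>n n) x y < \<infinity>" for n x y
      using graph_lip_const_bound[OF assms(16,17) that(1) _ that(2) lip _ that(3)] assms(11)[of n] that(1)
      by (auto simp: L_def)
    show "solves_graph_inf_laplace \<eta> (h n) (\<Omega>n n) (\<O>n n) (gn n) (un n)" for n by (rule assms(21))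
    show "L > 0" by (simp add: L_def)
  qed (use assms(6-12,16,17,23,24) C0 in auto)
  show ?thesis
  proof (rule uniform_limit_solutions)
    show "continuous_on (closure \<Omega>) u" "\<And>z. z \<in> \<O> \<Longrightarrow> u z = g z"
      using assms(22) by (auto simp: is_AMLE_def)
    show "cone_subsolution \<O> u" by (rule is_AMLE_cone_subsolution[OF assms(5,3,2,22)])
    show "cone_subsolution \<O> (\<lambda>x. - u x)"
      by (rule is_AMLE_cone_subsolution[OF assms(5,3,2) is_AMLE_uminus[OF assms(22)]])
  qed
qed

end
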